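(* Let $G=G_1\ast G_2$ be a free product of finite groups given by finite presentations $G_1=\langle X_1\mid R_1\rangle$, $G_2=\langle X_2\mid R_2\rangle$ with $X_1^{\pm}\cap X_2^{\pm}=\emptyset$, so that $G=\langle X_1,X_2\mid R_1,R_2\rangle$. Let $h_1,\ldots,h_n\in G$ (given as words over $X_1^{\pm}\cup X_2^{\pm}$). Then there exists an algorithm which computes a Kurosh decomposition of the subgroup $H=\langle h_1,\ldots,h_n\rangle\le G$.
   Context: For a set $Y$, $Y^{\pm}=Y\cup Y^{-1}$ is the set of letters of $Y$ together with their formal inverses. A Kurosh decomposition of a subgroup $H\le G=G_1\ast G_2$ is an (internal) free product decomposition $H=F\ast\bigl(\ast_j\, g_jH_jg_j^{-1}\bigr)$, where $F$ is a free group, each $g_j\in G$, and each $H_j$ is a subgroup of one of the free factors $G_1$, $G_2$. To compute such a decomposition from the finite input $h_1,\ldots,h_n$ means to output a finite set of words over $X_1^{\pm}\cup X_2^{\pm}$ which is a free basis of $F$, together with a finite list of pairs consisting of a word representing $g_j$ and the corresponding subgroup $H_j$ (e.g. given by a finite set of generators) of $G_1$ or $G_2$. *)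

theory Defs
  imports "HOL-Algebra.Generated_Groups" "HOL-Library.Nat_Bijection"
begin

section \<open>Words and presented groups\<close>

text \<open>
  The letter \<open>(x, True)\<close> stands for the generator \<open>x\<close> and \<open>(x, False)\<close> for its formal inverse,
  so \<open>words_over X\<close> is the set of words over the alphabet of letters of \<open>X\<close> and their inverses.
\<close>

type_synonym 'a word = "('a \<times> bool) list"

definition inv_letter :: "'a \<times> bool \<Rightarrow> 'a \<times> bool" where
  "inv_letter p = (fst p, \<not> snd p)"

definition words_over :: "'a set \<Rightarrow> 'a word set" where
  "words_over X = lists (X \<times> UNIV)"

inductive pres_eq :: "'a set \<Rightarrow> 'a word set \<Rightarrow> 'a word \<Rightarrow> 'a word \<Rightarrow> bool"
  for X R where
  refl: "w \<in> words_over X \<Longrightarrow> pres_eq X R w w"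
| sym: "pres_eq X R v w \<Longrightarrow> pres_eq X R w v"
| trans: "pres_eq X R u v \<Longrightarrow> pres_eq X R v w \<Longrightarrow> pres_eq X R u w"
| cancel: "u \<in> words_over X \<Longrightarrow> v \<in> words_over X \<Longrightarrow> fst p \<in> X \<Longrightarrow>
    pres_eq X R (u @ [p, inv_letter p] @ v) (u @ v)"
| relator: "u \<in> words_over X \<Longrightarrow> v \<in> words_over X \<Longrightarrow> r \<in> R \<Longrightarrow> r \<in> words_over X \<Longrightarrow>
    pres_eq X R (u @ r @ v) (u @ v)"

definition pres_rel :: "'a set \<Rightarrow> 'a word set \<Rightarrow> ('a word \<times> 'a word) set" where
  "pres_rel X R = {(v, w). pres_eq X R v w}"

text \<open>The class of a word \<open>w\<close>, that is, the element of the presented group it represents.\<close>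

definition pres_class :: "'a set \<Rightarrow> 'a word set \<Rightarrow> 'a word \<Rightarrow> 'a word set" where
  "pres_class X R w = pres_rel X R `` {w}"

definition presented_group :: "'a set \<Rightarrow> 'a word set \<Rightarrow> 'a word set monoid" where
  "presented_group X R =
     \<lparr>carrier = words_over X // pres_rel X R,
      mult = (\<lambda>A B. \<Union>a\<in>A. \<Union>b\<in>B. pres_class X R (a @ b)),
      one = pres_class X R []\<rparr>"

lemma pres_eq_words: "pres_eq X R v w \<Longrightarrow> v \<in> words_over X \<and> w \<in> words_over X"
  by (induction rule: pres_eq.induct) (auto simp: words_over_def inv_letter_def mem_Times_iff)

lemma equiv_pres_rel: "equiv (words_over X) (pres_rel X R)"
  by (rule equivI)
     (auto simp: refl_on_def sym_def trans_def pres_rel_def dest: pres_eq_words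
           intro: pres_eq.refl pres_eq.sym pres_eq.trans)

lemma pres_eq_context:
  assumes "pres_eq X R v w" "a \<in> words_over X" "b \<in> words_over X"
  shows "pres_eq X R (a @ v @ b) (a @ w @ b)"
  using assms
proof (induction rule: pres_eq.induct)
  case (refl w)
  then show ?case by (auto intro!: pres_eq.refl simp: words_over_def)
next
  case (cancel u v p)
  then show ?case using pres_eq.cancel[of "a @ u" X "v @ b" p R] by (simp add: words_over_def)
next
  case (relator u v r)
  then show ?case using pres_eq.relator[of "a @ u" X "v @ b" r R] by (simp add: words_over_def)
qed (blast intro: pres_eq.sym pres_eq.trans)+

lemma pres_eq_append:
  assumes "pres_eq X R a b" "pres_eq X R c d"
  shows "pres_eq X R (a @ c) (b @ d)"
proof -
  have "pres_eq X R (a @ c) (b @ c)" "pres_eq X R (b @ c) (b @ d)"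
    using pres_eq_context[OF assms(1), of "[]" c] pres_eq_context[OF assms(2), of b "[]"]
      pres_eq_words[OF assms(1)] pres_eq_words[OF assms(2)] by (auto simp: words_over_def)
  then show ?thesis by (rule pres_eq.trans)
qed

lemma carrier_presented_group: "carrier (presented_group X R) = pres_class X R ` words_over X"
  by (auto simp: presented_group_def quotient_def pres_class_def)

lemma pres_class_eq_iff:
  "v \<in> words_over X \<Longrightarrow> w \<in> words_over X \<Longrightarrow>
    pres_class X R v = pres_class X R w \<longleftrightarrow> pres_eq X R v w"
  using eq_equiv_class_iff[OF equiv_pres_rel, of v X w R]
  by (simp add: pres_class_def pres_rel_def del: Image_singleton_iff)

lemma pres_class_mult:
  assumes "v \<in> words_over X" "w \<in> words_over X"
  shows "pres_class X R v \<otimes>\<^bsub>presented_group X R\<^esub> pres_class X R w = pres_class X R (v @ w)"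
proof -
  have eq: "pres_class X R (a @ b) = pres_class X R (v @ w)"
    if "a \<in> pres_class X R v" "b \<in> pres_class X R w" for a b
  proof -
    have "pres_eq X R (v @ w) (a @ b)"
      using that by (intro pres_eq_append) (auto simp: pres_class_def pres_rel_def)
    then show ?thesis
      using pres_eq_words[of X R "v @ w" "a @ b"] pres_class_eq_iff[of "v @ w" X "a @ b" R] by simp
  qed
  have "(\<Union>a\<in>pres_class X R v. \<Union>b\<in>pres_class X R w. pres_class X R (a @ b)) =
      (\<Union>a\<in>pres_class X R v. \<Union>b\<in>pres_class X R w. pres_class X R (v @ w))"
    by (intro SUP_cong HOL.refl eq)
  moreover have "v \<in> pres_class X R v" "w \<in> pres_class X R w"
    using assms by (simp_all add: pres_class_def pres_rel_def pres_eq.refl)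
  then have "pres_class X R v \<noteq> {}" "pres_class X R w \<noteq> {}" by blast+
  ultimately show ?thesis by (simp add: presented_group_def)
qed

lemma words_over_append: "v @ w \<in> words_over X \<longleftrightarrow> v \<in> words_over X \<and> w \<in> words_over X"
  by (auto simp: words_over_def)

lemma words_over_inverse:
  "w \<in> words_over X \<Longrightarrow> rev (map inv_letter w) \<in> words_over X"
  by (induction w) (auto simp: words_over_def inv_letter_def)

lemma pres_eq_left_inverse:
  "w \<in> words_over X \<Longrightarrow> pres_eq X R (rev (map inv_letter w) @ w) []"
proof (induction w)
  case Nil
  then show ?case by (auto intro: pres_eq.refl simp: words_over_def)
next
  case (Cons p w)
  let ?v = "rev (map inv_letter w)"
  have w: "w \<in> words_over X" "?v \<in> words_over X" "fst (inv_letter p) \<in> X"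
    using Cons.prems words_over_inverse[of w X] by (auto simp: words_over_def inv_letter_def)
  have "inv_letter (inv_letter p) = p" by (simp add: inv_letter_def)
  then have "pres_eq X R (?v @ [inv_letter p, p] @ w) (?v @ w)"
    using pres_eq.cancel[of ?v X w "inv_letter p" R] w by simp
  from pres_eq.trans[OF this Cons.IH[OF w(1)]] show ?case by simp
qed

lemma group_presented_group: "group (presented_group X R)"
proof (rule groupI)
  show "\<one>\<^bsub>presented_group X R\<^esub> \<in> carrier (presented_group X R)"
    unfolding carrier_presented_group by (simp add: presented_group_def words_over_def)
next
  fix x assume "x \<in> carrier (presented_group X R)"
  then obtain w where w: "w \<in> words_over X" "x = pres_class X R w"
    unfolding carrier_presented_group by auto
  have one: "\<one>\<^bsub>presented_group X R\<^esub> = pres_class X R []" by (simp add: presented_group_def)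
  have nil: "[] \<in> words_over X" by (simp add: words_over_def)
  show "\<one>\<^bsub>presented_group X R\<^esub> \<otimes>\<^bsub>presented_group X R\<^esub> x = x"
    using w nil by (simp add: one pres_class_mult)
  have v: "rev (map inv_letter w) \<in> words_over X"
    using w(1) by (rule words_over_inverse)
  have vw: "rev (map inv_letter w) @ w \<in> words_over X"
    using v w(1) by (simp add: words_over_def)
  have "pres_class X R (rev (map inv_letter w)) \<otimes>\<^bsub>presented_group X R\<^esub> x = \<one>\<^bsub>presented_group X R\<^esub>"
    using w v vw nil by (simp add: one pres_class_mult pres_class_eq_iff pres_eq_left_inverse)
  then show "\<exists>y\<in>carrier (presented_group X R).
      y \<otimes>\<^bsub>presented_group X R\<^esub> x = \<one>\<^bsub>presented_group X R\<^esub>"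
    unfolding carrier_presented_group using v by blast
next
  fix x y assume "x \<in> carrier (presented_group X R)" "y \<in> carrier (presented_group X R)"
  then obtain v w where vw: "v \<in> words_over X" "w \<in> words_over X"
      "x = pres_class X R v" "y = pres_class X R w"
    unfolding carrier_presented_group by auto
  then have xy: "x \<otimes>\<^bsub>presented_group X R\<^esub> y = pres_class X R (v @ w)"
    by (simp add: pres_class_mult)
  show "x \<otimes>\<^bsub>presented_group X R\<^esub> y \<in> carrier (presented_group X R)"
    unfolding xy carrier_presented_group using vw by (simp add: words_over_append)
  fix z assume "z \<in> carrier (presented_group X R)"
  then obtain u where u: "u \<in> words_over X" "z = pres_class X R u"
    unfolding carrier_presented_group by auto
  show "x \<otimes>\<^bsub>presented_group X R\<^esub> y \<otimes>\<^bsub>presented_group X R\<^esub> z =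
      x \<otimes>\<^bsub>presented_group X R\<^esub> (y \<otimes>\<^bsub>presented_group X R\<^esub> z)"
    using u vw by (simp add: pres_class_mult words_over_append)
qed

section \<open>Free groups, internal free products and Kurosh decompositions\<close>

definition freely_reduced :: "'a word \<Rightarrow> bool" where
  "freely_reduced w = successively (\<lambda>p q. q \<noteq> inv_letter p) w"

definition word_eval :: "('g, 'm) monoid_scheme \<Rightarrow> 'g word \<Rightarrow> 'g" where
  "word_eval G w = foldr (\<lambda>p x. (if snd p then fst p else inv\<^bsub>G\<^esub> fst p) \<otimes>\<^bsub>G\<^esub> x) w \<one>\<^bsub>G\<^esub>"

definition free_basis :: "('g, 'm) monoid_scheme \<Rightarrow> 'g set \<Rightarrow> 'g set \<Rightarrow> bool" where
  "free_basis G B F \<longleftrightarrow>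
     B \<subseteq> carrier G \<and> generate G B = F \<and>
     (\<forall>x\<in>F. \<exists>!w. w \<in> words_over B \<and> freely_reduced w \<and> word_eval G w = x)"

text \<open>
  A reduced sequence for a list \<open>Ks\<close> of subgroups consists of nontrivial elements, each tagged with
  the index of the subgroup it is taken from, such that neighbouring indices differ.
\<close>

definition reduced_sequence ::
    "('g, 'm) monoid_scheme \<Rightarrow> 'g set list \<Rightarrow> (nat \<times> 'g) list \<Rightarrow> bool" where
  "reduced_sequence G Ks s \<longleftrightarrow>
     (\<forall>(i, k)\<in>set s. i < length Ks \<and> k \<in> Ks ! i - {\<one>\<^bsub>G\<^esub>}) \<and>
     successively (\<lambda>p q. fst p \<noteq> fst q) s"

definition internal_free_product ::
    "('g, 'm) monoid_scheme \<Rightarrow> 'g set list \<Rightarrow> 'g set \<Rightarrow> bool" where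
  "internal_free_product G Ks H \<longleftrightarrow>
     (\<forall>K\<in>set Ks. subgroup K G) \<and> generate G (\<Union> (set Ks)) = H \<and>
     (\<forall>x\<in>H. \<exists>!s. reduced_sequence G Ks s \<and> foldr (\<lambda>p y. snd p \<otimes>\<^bsub>G\<^esub> y) s \<one>\<^bsub>G\<^esub> = x)"

definition conjugate :: "('g, 'm) monoid_scheme \<Rightarrow> 'g \<Rightarrow> 'g set \<Rightarrow> 'g set" where
  "conjugate G g K = (\<lambda>k. g \<otimes>\<^bsub>G\<^esub> k \<otimes>\<^bsub>G\<^esub> inv\<^bsub>G\<^esub> g) ` K"

text \<open>
  \<open>A1\<close> and \<open>A2\<close> are the free factors of \<open>G\<close>; the list \<open>L\<close> contains the pairs of a conjugator and
  a subgroup of one of the free factors.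
\<close>

definition kurosh_decomposition ::
    "('g, 'm) monoid_scheme \<Rightarrow> 'g set \<Rightarrow> 'g set \<Rightarrow> 'g set \<Rightarrow> 'g set \<Rightarrow> ('g \<times> 'g set) list \<Rightarrow> bool" where
  "kurosh_decomposition G A1 A2 H F L \<longleftrightarrow>
     (\<exists>B. free_basis G B F) \<and>
     (\<forall>(g, K)\<in>set L. g \<in> carrier G \<and> subgroup K G \<and> (K \<subseteq> A1 \<or> K \<subseteq> A2)) \<and>
     internal_free_product G (F # map (\<lambda>(g, K). conjugate G g K) L) H"

section \<open>Kurosh decompositions given by words\<close>

text \<open>
  For disjoint alphabets, the free product of the groups presented by \<open>(X1, R1)\<close> and \<open>(X2, R2)\<close>
  is the group presented by \<open>(X1 \<union> X2, R1 \<union> R2)\<close>, and its free factors consist of the classes of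
  the words over \<open>X1\<close> and over \<open>X2\<close>.  The finite data are a list \<open>bs\<close> of words,
  pairwise distinct as group elements, forming a basis of the free part, and a list \<open>L\<close> of
  pairs of a conjugating word and a list of words over one of the two alphabets that
  generate the subgroup of the free factor.
\<close>

definition represents_kurosh_decomposition ::
    "'a set \<Rightarrow> 'a word set \<Rightarrow> 'a set \<Rightarrow> 'a word set \<Rightarrow> 'a word list \<Rightarrow>
     'a word list \<Rightarrow> ('a word \<times> 'a word list) list \<Rightarrow> bool" where
  "represents_kurosh_decomposition X1 R1 X2 R2 hs bs L \<longleftrightarrow>
     (let G = presented_group (X1 \<union> X2) (R1 \<union> R2);
          c = pres_class (X1 \<union> X2) (R1 \<union> R2);
          F = generate G (c ` set bs)
      in set bs \<subseteq> words_over (X1 \<union> X2) \<and> distinct (map c bs) \<and> free_basis G (c ` set bs) F \<and>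
         (\<forall>(g, ks)\<in>set L. g \<in> words_over (X1 \<union> X2) \<and>
            (set ks \<subseteq> words_over X1 \<or> set ks \<subseteq> words_over X2)) \<and>
         kurosh_decomposition G (c ` words_over X1) (c ` words_over X2)
           (generate G (c ` set hs)) F (map (\<lambda>(g, ks). (c g, generate G (c ` set ks))) L))"

section \<open>Algorithms\<close>

text \<open>
  Algorithms are programs for partial recursive functions; \<open>computes p xs y\<close> says
  that \<open>p\<close> halts on the arguments \<open>xs\<close> with value \<open>y\<close>.  The argument of recursion and the variable
  of minimization come first in the argument list.
\<close>

datatype recf =
    Zero
  | Succ
  | Proj nat
  | Comp recf "recf list"
  | PrimRec recf recf
  | Mu recf

inductive computes :: "recf \<Rightarrow> nat list \<Rightarrow> nat \<Rightarrow> bool" where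
  Zero: "computes Zero xs 0"
| Succ: "computes Succ [x] (Suc x)"
| Proj: "i < length xs \<Longrightarrow> computes (Proj i) xs (xs ! i)"
| Comp: "list_all2 (\<lambda>g y. computes g xs y) gs ys \<Longrightarrow> computes f ys z \<Longrightarrow>
    computes (Comp f gs) xs z"
| PrimRec_0: "computes f xs y \<Longrightarrow> computes (PrimRec f g) (0 # xs) y"
| PrimRec_Suc: "computes (PrimRec f g) (n # xs) y \<Longrightarrow> computes g (n # y # xs) z \<Longrightarrow>
    computes (PrimRec f g) (Suc n # xs) z"
| Mu: "computes f (n # xs) 0 \<Longrightarrow> (\<forall>m<n. \<exists>y. computes f (m # xs) (Suc y)) \<Longrightarrow>
    computes (Mu f) xs n"

inductive_cases computes_elims:
  "computes Zero xs y"
  "computes Succ xs y"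
  "computes (Proj i) xs y"
  "computes (Comp f gs) xs y"
  "computes (PrimRec f g) (0 # xs) y"
  "computes (PrimRec f g) (Suc n # xs) y"
  "computes (Mu f) xs y"

lemma computes_deterministic: "computes p xs y \<Longrightarrow> computes p xs z \<Longrightarrow> y = z"
proof (induction arbitrary: z rule: computes.induct)
  case (Zero xs)
  then show ?case by (rule computes_elims) simp
next
  case (Succ x)
  then show ?case by (rule computes_elims) simp
next
  case (Proj i xs)
  from Proj.prems show ?case by (rule computes_elims) simp
next
  case (Comp xs gs ys f y)
  from Comp.prems obtain ys' where
    ys': "list_all2 (\<lambda>g. computes g xs) gs ys'" "computes f ys' z"
    by (rule computes_elims)
  have "ys = ys'"
  proof (rule nth_equalityI)
    show "length ys = length ys'"
      using list_all2_lengthD[OF Comp.IH(1)] list_all2_lengthD[OF ys'(1)] by simp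
    fix i assume "i < length ys"
    then show "ys ! i = ys' ! i"
      using list_all2_nthD2[OF Comp.IH(1), of i] list_all2_nthD2[OF ys'(1), of i]
        list_all2_lengthD[OF Comp.IH(1)] list_all2_lengthD[OF ys'(1)] by simp
  qed
  then show ?case using Comp.IH(2) ys'(2) by simp
next
  case (PrimRec_0 f xs y g)
  from PrimRec_0.prems have "computes f xs z" by (rule computes_elims)
  then show ?case by (rule PrimRec_0.IH)
next
  case (PrimRec_Suc f g n xs y z')
  from PrimRec_Suc.prems obtain y' where
    y': "computes (PrimRec f g) (n # xs) y'" "computes g (n # y' # xs) z"
    by (rule computes_elims)
  have "y = y'" using y'(1) by (rule PrimRec_Suc.IH(1))
  then show ?case using y'(2) PrimRec_Suc.IH(2) by simp
next
  case (Mu f n xs)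
  from Mu.prems have z: "computes f (z # xs) 0 \<and> (\<forall>m<z. \<exists>y. computes f (m # xs) (Suc y))"
    by (rule computes_elims) (rule conjI)
  have "\<not> z < n"
  proof
    assume "z < n"
    then have "\<exists>y. computes f (z # xs) (Suc y) \<and> (\<forall>w. computes f (z # xs) w \<longrightarrow> Suc y = w)"
      using Mu.IH(2) by simp
    with z show False by auto
  qed
  moreover have "\<not> n < z"
  proof
    assume "n < z"
    then obtain y where "computes f (n # xs) (Suc y)" using z by auto
    from Mu.IH(1)[OF this] show False by simp
  qed
  ultimately show ?case by simp
qed

definition word_encode :: "nat word \<Rightarrow> nat" where
  "word_encode w = list_encode (map (\<lambda>(x, b). prod_encode (x, of_bool b)) w)"

definition words_encode :: "nat word list \<Rightarrow> nat" where
  "words_encode ws = list_encode (map word_encode ws)"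

definition kurosh_encode :: "nat word list \<Rightarrow> (nat word \<times> nat word list) list \<Rightarrow> nat" where
  "kurosh_encode bs L =
     prod_encode (words_encode bs,
       list_encode (map (\<lambda>(g, ks). prod_encode (word_encode g, words_encode ks)) L))"

lemma inj_word_encode: "inj word_encode"
proof -
  have "inj (\<lambda>(x, b). prod_encode (x, of_bool b))"
    by (auto simp: inj_def)
  then show ?thesis
    by (simp add: word_encode_def inj_def[of word_encode] list_encode_eq inj_map_eq_map)
qed

lemma inj_words_encode: "inj words_encode"
  by (rule injI) (simp add: words_encode_def list_encode_eq inj_map_eq_map[OF inj_word_encode])

lemma kurosh_encode_eq_iff: "kurosh_encode bs L = kurosh_encode bs' L' \<longleftrightarrow> bs = bs' \<and> L = L'"
proof -
  have "inj (\<lambda>(g, ks). prod_encode (word_encode g, words_encode ks))"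
    using inj_word_encode inj_words_encode by (auto simp: inj_def)
  then show ?thesis
    by (simp add: kurosh_encode_def list_encode_eq inj_map_eq_map inj_eq[OF inj_words_encode])
qed

end

theory Submission
  imports Defs
begin

text \<open>
  The algorithm is an unbounded search for a certificate.  A certificate consists of a candidate
  decomposition and of finite data from which a program can see that the candidate is correct.
  Three things have to be shown: certificates can be checked by a program, a checked certificate
  describes a Kurosh decomposition, and every admissible input has a certificate.

  \<^bold>\<open>What a certificate contains.\<close>  Bass--Serre theory reads a Kurosh decomposition of \<open>H\<close> off the
  quotient of the tree of \<open>G = G\<^sub>1 * G\<^sub>2\<close> by \<open>H\<close>.  The edges of this quotient graph are the cosets
  of \<open>H\<close>, and its vertices are the orbits of cosets under \<open>G\<^sub>1\<close> and under \<open>G\<^sub>2\<close>.  Given a spanning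
  tree, the edges outside of the tree yield a basis of \<open>F\<close>, and the stabilizers of the vertices
  yield the other factors.  If \<open>H\<close> is finitely generated, then the generators visit only finitely
  many cosets, and the orbits of these are finite because \<open>G\<^sub>1\<close> and \<open>G\<^sub>2\<close> are finite.  Letting
  \<open>G\<^sub>i\<close> act trivially on those of the resulting cosets that lie in none of the chosen orbits under
  \<open>G\<^sub>i\<close> gives an action of \<open>G\<close> on a finite set, because \<open>G\<close> is a free product.  The certificate
  consists of tables of this action, of representatives for the orbits, of the vertices of the
  tree with words that lead from them to the base point, of the resulting generators, and of
  derivations that express the generators of \<open>H\<close> in terms of them and conversely.

  \<^bold>\<open>Why a checked certificate is correct.\<close>  That two sets of words generate the same subgroup is
  witnessed by derivations.  Freeness is a statement about infinitely many products, and here the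
  action of \<open>G\<close> on the finite set \<open>P\<close> is used (locale \<open>covering\<close>).  As in van der Waerden's proof
  of the normal form theorem, let \<open>N\<close> be the set of normal forms of the free product of a free
  group on the edges and of the vertex groups.  A letter of \<open>G\<^sub>i\<close> that moves \<open>q\<close> to \<open>q'\<close> is made to
  act on \<open>P \<times> N\<close> by moving \<open>q\<close> to \<open>q'\<close> and multiplying the normal form by the element of the
  vertex group that compares the orbit representatives of \<open>q\<close> and \<open>q'\<close>; crossing an edge outside
  of the tree multiplies by the letter of that edge.  Relators of \<open>G\<^sub>i\<close> act trivially, so this is an
  action of \<open>G\<close>.  The value in \<open>G\<close> of a normal form \<open>s\<close> maps \<open>(base, [])\<close> to \<open>(base, s)\<close>, so distinct
  normal forms have distinct values (lemma \<open>free_product\<close>).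

  \<^bold>\<open>Why a certificate exists.\<close>  It remains to see that the generators taken from the graph generate
  \<open>H\<close> (lemma \<open>kurosh_data_exists\<close>).  Reading a generator \<open>h\<close> of \<open>H\<close> letter by letter gives a closed
  path in the graph, and each letter of \<open>h\<close> contributes an element of a conjugated vertex group
  and, where the path changes sides at an edge outside of the tree, a generator of \<open>F\<close> or its inverse.

  \<^bold>\<open>Why certificates can be checked.\<close>  Functions between types of lists, pairs, numbers and
  Booleans are called computable if a program transforms codes accordingly.  The computable
  functions are closed under the constructs of list programming, and the test of a certificate is
  written with these constructs only.
\<close>

section \<open>Recursive programs\<close>

lemma computes_Comp1: "computes g xs y \<Longrightarrow> computes f [y] z \<Longrightarrow> computes (Comp f [g]) xs z"
  by (rule computes.Comp[of _ _ "[y]"]) simp_all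

lemma computes_Comp2:
  "computes g xs y \<Longrightarrow> computes h xs z \<Longrightarrow> computes f [y, z] v \<Longrightarrow> computes (Comp f [g, h]) xs v"
  by (rule computes.Comp[of _ _ "[y, z]"]) simp_all

text \<open>
  The closure properties of this predicate take the place of explicit programs.  Argument lists are
  kept as lists so that the arity may vary in the rules for recursion and minimization.
\<close>

definition recursive :: "nat \<Rightarrow> (nat list \<Rightarrow> nat) \<Rightarrow> bool" where
  "recursive k f \<longleftrightarrow> (\<exists>p. \<forall>xs. length xs = k \<longrightarrow> computes p xs (f xs))"

lemma recursive_comp:
  assumes "recursive (length gs) f" "\<And>g. g \<in> set gs \<Longrightarrow> recursive k g"
  shows "recursive k (\<lambda>xs. f (map (\<lambda>g. g xs) gs))"
proof -
  obtain p where p: "\<And>ys. length ys = length gs \<Longrightarrow> computes p ys (f ys)"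
    using assms(1) by (auto simp: recursive_def)
  define q where "q g = (SOME q. \<forall>xs. length xs = k \<longrightarrow> computes q xs (g xs))" for g
  have q: "computes (q g) xs (g xs)" if "g \<in> set gs" "length xs = k" for g xs
    using someI_ex[OF assms(2)[OF that(1), unfolded recursive_def]] that(2) by (simp add: q_def)
  have "computes (Comp p (map q gs)) xs (f (map (\<lambda>g. g xs) gs))" if "length xs = k" for xs
    using q that by (intro computes.Comp[OF _ p]) (auto simp: list_all2_conv_all_nth)
  then show ?thesis by (auto simp: recursive_def)
qed

lemma recursive_comp1:
  assumes "recursive 1 f" "recursive k g"
  shows "recursive k (\<lambda>xs. f [g xs])"
  using recursive_comp[of "[g]" f k] assms by simp

lemma recursive_proj: "i < k \<Longrightarrow> recursive k (\<lambda>xs. xs ! i)"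
  by (auto simp: recursive_def intro!: exI[of _ "Proj i"] computes.Proj)

lemma recursive_Suc: "recursive k f \<Longrightarrow> recursive k (\<lambda>xs. Suc (f xs))"
proof -
  have "recursive 1 (\<lambda>xs. Suc (xs ! 0))"
    by (auto simp: recursive_def length_Suc_conv intro!: exI[of _ Succ] computes.Succ)
  then show "recursive k f \<Longrightarrow> recursive k (\<lambda>xs. Suc (f xs))"
    using recursive_comp1[of "\<lambda>xs. Suc (xs ! 0)" k f] by simp
qed

lemma recursive_const: "recursive k (\<lambda>_. c)"
proof (induction c)
  case 0
  show ?case by (auto simp: recursive_def intro!: exI[of _ Zero] computes.Zero)
qed (rule recursive_Suc)

text \<open>
  The parameters \<open>xs\<close> are handed through unchanged: the program composes a primitive recursion with
  the bound and all projections.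
\<close>

lemma recursive_rec_nat:
  assumes "recursive k n" "recursive k a" "recursive (Suc (Suc k)) h"
  shows "recursive k (\<lambda>xs. rec_nat (a xs) (\<lambda>m y. h (m # y # xs)) (n xs))"
proof -
  obtain p q where p: "\<And>xs. length xs = k \<Longrightarrow> computes p xs (a xs)"
    and q: "\<And>xs. length xs = Suc (Suc k) \<Longrightarrow> computes q xs (h xs)"
    using assms(2,3) by (auto simp: recursive_def)
  have "computes (PrimRec p q) (m # xs) (rec_nat (a xs) (\<lambda>m y. h (m # y # xs)) m)"
    if "length xs = k" for m xs
  proof (induction m)
    case (Suc m)
    from computes.PrimRec_Suc[OF this q[of "m # rec_nat (a xs) (\<lambda>m y. h (m # y # xs)) m # xs"]] that
    show ?case by simp
  qed (auto intro: computes.PrimRec_0 p that)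
  then have "computes (PrimRec p q) xs (rec_nat (a (tl xs)) (\<lambda>m y. h (m # y # tl xs)) (hd xs))"
    if "length xs = Suc k" for xs
    using that by (cases xs) auto
  then have "recursive (Suc k) (\<lambda>xs. rec_nat (a (tl xs)) (\<lambda>m y. h (m # y # tl xs)) (hd xs))"
    by (auto simp: recursive_def)
  moreover have "\<And>g. g \<in> set (n # map (\<lambda>i xs. xs ! i) [0..<k]) \<Longrightarrow> recursive k g"
    using assms(1) by (auto intro: recursive_proj)
  ultimately have "recursive k (\<lambda>xs. (\<lambda>xs. rec_nat (a (tl xs)) (\<lambda>m y. h (m # y # tl xs)) (hd xs))
      (map (\<lambda>g. g xs) (n # map (\<lambda>i xs. xs ! i) [0..<k])))"
    by (intro recursive_comp) auto
  moreover have "map (\<lambda>i. xs ! i) [0..<k] = xs" if "length xs = k" for xs :: "nat list"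
    using that map_nth[of xs] by simp
  ultimately show ?thesis by (simp add: recursive_def comp_def)
qed

lemma recursive_Least:
  assumes "recursive (Suc k) f" "\<And>xs. length xs = k \<Longrightarrow> \<exists>n. f (n # xs) = 0"
  shows "recursive k (\<lambda>xs. LEAST n. f (n # xs) = 0)"
proof -
  obtain p where p: "\<And>xs. length xs = Suc k \<Longrightarrow> computes p xs (f xs)"
    using assms(1) by (auto simp: recursive_def)
  have "computes (Mu p) xs (LEAST n. f (n # xs) = 0)" if "length xs = k" for xs
  proof (rule computes.Mu)
    let ?n = "LEAST n. f (n # xs) = 0"
    have "f (?n # xs) = 0" using assms(2)[OF that] by (rule LeastI_ex)
    then show "computes p (?n # xs) 0" using p[of "?n # xs"] that by simp
    show "\<forall>m<?n. \<exists>y. computes p (m # xs) (Suc y)"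
    proof (intro allI impI)
      fix m assume "m < ?n"
      then obtain y where "f (m # xs) = Suc y" using not_less_Least[of m] not0_implies_Suc by blast
      then show "\<exists>y. computes p (m # xs) (Suc y)" using p[of "m # xs"] that by auto
    qed
  qed
  then show ?thesis by (auto simp: recursive_def)
qed

lemma recursive_add:
  assumes "recursive k f" "recursive k g"
  shows "recursive k (\<lambda>xs. f xs + g xs)"
proof -
  have "rec_nat a (\<lambda>m y. Suc ((m # y # xs) ! 1)) n = a + n" for a n :: nat and xs
    by (induction n) auto
  moreover have "recursive k (\<lambda>xs. rec_nat (f xs) (\<lambda>m y. Suc ((m # y # xs) ! 1)) (g xs))"
    by (intro recursive_rec_nat[where h = "\<lambda>ys. Suc (ys ! 1)"] recursive_Suc recursive_proj assms) simp
  ultimately show ?thesis by simp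
qed

lemma recursive_pred: "recursive k f \<Longrightarrow> recursive k (\<lambda>xs. f xs - 1)"
proof -
  assume f: "recursive k f"
  have "rec_nat 0 (\<lambda>m y. (m # y # xs) ! 0) n = n - 1" for n :: nat and xs
    by (induction n) auto
  moreover have "recursive k (\<lambda>xs. rec_nat 0 (\<lambda>m y. (m # y # xs) ! 0) (f xs))"
    by (intro recursive_rec_nat[where h = "\<lambda>ys. ys ! 0"] recursive_const recursive_proj f) simp
  ultimately show ?thesis by simp
qed

lemma recursive_diff:
  assumes "recursive k f" "recursive k g"
  shows "recursive k (\<lambda>xs. f xs - g xs)"
proof -
  have "rec_nat a (\<lambda>m y. (m # y # xs) ! 1 - 1) n = a - n" for a n :: nat and xs
    by (induction n) auto
  moreover have "recursive k (\<lambda>xs. rec_nat (f xs) (\<lambda>m y. (m # y # xs) ! 1 - 1) (g xs))"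
    by (intro recursive_rec_nat[where h = "\<lambda>ys. ys ! 1 - 1"] recursive_pred recursive_proj assms) simp
  ultimately show ?thesis by simp
qed

lemma recursive_triangle:
  assumes "recursive k f"
  shows "recursive k (\<lambda>xs. triangle (f xs))"
proof -
  have "rec_nat 0 (\<lambda>m y. (m # y # xs) ! 1 + Suc ((m # y # xs) ! 0)) n = triangle n" for n xs
    by (induction n) auto
  moreover have "recursive k
      (\<lambda>xs. rec_nat 0 (\<lambda>m y. (m # y # xs) ! 1 + Suc ((m # y # xs) ! 0)) (f xs))"
    by (intro recursive_rec_nat[where h = "\<lambda>ys. ys ! 1 + Suc (ys ! 0)"] recursive_add recursive_Suc
        recursive_proj recursive_const assms) auto
  ultimately show ?thesis by simp
qed

lemma recursive_prod_encode:
  "recursive k f \<Longrightarrow> recursive k g \<Longrightarrow> recursive k (\<lambda>xs. prod_encode (f xs, g xs))"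
  unfolding prod_encode_def by (simp add: recursive_add recursive_triangle)

lemma triangle_mono: "m \<le> n \<Longrightarrow> triangle m \<le> triangle n"
  by (induction n) (auto simp: le_Suc_eq)

text \<open>
  The pairs with sum \<open>k\<close> have the codes from \<open>triangle k\<close> up to \<open>triangle (Suc k) - 1\<close>, so
  minimization recovers the sum, and with it both components, from the code of a pair.
\<close>

lemma Least_triangle:
  "(LEAST k. Suc (prod_encode (a, b)) - triangle (Suc k) = 0) = a + b"
proof (rule Least_equality)
  show "Suc (prod_encode (a, b)) - triangle (Suc (a + b)) = 0"
    by (simp add: prod_encode_def)
  fix k assume k: "Suc (prod_encode (a, b)) - triangle (Suc k) = 0"
  show "a + b \<le> k"
  proof (rule ccontr)
    assume "\<not> a + b \<le> k"
    then have "triangle (Suc k) \<le> triangle (a + b)" by (intro triangle_mono) simp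
    with k show False by (simp add: prod_encode_def)
  qed
qed

lemma recursive_prod_decode:
  assumes "recursive k f"
  shows "recursive k (\<lambda>xs. fst (prod_decode (f xs)))" "recursive k (\<lambda>xs. snd (prod_decode (f xs)))"
proof -
  define d where "d z = (LEAST k. Suc z - triangle (Suc k) = 0)" for z
  have d: "d (prod_encode (a, b)) = a + b" for a b
    unfolding d_def by (rule Least_triangle)
  have "recursive 1 (\<lambda>xs. LEAST n. (\<lambda>ys. Suc (ys ! 1) - triangle (Suc (ys ! 0))) (n # xs) = 0)"
  proof (rule recursive_Least)
    show "recursive (Suc 1) (\<lambda>ys. Suc (ys ! 1) - triangle (Suc (ys ! 0)))"
      by (intro recursive_diff recursive_triangle recursive_Suc recursive_proj) auto
    fix xs :: "nat list"
    have "z \<le> triangle z" for z by (induction z) auto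
    then show "\<exists>n. Suc ((n # xs) ! 1) - triangle (Suc ((n # xs) ! 0)) = 0"
      by (intro exI[of _ "xs ! 0"]) (simp add: le_SucI)
  qed
  then have "recursive 1 (\<lambda>xs. d (xs ! 0))" by (simp add: d_def)
  from recursive_comp1[OF this assms] have rd: "recursive k (\<lambda>xs. d (f xs))" by simp
  have *: "fst (prod_decode z) = z - triangle (d z)" "snd (prod_decode z) = d z - (z - triangle (d z))"
    for z
  proof -
    obtain a b where z: "z = prod_encode (a, b)" using prod_decode_inverse[of z] by (metis surj_pair)
    then have "z - triangle (d z) = a" using d[of a b] by (simp add: prod_encode_def)
    then show "fst (prod_decode z) = z - triangle (d z)" "snd (prod_decode z) = d z - (z - triangle (d z))"
      using d[of a b] by (simp_all add: z)
  qed
  show "recursive k (\<lambda>xs. fst (prod_decode (f xs)))" "recursive k (\<lambda>xs. snd (prod_decode (f xs)))"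
    unfolding * by (intro recursive_diff recursive_triangle rd assms)+
qed

section \<open>Computable functions on encodable types\<close>

text \<open>
  One overloaded function covers all codes that occur as inputs and outputs of the algorithm.  Some
  value has code 0 because a program that takes apart the empty list, whose code is 0, then
  finds codes of legal values for the missing head and tail.
\<close>

class encodable =
  fixes enc :: "'a \<Rightarrow> nat"
  assumes inj_enc: "inj enc" and ex_enc_eq_0: "\<exists>x. enc x = 0"

lemma enc_eq_iff [simp]: "enc x = enc y \<longleftrightarrow> x = y"
  by (simp add: inj_eq inj_enc)

instantiation nat :: encodable
begin
definition enc_nat :: "nat \<Rightarrow> nat" where [simp]: "enc_nat n = n"
instance by standard (auto simp: inj_def)
end

instantiation bool :: encodable
begin
definition enc_bool :: "bool \<Rightarrow> nat" where [simp]: "enc_bool b = of_bool b"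
instance by standard (auto simp: inj_def intro: exI[of _ False])
end

instantiation prod :: (encodable, encodable) encodable
begin
definition enc_prod :: "'a \<times> 'b \<Rightarrow> nat" where
  [simp]: "enc_prod p = prod_encode (enc (fst p), enc (snd p))"
instance
proof
  show "inj (enc :: 'a \<times> 'b \<Rightarrow> nat)" by (auto simp: inj_def)
  obtain x y where "enc (x :: 'a) = 0" "enc (y :: 'b) = 0" using ex_enc_eq_0 by metis
  then show "\<exists>p. enc (p :: 'a \<times> 'b) = 0" by (intro exI[of _ "(x, y)"]) (simp add: prod_encode_def)
qed
end

instantiation list :: (encodable) encodable
begin
definition enc_list :: "'a list \<Rightarrow> nat" where "enc_list xs = list_encode (map enc xs)"
instance
proof
  show "inj (enc :: 'a list \<Rightarrow> nat)"
    by (auto simp: inj_def enc_list_def list_encode_eq inj_map_eq_map[OF inj_enc])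
  show "\<exists>xs. enc (xs :: 'a list) = 0" by (intro exI[of _ "[]"]) (simp add: enc_list_def)
qed
end

lemma enc_Nil [simp]: "enc [] = 0"
  and enc_Cons [simp]: "enc (x # xs) = Suc (prod_encode (enc x, enc xs))"
  by (simp_all add: enc_list_def)

text \<open>
  Each closure property below is an introduction rule whose conclusion abstracts over the input \<open>x\<close>,
  and binders inside of a term turn into pairing with the bound value.  The rules collected in
  \<open>comp_intros\<close> thus follow the syntax of the term that defines a function.
\<close>

definition computable :: "('a::encodable \<Rightarrow> 'b::encodable) \<Rightarrow> bool" where
  "computable f \<longleftrightarrow> (\<exists>p. \<forall>x. computes p [enc x] (enc (f x)))"

named_theorems comp_intros

lemma computable_recursive:
  assumes "recursive 1 (\<lambda>xs. f (xs ! 0))" "\<And>x. f (enc x) = enc (g x)"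
  shows "computable g"
proof -
  obtain p where "\<forall>xs. length xs = 1 \<longrightarrow> computes p xs (f (xs ! 0))"
    using assms(1) by (auto simp: recursive_def)
  then have "computes p [enc x] (enc (g x))" for x
    using assms(2)[of x] by (metis One_nat_def length_Cons list.size(3) nth_Cons_0)
  then show ?thesis by (auto simp: computable_def)
qed

lemma computable_comp:
  assumes "computable f" "computable g"
  shows "computable (\<lambda>x. f (g x))"
proof -
  obtain p q where "\<And>x. computes p [enc x] (enc (f x))" "\<And>x. computes q [enc x] (enc (g x))"
    using assms by (auto simp: computable_def)
  then have "computes (Comp p [q]) [enc x] (enc (f (g x)))" for x
    by (auto intro: computes_Comp1)
  then show ?thesis by (auto simp: computable_def)
qed

lemma computable_same_code: "(\<And>x. enc (g x) = enc x) \<Longrightarrow> computable g"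
  using computable_recursive[of "\<lambda>n. n" g] recursive_proj[of 0 1] by simp

lemma computable_id [comp_intros]: "computable (\<lambda>x. x)"
  by (simp add: computable_same_code)

lemma computable_const [comp_intros]: "computable (\<lambda>_. c)"
  by (rule computable_recursive[of "\<lambda>_. enc c"]) (rule recursive_const, simp)

lemma recursive_pair_program: "\<exists>p. \<forall>x y. computes p [x, y] (prod_encode (x, y))"
proof -
  have "recursive 2 (\<lambda>xs. prod_encode (xs ! 0, xs ! 1))"
    by (intro recursive_prod_encode recursive_proj) auto
  then obtain p where "\<forall>xs. length xs = 2 \<longrightarrow> computes p xs (prod_encode (xs ! 0, xs ! 1))"
    by (auto simp: recursive_def)
  then have "computes p [x, y] (prod_encode (x, y))" for x y
    by (metis One_nat_def Suc_1 length_Cons list.size(3) nth_Cons_0 nth_Cons_Suc)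
  then show ?thesis by blast
qed

lemma computable_Pair [comp_intros]:
  assumes "computable f" "computable g"
  shows "computable (\<lambda>x. (f x, g x))"
proof -
  obtain p q where pq: "\<And>x. computes p [enc x] (enc (f x))" "\<And>x. computes q [enc x] (enc (g x))"
    using assms by (auto simp: computable_def)
  obtain r where r: "\<And>x y. computes r [x, y] (prod_encode (x, y))"
    using recursive_pair_program by blast
  have "computes (Comp r [p, q]) [enc x] (enc (f x, g x))" for x
    using computes_Comp2[OF pq r] by simp
  then show ?thesis by (auto simp: computable_def)
qed

lemma computable_comp2:
  assumes "computable (\<lambda>p. f (fst p) (snd p))" "computable g" "computable h"
  shows "computable (\<lambda>x. f (g x) (h x))"
  using computable_comp[OF assms(1) computable_Pair[OF assms(2,3)]] by simp

lemma computable_fst [comp_intros]: "computable f \<Longrightarrow> computable (\<lambda>x. fst (f x))"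
  and computable_snd [comp_intros]: "computable f \<Longrightarrow> computable (\<lambda>x. snd (f x))"
proof -
  have "computable (fst :: 'b \<times> 'c \<Rightarrow> 'b)" "computable (snd :: 'b \<times> 'c \<Rightarrow> 'c)"
    using computable_recursive[of "\<lambda>n. fst (prod_decode n)" "fst :: 'b \<times> 'c \<Rightarrow> 'b"]
      computable_recursive[of "\<lambda>n. snd (prod_decode n)" "snd :: 'b \<times> 'c \<Rightarrow> 'c"]
      recursive_prod_decode[OF recursive_proj[of 0 1]] by simp_all
  then show "computable f \<Longrightarrow> computable (\<lambda>x. fst (f x))" "computable f \<Longrightarrow> computable (\<lambda>x. snd (f x))"
    by (auto intro: computable_comp)
qed

lemma computable_nat2:
  assumes "recursive 2 (\<lambda>xs. F (xs ! 0) (xs ! 1))" "computable f" "computable g"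
  shows "computable (\<lambda>x. F (f x) (g x) :: nat)"
proof (rule computable_comp2[OF _ assms(2,3)])
  have "recursive 1 (\<lambda>xs. (\<lambda>xs. F (xs ! 0) (xs ! 1)) (map (\<lambda>g. g xs)
      [\<lambda>xs. fst (prod_decode (xs ! 0)), \<lambda>xs. snd (prod_decode (xs ! 0))]))"
    using assms(1) recursive_prod_decode[OF recursive_proj[of 0 1]]
    by (intro recursive_comp) (auto simp: numeral_2_eq_2)
  then have "recursive 1 (\<lambda>xs. F (fst (prod_decode (xs ! 0))) (snd (prod_decode (xs ! 0))))"
    by simp
  then show "computable (\<lambda>p. F (fst p) (snd p))"
    by (rule computable_recursive) simp
qed

lemma computable_Suc [comp_intros]: "computable f \<Longrightarrow> computable (\<lambda>x. Suc (f x))"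
  by (rule computable_comp[of Suc], rule computable_recursive[of Suc])
    (auto intro: recursive_Suc recursive_proj)

lemma computable_add [comp_intros]:
    "computable f \<Longrightarrow> computable g \<Longrightarrow> computable (\<lambda>x. f x + g x :: nat)"
  and computable_diff [comp_intros]:
    "computable f \<Longrightarrow> computable g \<Longrightarrow> computable (\<lambda>x. f x - g x :: nat)"
  by (intro computable_nat2[where F = "(+)"] computable_nat2[where F = "(-)"]
      recursive_add recursive_diff recursive_proj; simp)+

lemma computable_enc [comp_intros]: "computable f \<Longrightarrow> computable (\<lambda>x. enc (f x))"
  by (rule computable_comp[of enc], rule computable_same_code) simp

lemma computable_rec_nat [comp_intros]:
  assumes "computable a" "computable (\<lambda>p. h (fst p) (fst (snd p)) (snd (snd p)))" "computable k"
  shows "computable (\<lambda>x. rec_nat (a x) (\<lambda>n y. h n y x) (k x))"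
proof -
  obtain p q s where p: "\<And>x. computes p [enc x] (enc (a x))"
    and q: "\<And>n y x. computes q [enc (n, y, x)] (enc (h n y x))"
    and s: "\<And>x. computes s [enc x] (enc (k x))"
    using assms by (fastforce simp: computable_def)
  obtain r where r: "\<And>x y. computes r [x, y] (prod_encode (x, y))"
    using recursive_pair_program by blast
  let ?g = "Comp q [Comp r [Proj 0, Comp r [Proj 1, Proj 2]]]"
  have proj: "computes (Proj 0) [n, y, x] n" "computes (Proj 1) [n, y, x] y"
      "computes (Proj 2) [n, y, x] x" for n y x
    using computes.Proj[of 0 "[n, y, x]"] computes.Proj[of 1 "[n, y, x]"] computes.Proj[of 2 "[n, y, x]"]
    by simp_all
  have g: "computes ?g [n, enc y, enc x] (enc (h n y x))" for n y x
  proof -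
    have "computes (Comp r [Proj 1, Proj 2]) [n, enc y, enc x] (prod_encode (enc y, enc x))"
      by (rule computes_Comp2[OF proj(2,3) r])
    from computes_Comp2[OF proj(1) this r]
    have "computes (Comp r [Proj 0, Comp r [Proj 1, Proj 2]]) [n, enc y, enc x] (enc (n, y, x))"
      by simp
    then show ?thesis using q by (rule computes_Comp1)
  qed
  have rec: "computes (PrimRec p ?g) [n, enc x] (enc (rec_nat (a x) (\<lambda>n y. h n y x) n))" for n x
  proof (induction n)
    case (Suc n)
    from computes.PrimRec_Suc[OF this g] show ?case by simp
  qed (auto intro: computes.PrimRec_0 p)
  have "computes (Proj 0) [enc x] (enc x)" for x :: 'a
    using computes.Proj[of 0 "[enc x]"] by simp
  then have "computes (Comp (PrimRec p ?g) [s, Proj 0]) [enc x]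
      (enc (rec_nat (a x) (\<lambda>n y. h n y x) (k x)))" for x
    using s[of x] rec[of "k x" x] by (auto intro: computes_Comp2)
  then show ?thesis by (auto simp: computable_def)
qed

text \<open>Recursion over the code 0 or 1 of the condition performs the case distinction.\<close>

lemma computable_If [comp_intros]:
  assumes "computable c" "computable f" "computable g"
  shows "computable (\<lambda>x. if c x then f x else g x)"
proof -
  have "computable (\<lambda>x. of_bool (c x) :: nat)"
    by (rule computable_comp[OF computable_same_code assms(1)]) simp
  moreover have "computable (\<lambda>p. (\<lambda>n y. f) (fst p) (fst (snd p)) (snd (snd p)))"
    by (rule computable_comp[OF assms(2)]) (intro comp_intros)
  ultimately have "computable (\<lambda>x. rec_nat (g x) (\<lambda>n y. f x) (of_bool (c x)))"
    using assms(3) by (intro computable_rec_nat) auto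
  moreover have "rec_nat (g x) (\<lambda>n y. f x) (of_bool (c x)) = (if c x then f x else g x)" for x
    by simp
  ultimately show ?thesis by simp
qed

lemma computable_not [comp_intros]: "computable P \<Longrightarrow> computable (\<lambda>x. \<not> P x)"
  and computable_conj [comp_intros]: "computable P \<Longrightarrow> computable Q \<Longrightarrow> computable (\<lambda>x. P x \<and> Q x)"
  and computable_disj [comp_intros]: "computable P \<Longrightarrow> computable Q \<Longrightarrow> computable (\<lambda>x. P x \<or> Q x)"
proof -
  have *: "(\<lambda>x. \<not> P x) = (\<lambda>x. if P x then False else True)"
    "(\<lambda>x. P x \<and> Q x) = (\<lambda>x. if P x then Q x else False)"
    "(\<lambda>x. P x \<or> Q x) = (\<lambda>x. if P x then True else Q x)"
    by auto
  show "computable P \<Longrightarrow> computable (\<lambda>x. \<not> P x)"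
    "computable P \<Longrightarrow> computable Q \<Longrightarrow> computable (\<lambda>x. P x \<and> Q x)"
    "computable P \<Longrightarrow> computable Q \<Longrightarrow> computable (\<lambda>x. P x \<or> Q x)"
    unfolding * by (intro computable_If computable_const; assumption)+
qed

lemma computable_eq [comp_intros]:
  assumes "computable f" "computable g"
  shows "computable (\<lambda>x. f x = g x)"
proof -
  have z: "recursive 1 (\<lambda>xs. 1 - xs ! 0)"
    by (intro recursive_diff recursive_const recursive_proj) simp
  have "computable (\<lambda>n. n = (0::nat))"
    by (rule computable_recursive[OF z]) auto
  then have "computable (\<lambda>x. (enc (f x) - enc (g x)) + (enc (g x) - enc (f x)) = 0)"
    by (rule computable_comp) (intro comp_intros assms)
  moreover have "((a::nat) - b) + (b - a) = 0 \<longleftrightarrow> a = b" for a b by arith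
  ultimately show ?thesis by simp
qed

lemma computable_less [comp_intros]:
  assumes "computable f" "computable g"
  shows "computable (\<lambda>x. f x < (g x :: nat))"
proof -
  have "computable (\<lambda>x. \<not> g x - f x = 0)" by (intro comp_intros assms)
  moreover have "\<not> g x - f x = 0 \<longleftrightarrow> f x < g x" for x by auto
  ultimately show ?thesis by simp
qed

section \<open>Computable list functions\<close>

lemma computable_Cons [comp_intros]:
  assumes "computable f" "computable g"
  shows "computable (\<lambda>x. f x # g x)"
proof -
  have "computable (\<lambda>p :: 'b \<times> 'b list. fst p # snd p)"
    by (rule computable_recursive[of Suc]) (auto intro: recursive_Suc recursive_proj)
  from computable_comp2[of "(#)", OF this assms] show ?thesis .
qed

text \<open>
  The predecessor of the code of a nonempty list is the code of the pair of its head and its tail.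
  Both branches are evaluated for every list, and for the empty list the second branch
  is run on a head with code 0.
\<close>

lemma computable_case_list [comp_intros]:
  assumes "computable a" "computable (\<lambda>p. h (fst p) (fst (snd p)) (snd (snd p)))" "computable l"
  shows "computable (\<lambda>x. case l x of [] \<Rightarrow> a x | y # ys \<Rightarrow> h y ys x)"
proof -
  obtain d where d: "enc (d :: 'c) = 0" using ex_enc_eq_0 by blast
  define u where "u l = (case l of [] \<Rightarrow> (d, []) | y # ys \<Rightarrow> (y, ys))" for l :: "'c list"
  have "recursive 1 (\<lambda>xs. xs ! 0 - 1)"
    by (intro recursive_pred recursive_proj) simp
  then have "computable u"
    by (rule computable_recursive) (auto simp: u_def d prod_encode_def split: list.split)
  then have u: "computable (\<lambda>x. u (l x))" using assms(3) by (rule computable_comp)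
  have "computable (\<lambda>x. (\<lambda>p. h (fst p) (fst (snd p)) (snd (snd p))) (fst (u (l x)), snd (u (l x)), x))"
    by (rule computable_comp[OF assms(2)]) (intro comp_intros u)
  then have "computable (\<lambda>x. if l x = [] then a x else h (fst (u (l x))) (snd (u (l x))) x)"
    by (intro comp_intros assms(1,3)) simp
  moreover have "(if l x = [] then a x else h (fst (u (l x))) (snd (u (l x))) x) =
      (case l x of [] \<Rightarrow> a x | y # ys \<Rightarrow> h y ys x)" for x
    by (auto simp: u_def split: list.split)
  ultimately show ?thesis by simp
qed

lemma length_le_enc: "length l \<le> enc l"
proof (induction l)
  case (Cons y l)
  then show ?case using le_prod_encode_2[of "enc l" "enc y"] by simp
qed simp

text \<open>
  The state is the rest of the list with the accumulator.  The code of the list is an upper bound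
  for its length, and steps after the end of the list do not change the state.
\<close>

lemma computable_foldl:
  assumes "computable a" "computable (\<lambda>p. h (fst p) (fst (snd p)) (snd (snd p)))" "computable l"
  shows "computable (\<lambda>x. foldl (\<lambda>s y. h s y x) (a x) (l x))"
proof -
  define step where "step x p = (case fst p of [] \<Rightarrow> p | y # ys \<Rightarrow> (ys, h (snd p) y x))"
    for x and p :: "'c list \<times> 'b"
  have rec: "snd (rec_nat (ys, s) (\<lambda>_. step x) n) = foldl (\<lambda>s y. h s y x) s ys"
    if "length ys \<le> n" for x ys s n
  proof -
    have "rec_nat p (\<lambda>_. step x) n = (step x ^^ n) p" for p by (induction n) auto
    moreover have "snd ((step x ^^ n) (ys, s)) = foldl (\<lambda>s y. h s y x) s ys"
      using that by (induction n arbitrary: ys s)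
        (auto simp: step_def funpow_swap1 length_Suc_conv simp del: funpow.simps(2)
          simp add: funpow_Suc_right split: list.split)
    ultimately show ?thesis by simp
  qed
  have h: "computable (\<lambda>q. h (f q) (g q) (k q))"
    if "computable f" "computable g" "computable k" for f g k
    using computable_comp[OF assms(2) computable_Pair[OF that(1) computable_Pair[OF that(2,3)]]]
    by simp
  have "computable (\<lambda>x. snd (rec_nat (l x, a x) (\<lambda>_ p. case fst p of [] \<Rightarrow> p | y # ys \<Rightarrow>
      (\<lambda>y ys p x. (ys, h (snd p) y x)) y ys p x) (enc (l x))))"
    by (intro comp_intros assms h)
  moreover have "snd (rec_nat (l x, a x) (\<lambda>_ p. case fst p of [] \<Rightarrow> p | y # ys \<Rightarrow>
      (\<lambda>y ys p x. (ys, h (snd p) y x)) y ys p x) (enc (l x))) =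
      foldl (\<lambda>s y. h s y x) (a x) (l x)" for x
    using rec[OF length_le_enc[of "l x"], of "a x" x] by (simp add: step_def[abs_def])
  ultimately show ?thesis by simp
qed

lemma computable_rev [comp_intros]: "computable f \<Longrightarrow> computable (\<lambda>x. rev (f x))"
proof -
  assume f: "computable f"
  have "computable (\<lambda>x. foldl (\<lambda>s y. y # s) [] (f x))"
    by (rule computable_foldl) (intro comp_intros f)+
  moreover have "foldl (\<lambda>s y. y # s) s l = rev l @ s" for s l :: "'b list"
    by (induction l arbitrary: s) auto
  ultimately show ?thesis by simp
qed

text \<open>
  Recursion starts at the end of the list, so the list is reversed and the state
  contains the tail seen so far together with its value.
\<close>

lemma computable_rec_list [comp_intros]:
  assumes "computable a"
    "computable (\<lambda>p. h (fst p) (fst (snd p)) (fst (snd (snd p))) (snd (snd (snd p))))" "computable l"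
  shows "computable (\<lambda>x. rec_list (a x) (\<lambda>y ys r. h y ys r x) (l x))"
proof -
  have h: "computable (\<lambda>x. h (f1 x) (f2 x) (f3 x) (f4 x))"
    if "computable f1" "computable f2" "computable f3" "computable f4" for f1 f2 f3 f4
    using computable_comp[OF assms(2) computable_Pair[OF that(1)
          computable_Pair[OF that(2) computable_Pair[OF that(3,4)]]]] by simp
  have "computable (\<lambda>x. snd (foldl (\<lambda>s y. (y # fst s, h y (fst s) (snd s) x)) ([], a x) (rev (l x))))"
    by (intro comp_intros computable_foldl h assms)
  moreover have "foldl (\<lambda>s y. (y # fst s, h y (fst s) (snd s) x)) ([], b) (rev l) =
      (l, rec_list b (\<lambda>y ys r. h y ys r x) l)" for x b l
    by (induction l) auto
  ultimately show ?thesis by simp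
qed

text \<open>
  A function with parameters is computable once the right-hand sides of its recursion equations
  over a list are.
\<close>

lemma computable_list_rec:
  assumes "\<And>x. f x [] = a x" "\<And>y ys x. f x (y # ys) = h y ys (f x ys) x"
    "computable a" "computable (\<lambda>p. h (fst p) (fst (snd p)) (fst (snd (snd p))) (snd (snd (snd p))))"
    "computable l"
  shows "computable (\<lambda>x. f x (l x))"
proof -
  have "f x l = rec_list (a x) (\<lambda>y ys r. h y ys r x) l" for x l
    by (induction l) (simp_all add: assms(1,2))
  then show ?thesis using computable_rec_list[OF assms(3-5)] by simp
qed

lemma computable_append [comp_intros]:
  assumes "computable f" "computable g"
  shows "computable (\<lambda>x. f x @ g x)"
  by (rule computable_list_rec[where f = "\<lambda>x l. l @ g x" and a = g and h = "\<lambda>y _ r _. y # r"])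
    (simp_all add: assms, intro comp_intros)

lemma computable_map [comp_intros]:
  assumes "computable (\<lambda>p. f (fst p) (snd p))" "computable l"
  shows "computable (\<lambda>x. map (\<lambda>y. f y x) (l x))"
proof (rule computable_list_rec[where a = "\<lambda>_. []" and h = "\<lambda>y _ r x. f y x # r"])
  have "computable (\<lambda>x. (\<lambda>p. f (fst p) (snd p)) (fst x, snd (snd (snd x))))"
    by (rule computable_comp[OF assms(1)]) (intro comp_intros)
  then show "computable (\<lambda>p. f (fst p) (snd (snd (snd p))) # fst (snd (snd p)))"
    by (intro comp_intros) simp
qed (auto intro: comp_intros assms)

lemma computable_Ball [comp_intros]:
  assumes "computable (\<lambda>p. P (fst p) (snd p))" "computable l"
  shows "computable (\<lambda>x. \<forall>y\<in>set (l x). P y x)"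
proof (rule computable_list_rec[where a = "\<lambda>_. True" and h = "\<lambda>y _ r x. P y x \<and> r"])
  have "computable (\<lambda>x. (\<lambda>p. P (fst p) (snd p)) (fst x, snd (snd (snd x))))"
    by (rule computable_comp[OF assms(1)]) (intro comp_intros)
  then show "computable (\<lambda>p. P (fst p) (snd (snd (snd p))) \<and> fst (snd (snd p)))"
    by (intro comp_intros) simp
qed (auto intro: comp_intros assms)

lemma computable_Bex [comp_intros]:
  assumes "computable (\<lambda>p. P (fst p) (snd p))" "computable l"
  shows "computable (\<lambda>x. \<exists>y\<in>set (l x). P y x)"
proof -
  have "computable (\<lambda>x. \<not> (\<forall>y\<in>set (l x). \<not> P y x))"
    by (intro comp_intros assms)
  then show ?thesis by simp
qed

lemma computable_member [comp_intros]:
  assumes "computable f" "computable l"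
  shows "computable (\<lambda>x. f x \<in> set (l x))"
proof -
  have "computable (\<lambda>x. \<exists>y\<in>set (l x). y = f x)"
    by (intro comp_intros assms(2) computable_comp[OF assms(1)])
  then show ?thesis by simp
qed

lemma computable_concat [comp_intros]: "computable l \<Longrightarrow> computable (\<lambda>x. concat (l x))"
  by (rule computable_list_rec[where f = "\<lambda>_. concat" and a = "\<lambda>_. []" and h = "\<lambda>y _ r _. y @ r"])
    (simp_all add: computable_const, intro comp_intros)

lemma computable_distinct [comp_intros]: "computable l \<Longrightarrow> computable (\<lambda>x. distinct (l x))"
  by (rule computable_list_rec[where f = "\<lambda>_. distinct" and a = "\<lambda>_. True"
        and h = "\<lambda>y ys r _. y \<notin> set ys \<and> r"])
    (simp_all add: computable_const, intro comp_intros)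

lemma computable_upt [comp_intros]: "computable n \<Longrightarrow> computable (\<lambda>x. [0..<n x])"
proof -
  assume n: "computable n"
  have "computable (\<lambda>x. rec_nat [] (\<lambda>m r. r @ [m]) (n x))"
    by (intro comp_intros n)
  moreover have "rec_nat [] (\<lambda>m r. r @ [m]) n = [0..<n]" for n
    by (induction n) auto
  ultimately show ?thesis by simp
qed

section \<open>Unbounded search\<close>

text \<open>
  Not every number is the code of a value: the Booleans have only two codes.  The search through all
  values of a type therefore follows a computable enumeration.
\<close>

definition enumerable :: "'a::encodable itself \<Rightarrow> bool" where
  "enumerable _ \<longleftrightarrow> (\<exists>d :: nat \<Rightarrow> 'a. surj d \<and> computable d)"

lemma enumerable_nat: "enumerable TYPE(nat)"
  unfolding enumerable_def by (intro exI[of _ "\<lambda>n. n"]) (auto intro: comp_intros)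

lemma enumerable_bool: "enumerable TYPE(bool)"
proof -
  have "surj (\<lambda>n :: nat. n = 0)" by (rule surjI[of _ "\<lambda>b. of_bool (\<not> b)"]) simp
  moreover have "computable (\<lambda>n :: nat. n = 0)" by (intro comp_intros)
  ultimately show ?thesis unfolding enumerable_def by blast
qed

lemma enumerable_prod:
  assumes "enumerable TYPE('a::encodable)" "enumerable TYPE('b::encodable)"
  shows "enumerable TYPE('a \<times> 'b)"
proof -
  obtain d :: "nat \<Rightarrow> 'a" and e :: "nat \<Rightarrow> 'b" where d: "surj d" "computable d"
    and e: "surj e" "computable e"
    using assms by (auto simp: enumerable_def)
  let ?f = "\<lambda>n. (d (fst (prod_decode n)), e (snd (prod_decode n)))"
  have "computable (\<lambda>n. prod_decode n)" by (rule computable_same_code) simp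
  then have "computable ?f"
    by (intro comp_intros computable_comp[OF d(2)] computable_comp[OF e(2)])
  moreover have "surj ?f"
  proof (rule surjI)
    fix p :: "'a \<times> 'b"
    show "?f (prod_encode (inv_into UNIV d (fst p), inv_into UNIV e (snd p))) = p"
      using d(1) e(1) by (simp add: surj_f_inv_f)
  qed
  ultimately show ?thesis unfolding enumerable_def by blast
qed

lemma enumerable_list:
  assumes "enumerable TYPE('a::encodable)"
  shows "enumerable TYPE('a list)"
proof -
  obtain d :: "nat \<Rightarrow> 'a" where d: "surj d" "computable d"
    using assms by (auto simp: enumerable_def)
  let ?f = "\<lambda>n. map d (list_decode n)"
  have "map (enc :: nat \<Rightarrow> nat) = (\<lambda>xs. xs)" by (simp add: fun_eq_iff map_idI)
  then have "computable (\<lambda>n. list_decode n)" by (intro computable_same_code) (simp add: enc_list_def)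
  then have "computable ?f"
    by (intro comp_intros computable_comp[OF d(2)])
  moreover have "surj ?f"
  proof (rule surjI)
    fix xs :: "'a list"
    show "?f (list_encode (map (inv_into UNIV d) xs)) = xs"
      using d(1) by (simp add: surj_f_inv_f map_idI)
  qed
  ultimately show ?thesis unfolding enumerable_def by blast
qed

text \<open>
  Minimization tests the values of an enumeration one after the other.  Each test halts, so the
  search finds a value whenever there is one; which one is found is left open.
\<close>

theorem search_program:
  fixes P :: "'i::encodable \<Rightarrow> 'c::encodable \<Rightarrow> bool" and out :: "'c \<Rightarrow> 'o::encodable"
  assumes "enumerable TYPE('c)" "computable (\<lambda>p. P (fst p) (snd p))" "computable out"
  shows "\<exists>p. \<forall>i. (\<exists>c. P i c) \<longrightarrow> (\<exists>c. P i c \<and> computes p [enc i] (enc (out c)))"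
proof -
  obtain d :: "nat \<Rightarrow> 'c" where d: "surj d" "computable d"
    using assms(1) by (auto simp: enumerable_def)
  have "computable (\<lambda>p. P (snd p) (d (fst p)))"
    by (rule computable_comp2[of P, OF assms(2)]) (intro comp_intros computable_comp[OF d(2)])+
  then have "computable (\<lambda>p. if P (snd p) (d (fst p)) then 0 else 1 :: nat)"
    by (intro comp_intros)
  then obtain q where q: "\<And>n i. computes q [enc (n, i)] (if P i (d n) then 0 else 1)"
    by (fastforce simp: computable_def)
  have "computable (\<lambda>n. out (d n))" by (rule computable_comp[OF assms(3) d(2)])
  then obtain o' where o': "\<And>n. computes o' [n] (enc (out (d n)))"
    by (auto simp: computable_def)
  obtain r where r: "\<And>x y. computes r [x, y] (prod_encode (x, y))"
    using recursive_pair_program by blast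
  have test: "computes (Comp q [Comp r [Proj 0, Proj 1]]) [n, enc i] (if P i (d n) then 0 else 1)" for n i
  proof (rule computes_Comp1)
    show "computes (Comp r [Proj 0, Proj 1]) [n, enc i] (enc (n, i))"
      using computes_Comp2[OF computes.Proj[of 0 "[n, enc i]"] computes.Proj[of 1 "[n, enc i]"] r]
      by simp
  qed (rule q)
  have "\<exists>c. P i c \<and> computes (Comp o' [Mu (Comp q [Comp r [Proj 0, Proj 1]])]) [enc i] (enc (out c))" if "P i c" for i c
  proof -
    let ?n = "LEAST n. P i (d n)"
    obtain m where "d m = c" using d(1) by (metis surjD)
    with that have n: "P i (d ?n)" by (intro LeastI[of "\<lambda>n. P i (d n)" m]) simp
    have "computes (Mu (Comp q [Comp r [Proj 0, Proj 1]])) [enc i] ?n"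
    proof (rule computes.Mu)
      show "computes (Comp q [Comp r [Proj 0, Proj 1]]) [?n, enc i] 0" using test[of ?n i] n by simp
      show "\<forall>m<?n. \<exists>y. computes (Comp q [Comp r [Proj 0, Proj 1]]) [m, enc i] (Suc y)"
      proof (intro allI impI)
        fix m assume "m < ?n"
        then have "\<not> P i (d m)" by (rule not_less_Least)
        then show "\<exists>y. computes (Comp q [Comp r [Proj 0, Proj 1]]) [m, enc i] (Suc y)"
          using test[of m i] by auto
      qed
    qed
    then have "computes (Comp o' [Mu (Comp q [Comp r [Proj 0, Proj 1]])]) [enc i] (enc (out (d ?n)))"
      using o' by (rule computes_Comp1)
    with n show ?thesis by blast
  qed
  then show ?thesis by blast
qed

section \<open>Normal forms\<close>

text \<open>
  A syllable is a letter of a free group or an element of one of the factors.  Treating single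
  letters, rather than elements of the free group, as syllables makes all computations local.
\<close>

type_synonym ('j, 'i, 'g) syllable = "('j \<times> bool) + ('i \<times> 'g)"

lemma inv_letter_involution [simp]: "inv_letter (inv_letter p) = p"
  and fst_inv_letter [simp]: "fst (inv_letter p) = fst p"
  by (simp_all add: inv_letter_def)

lemma inv_letter_neq [simp]: "inv_letter p \<noteq> p" "p \<noteq> inv_letter p"
  by (cases p; simp add: inv_letter_def)+

fun joinable :: "('j, 'i, 'g) syllable \<Rightarrow> ('j, 'i, 'g) syllable \<Rightarrow> bool" where
  "joinable (Inl p) (Inl q) \<longleftrightarrow> q \<noteq> inv_letter p"
| "joinable (Inr p) (Inr q) \<longleftrightarrow> fst p \<noteq> fst q"
| "joinable _ _ \<longleftrightarrow> True"

definition normal_forms ::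
    "('g, 'm) monoid_scheme \<Rightarrow> 'j set \<Rightarrow> 'i set \<Rightarrow> ('i \<Rightarrow> 'g set) \<Rightarrow> ('j, 'i, 'g) syllable list set" where
  "normal_forms G J I K =
     {s \<in> lists (Inl ` (J \<times> UNIV) \<union> Inr ` (SIGMA i:I. K i - {\<one>\<^bsub>G\<^esub>})). successively joinable s}"

definition lmul_letter :: "'j \<times> bool \<Rightarrow> ('j, 'i, 'g) syllable list \<Rightarrow> ('j, 'i, 'g) syllable list" where
  "lmul_letter p s = (if s \<noteq> [] \<and> hd s = Inl (inv_letter p) then tl s else Inl p # s)"

definition cons_factor ::
    "('g, 'm) monoid_scheme \<Rightarrow> 'i \<Rightarrow> 'g \<Rightarrow> ('j, 'i, 'g) syllable list \<Rightarrow> ('j, 'i, 'g) syllable list" where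
  "cons_factor G i k s = (if k = \<one>\<^bsub>G\<^esub> then s else Inr (i, k) # s)"

definition starts_with :: "'i \<Rightarrow> ('j, 'i, 'g) syllable list \<Rightarrow> bool" where
  "starts_with i s \<longleftrightarrow> (\<exists>k s'. s = Inr (i, k) # s')"

text \<open>
  Together with \<open>lmul_letter\<close> this describes multiplication from the left in the free product,
  whose elements are the normal forms.
\<close>

definition lmul_factor ::
    "('g, 'm) monoid_scheme \<Rightarrow> 'i \<Rightarrow> 'g \<Rightarrow> ('j, 'i, 'g) syllable list \<Rightarrow> ('j, 'i, 'g) syllable list" where
  "lmul_factor G i k s =
     (if starts_with i s then cons_factor G i (k \<otimes>\<^bsub>G\<^esub> snd (projr (hd s))) (tl s)
      else cons_factor G i k s)"

lemma Nil_normal_form [simp]: "[] \<in> normal_forms G J I K"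
  by (simp add: normal_forms_def)

lemma normal_form_Cons:
  "u # s \<in> normal_forms G J I K \<longleftrightarrow>
     u \<in> Inl ` (J \<times> UNIV) \<union> Inr ` (SIGMA i:I. K i - {\<one>\<^bsub>G\<^esub>}) \<and> s \<in> normal_forms G J I K \<and>
     (s \<noteq> [] \<longrightarrow> joinable u (hd s))"
  by (cases s) (auto simp: normal_forms_def)

lemma lmul_letter_normal_form:
  "s \<in> normal_forms G J I K \<Longrightarrow> fst p \<in> J \<Longrightarrow> lmul_letter p s \<in> normal_forms G J I K"
  by (cases s; cases p; cases "hd s") (auto simp: lmul_letter_def normal_form_Cons)

lemma lmul_letter_cancel:
  "s \<in> normal_forms G J I K \<Longrightarrow> lmul_letter (inv_letter p) (lmul_letter p s) = s"
proof (cases s)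
  case (Cons u s')
  moreover assume "s \<in> normal_forms G J I K"
  ultimately show ?thesis
    by (cases s'; cases u) (auto simp: lmul_letter_def normal_form_Cons)
qed (simp add: lmul_letter_def)

lemma lmul_letter_Cons:
  "Inl p # s \<in> normal_forms G J I K \<Longrightarrow> lmul_letter p s = Inl p # s"
  by (auto simp: lmul_letter_def normal_form_Cons)

lemma lmul_factor_Cons:
  "Inr (i, k) # s \<in> normal_forms G J I K \<Longrightarrow> lmul_factor G i k s = Inr (i, k) # s"
  by (auto simp: lmul_factor_def cons_factor_def starts_with_def normal_form_Cons)

lemma cons_factor_normal_form:
  "s \<in> normal_forms G J I K \<Longrightarrow> \<not> starts_with i s \<Longrightarrow> i \<in> I \<Longrightarrow> k \<in> K i \<Longrightarrow>
    cons_factor G i k s \<in> normal_forms G J I K"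
  by (cases s; cases "hd s") (auto simp: cons_factor_def normal_form_Cons starts_with_def)

context group
begin

lemma lmul_factor_cons_factor:
  assumes "\<not> starts_with i s" "k \<in> carrier G" "k' \<in> carrier G"
  shows "lmul_factor G i k (cons_factor G i k' s) = cons_factor G i (k \<otimes> k') s"
  using assms by (auto simp: lmul_factor_def cons_factor_def starts_with_def)

text \<open>
  Splitting off a possibly trivial first syllable of factor \<open>i\<close> makes multiplication by elements of
  this factor a multiplication of first syllables, from which its properties are immediate.
\<close>

lemma normal_form_as_cons_factor:
  assumes "s \<in> normal_forms G J I K" "subgroup (K i) G"
  obtains k s' where "s = cons_factor G i k s'" "k \<in> K i" "\<not> starts_with i s'"
    "s' \<in> normal_forms G J I K"
proof (cases "starts_with i s")
  case True
  then obtain k s' where s: "s = Inr (i, k) # s'" by (auto simp: starts_with_def)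
  then have "s = cons_factor G i k s'" "k \<in> K i" "\<not> starts_with i s'" "s' \<in> normal_forms G J I K"
    using assms by (auto simp: cons_factor_def normal_form_Cons starts_with_def)
  then show thesis by (rule that)
next
  case False
  then show thesis
    using that[of \<one> s] assms subgroup.one_closed by (auto simp: cons_factor_def)
qed

lemma lmul_factor_normal_form:
  assumes "s \<in> normal_forms G J I K" "subgroup (K i) G" "i \<in> I" "k \<in> K i"
  shows "lmul_factor G i k s \<in> normal_forms G J I K"
proof -
  obtain k' s' where s: "s = cons_factor G i k' s'" "k' \<in> K i" "\<not> starts_with i s'"
    "s' \<in> normal_forms G J I K"
    using normal_form_as_cons_factor[OF assms(1,2)] .
  have kk: "k \<in> carrier G" "k' \<in> carrier G" "k \<otimes> k' \<in> K i"
    using assms s(2) by (auto intro: subgroup.mem_carrier subgroup.m_closed)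
  show ?thesis
    unfolding s(1) lmul_factor_cons_factor[OF s(3) kk(1,2)]
    using s kk assms by (intro cons_factor_normal_form)
qed

lemma lmul_factor_mult:
  assumes "s \<in> normal_forms G J I K" "subgroup (K i) G" "k \<in> K i" "l \<in> K i"
  shows "lmul_factor G i k (lmul_factor G i l s) = lmul_factor G i (k \<otimes> l) s"
proof -
  obtain k' s' where s: "s = cons_factor G i k' s'" "k' \<in> K i" "\<not> starts_with i s'"
    using normal_form_as_cons_factor[OF assms(1,2)] by metis
  have "k \<in> carrier G" "l \<in> carrier G" "k' \<in> carrier G"
    using assms s(2) by (auto intro: subgroup.mem_carrier)
  then show ?thesis
    by (simp add: s(1) lmul_factor_cons_factor[OF s(3)] m_assoc)
qed

lemma lmul_factor_one:
  assumes "s \<in> normal_forms G J I K" "subgroup (K i) G"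
  shows "lmul_factor G i \<one> s = s"
proof -
  obtain k' s' where s: "s = cons_factor G i k' s'" "k' \<in> K i" "\<not> starts_with i s'"
    using normal_form_as_cons_factor[OF assms(1,2)] by metis
  have "k' \<in> carrier G"
    using assms s(2) by (auto intro: subgroup.mem_carrier)
  then show ?thesis
    by (simp add: s(1) lmul_factor_cons_factor[OF s(3)])
qed

section \<open>Existence of normal forms\<close>

text \<open>
  With \<open>y = \<one>\<close> and \<open>M\<close> the set of values of normal forms, this reduces the existence of normal forms
  to the multiplication of a normal form by one generator.
\<close>

lemma generate_left_closed:
  assumes "x \<in> generate G B" "B \<subseteq> carrier G" "M \<subseteq> carrier G"
    "\<And>b y. b \<in> B \<Longrightarrow> y \<in> M \<Longrightarrow> b \<otimes> y \<in> M \<and> inv b \<otimes> y \<in> M" "y \<in> M"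
  shows "x \<otimes> y \<in> M"
  using assms(1,5)
proof (induction arbitrary: y rule: generate.induct)
  case (eng x x')
  have "x \<in> carrier G" "x' \<in> carrier G" "y \<in> carrier G"
    using generate_in_carrier[OF assms(2)] eng assms(3) by auto
  then have "x \<otimes> x' \<otimes> y = x \<otimes> (x' \<otimes> y)" by (rule m_assoc)
  with eng show ?case by simp
qed (use assms in auto)

lemma word_eval_closed: "B \<subseteq> carrier G \<Longrightarrow> w \<in> words_over B \<Longrightarrow> word_eval G w \<in> carrier G"
  by (induction w) (auto simp: word_eval_def words_over_def)

lemma freely_reduced_word_exists:
  assumes "B \<subseteq> carrier G" "x \<in> generate G B"
  shows "\<exists>w. w \<in> words_over B \<and> freely_reduced w \<and> word_eval G w = x"
proof -
  define M where "M = {word_eval G w | w. w \<in> words_over B \<and> freely_reduced w}"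
  have "\<one> \<in> M"
    unfolding M_def by (intro CollectI exI[of _ "[]"])
      (simp add: word_eval_def words_over_def freely_reduced_def)
  have letter: "(if \<sigma> then b else inv b) \<otimes> y \<in> M" if b: "b \<in> B" and y: "y \<in> M" for b y \<sigma>
  proof -
    obtain w where w: "w \<in> words_over B" "freely_reduced w" "y = word_eval G w"
      using y by (auto simp: M_def)
    show ?thesis
    proof (cases "w \<noteq> [] \<and> hd w = (b, \<not> \<sigma>)")
      case True
      then obtain w' where w': "w = (b, \<not> \<sigma>) # w'" by (cases w) auto
      then have "w' \<in> words_over B" "freely_reduced w'"
        using w by (auto simp: words_over_def freely_reduced_def successively_Cons)
      moreover have "(if \<sigma> then b else inv b) \<otimes> y = word_eval G w'"
        using w w' b assms(1) word_eval_closed[OF assms(1) calculation(1)]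
        by (auto simp: word_eval_def m_assoc[symmetric] subset_iff)
      ultimately show ?thesis by (auto simp: M_def)
    next
      case False
      then have "freely_reduced ((b, \<sigma>) # w)"
        using w by (cases w) (auto simp: freely_reduced_def inv_letter_def)
      moreover have "(b, \<sigma>) # w \<in> words_over B" using w b by (simp add: words_over_def)
      moreover have "(if \<sigma> then b else inv b) \<otimes> y = word_eval G ((b, \<sigma>) # w)"
        by (simp add: word_eval_def w)
      ultimately show ?thesis unfolding M_def by blast
    qed
  qed
  have "x \<otimes> \<one> \<in> M"
  proof (rule generate_left_closed[OF assms(2,1)])
    show "M \<subseteq> carrier G" using word_eval_closed[OF assms(1)] by (auto simp: M_def)
    fix b y assume "b \<in> B" "y \<in> M"
    then show "b \<otimes> y \<in> M \<and> inv b \<otimes> y \<in> M" using letter[of b y True] letter[of b y False] by simp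
  qed fact
  moreover have "x \<in> carrier G" using assms generate_in_carrier by blast
  ultimately show ?thesis by (auto simp: M_def)
qed

lemma reduced_sequence_closed:
  assumes "\<And>K. K \<in> set Ks \<Longrightarrow> subgroup K G" "reduced_sequence G Ks s"
  shows "foldr (\<lambda>p y. snd p \<otimes> y) s \<one> \<in> carrier G"
  using assms(2)
proof (induction s)
  case (Cons p s)
  then have "reduced_sequence G Ks s" "fst p < length Ks" "snd p \<in> Ks ! fst p"
    by (auto simp: reduced_sequence_def successively_Cons)
  with Cons.IH show ?case
    using assms(1)[of "Ks ! fst p"] subgroup.mem_carrier by fastforce
qed simp

lemma reduced_sequence_exists:
  assumes sub: "\<And>K. K \<in> set Ks \<Longrightarrow> subgroup K G" and x: "x \<in> generate G (\<Union> (set Ks))"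
  shows "\<exists>s. reduced_sequence G Ks s \<and> foldr (\<lambda>p y. snd p \<otimes> y) s \<one> = x"
proof -
  define val where "val s = foldr (\<lambda>p y. snd p \<otimes> y) s \<one>" for s :: "(nat \<times> 'a) list"
  define M where "M = {val s | s. reduced_sequence G Ks s}"
  have val: "val s \<in> carrier G" if "reduced_sequence G Ks s" for s
    unfolding val_def by (rule reduced_sequence_closed[OF sub that])
  have "\<one> \<in> M"
    unfolding M_def by (intro CollectI exI[of _ "[]"]) (simp add: val_def reduced_sequence_def)
  have step: "k \<otimes> y \<in> M" if k: "k \<in> \<Union> (set Ks)" and y: "y \<in> M" for k y
  proof (cases "k = \<one>")
    case True
    then show ?thesis using y val by (auto simp: M_def)
  next
    case k1: False
    obtain i where i: "i < length Ks" "k \<in> Ks ! i" using k by (auto simp: in_set_conv_nth)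
    then have sub_i: "subgroup (Ks ! i) G" using sub by simp
    obtain s where s: "reduced_sequence G Ks s" "y = val s" using y by (auto simp: M_def)
    show ?thesis
    proof (cases "s \<noteq> [] \<and> fst (hd s) = i")
      case True
      then obtain l s' where s': "s = (i, l) # s'" by (cases s) auto
      have l: "l \<in> Ks ! i" and red: "reduced_sequence G Ks s'"
        using s s' by (auto simp: reduced_sequence_def successively_Cons)
      have kl: "k \<otimes> l \<in> Ks ! i" using i l sub_i by (simp add: subgroup.m_closed)
      have ky: "k \<otimes> y = (k \<otimes> l) \<otimes> val s'"
        using i l sub_i val[OF red] by (auto simp: s s' val_def m_assoc subgroup.mem_carrier)
      show ?thesis
      proof (cases "k \<otimes> l = \<one>")
        case True
        then show ?thesis using ky val[OF red] red by (auto simp: M_def)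
      next
        case False
        then have "reduced_sequence G Ks ((i, k \<otimes> l) # s')"
          using s s' kl i by (auto simp: reduced_sequence_def successively_Cons)
        moreover have "val ((i, k \<otimes> l) # s') = k \<otimes> y" by (simp add: ky val_def)
        ultimately show ?thesis
          unfolding M_def by (intro CollectI exI[of _ "(i, k \<otimes> l) # s'"]) simp
      qed
    next
      case False
      then have "reduced_sequence G Ks ((i, k) # s)"
        using s i k1 by (auto simp: reduced_sequence_def successively_Cons)
      moreover have "val ((i, k) # s) = k \<otimes> y" by (simp add: s val_def)
      ultimately show ?thesis
        unfolding M_def by (intro CollectI exI[of _ "(i, k) # s"]) simp
    qed
  qed
  have carr: "\<Union> (set Ks) \<subseteq> carrier G" using sub subgroup.subset by blast
  have "x \<otimes> \<one> \<in> M"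
  proof (rule generate_left_closed[OF x carr])
    show "M \<subseteq> carrier G" using val by (auto simp: M_def)
    fix k y assume ky: "k \<in> \<Union> (set Ks)" "y \<in> M"
    then have "inv k \<in> \<Union> (set Ks)" using sub subgroup.m_inv_closed by fast
    with ky show "k \<otimes> y \<in> M \<and> inv k \<otimes> y \<in> M" by (simp add: step)
  qed fact
  moreover have "x \<in> carrier G" using x carr generate_in_carrier by blast
  ultimately show ?thesis by (auto simp: M_def val_def)
qed


section \<open>Free products from uniqueness of normal forms\<close>

lemma subgroup_conjugate:
  assumes "subgroup K G" "g \<in> carrier G"
  shows "subgroup (conjugate G g K) G"
proof (rule subgroupI)
  note K = subgroup.mem_carrier[OF assms(1)]
  show "conjugate G g K \<subseteq> carrier G" using K assms(2) by (auto simp: conjugate_def)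
  show "conjugate G g K \<noteq> {}" using subgroup.one_closed[OF assms(1)] by (auto simp: conjugate_def)
  fix x assume "x \<in> conjugate G g K"
  then obtain k where k: "k \<in> K" "x = g \<otimes> k \<otimes> inv g" by (auto simp: conjugate_def)
  then have "inv x = g \<otimes> inv k \<otimes> inv g" using K assms(2) by (simp add: inv_mult_group m_assoc)
  then show "inv x \<in> conjugate G g K"
    using k(1) assms(1) by (auto simp: conjugate_def subgroup.m_inv_closed)
  fix y assume "y \<in> conjugate G g K"
  then obtain l where l: "l \<in> K" "y = g \<otimes> l \<otimes> inv g" by (auto simp: conjugate_def)
  have "x \<otimes> y = g \<otimes> (k \<otimes> l) \<otimes> inv g"
    using k l K assms(2) by (simp add: m_assoc inv_solve_left')
  then show "x \<otimes> y \<in> conjugate G g K"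
    using k(1) l(1) assms(1) by (auto simp: conjugate_def subgroup.m_closed)
qed

text \<open>The factor with index \<open>i\<close> is conjugated by \<open>g i\<close>, as in a Kurosh decomposition.\<close>

definition syllable_val :: "('j \<Rightarrow> 'a) \<Rightarrow> ('i \<Rightarrow> 'a) \<Rightarrow> ('j, 'i, 'a) syllable \<Rightarrow> 'a" where
  "syllable_val b g u = (case u of Inl p \<Rightarrow> if snd p then b (fst p) else inv b (fst p)
     | Inr p \<Rightarrow> g (fst p) \<otimes> snd p \<otimes> inv g (fst p))"

definition normal_form_val :: "('j \<Rightarrow> 'a) \<Rightarrow> ('i \<Rightarrow> 'a) \<Rightarrow> ('j, 'i, 'a) syllable list \<Rightarrow> 'a" where
  "normal_form_val b g s = foldr (\<lambda>u x. syllable_val b g u \<otimes> x) s \<one>"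

context
  fixes b :: "'j \<Rightarrow> 'a" and g :: "'i \<Rightarrow> 'a" and J :: "'j set" and K :: "'i \<Rightarrow> 'a set" and ixs :: "'i list"
  assumes b: "b ` J \<subseteq> carrier G" and g: "g ` set ixs \<subseteq> carrier G"
    and K: "\<And>i. i \<in> set ixs \<Longrightarrow> subgroup (K i) G" and distinct: "distinct ixs"
    and inj: "inj_on (normal_form_val b g) (normal_forms G J (set ixs) K)"
begin

abbreviation (input) "nfs \<equiv> normal_forms G J (set ixs) K"

lemma letter_normal_form:
  "map Inl w \<in> nfs \<longleftrightarrow> w \<in> words_over J \<and> freely_reduced w"
proof -
  have "successively joinable (map Inl w :: ('j, 'i, 'a) syllable list) \<longleftrightarrow> freely_reduced w"
    by (simp add: freely_reduced_def successively_map)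
  then show ?thesis by (auto simp: normal_forms_def words_over_def lists_eq_set)
qed

lemma normal_form_val_letters:
  "normal_form_val b g (map Inl w) = word_eval G (map (\<lambda>p. (b (fst p), snd p)) w)"
  by (induction w) (auto simp: normal_form_val_def word_eval_def syllable_val_def)

lemma inj_on_basis: "inj_on b J"
proof (rule inj_onI)
  fix j j' assume "j \<in> J" "j' \<in> J" and eq: "b j = b j'"
  then have "map Inl [(j, True)] \<in> nfs" "map Inl [(j', True)] \<in> nfs"
    unfolding letter_normal_form by (auto simp: words_over_def freely_reduced_def)
  moreover have "normal_form_val b g (map Inl [(j, True)]) = normal_form_val b g (map Inl [(j', True)])"
    unfolding normal_form_val_letters using eq by simp
  ultimately have "map Inl [(j, True)] = (map Inl [(j', True)] :: ('j, 'i, 'a) syllable list)"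
    using inj by (metis inj_onD)
  then show "j = j'" by simp
qed

text \<open>
  Words over the image of the basis are pulled back to words over the index set, where uniqueness
  of normal forms applies.
\<close>

definition relabel :: "'a word \<Rightarrow> 'j word" where
  "relabel w = map (\<lambda>p. (inv_into J b (fst p), snd p)) w"

lemma relabel:
  assumes "w \<in> words_over (b ` J)"
  shows "map (\<lambda>p. (b (fst p), snd p)) (relabel w) = w" "relabel w \<in> words_over J"
    "freely_reduced w \<Longrightarrow> freely_reduced (relabel w)"
proof -
  have 1: "map (\<lambda>p. (b (fst p), snd p)) (relabel w) = w" if "w \<in> words_over (b ` J)" for w
    using that by (induction w) (auto simp: relabel_def words_over_def f_inv_into_f)
  show "map (\<lambda>p. (b (fst p), snd p)) (relabel w) = w" using assms by (rule 1)
  show "relabel w \<in> words_over J"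
    using assms by (induction w) (auto simp: relabel_def words_over_def inv_into_into)
  assume red: "freely_reduced w"
  have "successively (\<lambda>p q. (b (fst q), snd q) \<noteq> inv_letter (b (fst p), snd p)) (relabel w)"
    using red unfolding freely_reduced_def by (subst (asm) 1[OF assms, symmetric]) (simp add: successively_map)
  then show "freely_reduced (relabel w)"
    unfolding freely_reduced_def by (rule successively_mono) (auto simp: inv_letter_def)
qed

lemma free_basis_letters: "free_basis G (b ` J) (generate G (b ` J))"
  unfolding free_basis_def
proof (intro conjI ballI ex_ex1I)
  fix x assume "x \<in> generate G (b ` J)"
  then show "\<exists>w. w \<in> words_over (b ` J) \<and> freely_reduced w \<and> word_eval G w = x"
    by (rule freely_reduced_word_exists[OF b])
next
  fix x w w'
  assume w: "w \<in> words_over (b ` J) \<and> freely_reduced w \<and> word_eval G w = x"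
    and w': "w' \<in> words_over (b ` J) \<and> freely_reduced w' \<and> word_eval G w' = x"
  have "map Inl (relabel w) \<in> nfs" "map Inl (relabel w') \<in> nfs"
    unfolding letter_normal_form using w w' relabel(2,3) by blast+
  moreover have "normal_form_val b g (map Inl (relabel w)) = normal_form_val b g (map Inl (relabel w'))"
    unfolding normal_form_val_letters using w w' relabel(1) by simp
  ultimately have "map Inl (relabel w) = (map Inl (relabel w') :: ('j, 'i, 'a) syllable list)"
    using inj by (metis inj_onD)
  then have "relabel w = relabel w'" by (simp add: inj_map_eq_map)
  then show "w = w'" using relabel(1) w w' by metis
qed (use b in auto)

abbreviation (input) "factors \<equiv> generate G (b ` J) # map (\<lambda>i. conjugate G (g i) (K i)) ixs"

lemma factors_subgroup: "Q \<in> set factors \<Longrightarrow> subgroup Q G"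
  using subgroup_conjugate[OF K] generate_is_subgroup[OF b] g by (auto simp: image_subset_iff)

definition basis_word :: "'a \<Rightarrow> 'j word" where
  "basis_word x = (SOME w. w \<in> words_over J \<and> freely_reduced w \<and> normal_form_val b g (map Inl w) = x)"

lemma basis_word:
  assumes "x \<in> generate G (b ` J)"
  shows "basis_word x \<in> words_over J" "freely_reduced (basis_word x)"
    "normal_form_val b g (map Inl (basis_word x)) = x"
proof -
  obtain w where "w \<in> words_over (b ` J)" "freely_reduced w" "word_eval G w = x"
    using freely_reduced_word_exists[OF b assms] by blast
  then have "\<exists>w. w \<in> words_over J \<and> freely_reduced w \<and> normal_form_val b g (map Inl w) = x"
    using relabel[of w] by (intro exI[of _ "relabel w"]) (simp add: normal_form_val_letters)
  from someI_ex[OF this] show "basis_word x \<in> words_over J" "freely_reduced (basis_word x)"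
    "normal_form_val b g (map Inl (basis_word x)) = x"
    by (simp_all add: basis_word_def)
qed

text \<open>
  In the list of factors the free group has index 0.  Its elements are written as freely reduced
  words, and elements of the conjugated factors are conjugated back.
\<close>

fun expand :: "(nat \<times> 'a) list \<Rightarrow> ('j, 'i, 'a) syllable list" where
  "expand [] = []"
| "expand ((0, x) # s) = map Inl (basis_word x) @ expand s"
| "expand ((Suc n, x) # s) = Inr (ixs ! n, inv g (ixs ! n) \<otimes> x \<otimes> g (ixs ! n)) # expand s"

lemma normal_form_val_append:
  assumes "s \<in> nfs" "t \<in> nfs"
  shows "normal_form_val b g (s @ t) = normal_form_val b g s \<otimes> normal_form_val b g t"
    and normal_form_val_closed: "normal_form_val b g t \<in> carrier G"
proof -
  have syl: "syllable_val b g u \<in> carrier G"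
    if "u \<in> Inl ` (J \<times> UNIV) \<union> Inr ` (SIGMA i:set ixs. K i - {\<one>})" for u
    using that b g K[THEN subgroup.mem_carrier]
    by (auto simp: syllable_val_def image_subset_iff)
  have closed: "normal_form_val b g s \<in> carrier G" if "s \<in> nfs" for s
    using that by (induction s) (auto simp: normal_form_val_def normal_form_Cons intro!: syl)
  then show "normal_form_val b g t \<in> carrier G" using assms(2) .
  show "normal_form_val b g (s @ t) = normal_form_val b g s \<otimes> normal_form_val b g t"
    using assms(1)
  proof (induction s)
    case (Cons u s)
    then show ?case
      using closed[OF assms(2)] closed[of s] syl[of u]
      by (simp add: normal_form_val_def normal_form_Cons m_assoc)
  qed (simp add: normal_form_val_def closed[OF assms(2), unfolded normal_form_val_def])
qed

lemma append_normal_form: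
  "s \<in> nfs \<Longrightarrow> t \<in> nfs \<Longrightarrow> (s \<noteq> [] \<Longrightarrow> t \<noteq> [] \<Longrightarrow> joinable (last s) (hd t)) \<Longrightarrow> s @ t \<in> nfs"
  by (auto simp: normal_forms_def successively_append_iff)

lemma basis_word_neq_Nil: "x \<in> generate G (b ` J) \<Longrightarrow> x \<noteq> \<one> \<Longrightarrow> basis_word x \<noteq> []"
  using basis_word(3)[of x] by (auto simp: normal_form_val_def)

lemma expand_head:
  assumes "reduced_sequence G factors ((i, x) # s)"
  shows "expand ((i, x) # s) \<noteq> []" "isl (hd (expand ((i, x) # s))) \<longleftrightarrow> i = 0"
    "i = Suc n \<Longrightarrow> fst (projr (hd (expand ((i, x) # s)))) = ixs ! n"
  using assms basis_word_neq_Nil[of x]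
  by (cases i; auto simp: reduced_sequence_def hd_append hd_map)+

lemma reduced_sequence_Cons:
  assumes "reduced_sequence G factors ((i, x) # s)"
  shows "reduced_sequence G factors s"
    "i = 0 \<Longrightarrow> x \<in> generate G (b ` J) \<and> x \<noteq> \<one>"
    "i = Suc n \<Longrightarrow> n < length ixs \<and> x \<noteq> \<one> \<and> (\<exists>k\<in>K (ixs ! n). x = g (ixs ! n) \<otimes> k \<otimes> inv g (ixs ! n))"
    "s \<noteq> [] \<Longrightarrow> fst (hd s) \<noteq> i"
  using assms by (cases s; auto simp: reduced_sequence_def conjugate_def)+

lemma conj_cancel:
  assumes "n < length ixs" "k \<in> K (ixs ! n)"
  shows "inv g (ixs ! n) \<otimes> (g (ixs ! n) \<otimes> k \<otimes> inv g (ixs ! n)) \<otimes> g (ixs ! n) = k"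
    "g (ixs ! n) \<otimes> k \<otimes> inv g (ixs ! n) \<noteq> \<one> \<Longrightarrow> k \<noteq> \<one>"
proof -
  have gn: "g (ixs ! n) \<in> carrier G" using g assms(1) by auto
  have k: "k \<in> carrier G" using K[of "ixs ! n"] assms subgroup.mem_carrier by fastforce
  show "inv g (ixs ! n) \<otimes> (g (ixs ! n) \<otimes> k \<otimes> inv g (ixs ! n)) \<otimes> g (ixs ! n) = k"
    using gn k by (simp add: m_assoc) (simp add: m_assoc[symmetric])
  show "g (ixs ! n) \<otimes> k \<otimes> inv g (ixs ! n) \<noteq> \<one> \<Longrightarrow> k \<noteq> \<one>"
    using gn by auto
qed

lemma expand_normal_form:
  assumes "reduced_sequence G factors s"
  shows "expand s \<in> nfs" "normal_form_val b g (expand s) = foldr (\<lambda>p y. snd p \<otimes> y) s \<one>"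
proof -
  have "expand s \<in> nfs \<and> normal_form_val b g (expand s) = foldr (\<lambda>p y. snd p \<otimes> y) s \<one>"
    using assms
  proof (induction s)
    case (Cons p s)
    obtain i x where p: "p = (i, x)" by (cases p)
    note red = reduced_sequence_Cons[OF Cons.prems[unfolded p]]
    have IH: "expand s \<in> nfs" "normal_form_val b g (expand s) = foldr (\<lambda>p y. snd p \<otimes> y) s \<one>"
      using Cons.IH red(1) by auto
    show ?case
    proof (cases i)
      case 0
      then have x: "x \<in> generate G (b ` J)" "x \<noteq> \<one>" using red(2) by auto
      have w: "map Inl (basis_word x) \<in> nfs"
        unfolding letter_normal_form using basis_word[OF x(1)] by blast
      have "joinable (last (map Inl (basis_word x))) (hd (expand s))" if "expand s \<noteq> []"
      proof -
        from that have "s \<noteq> []" by auto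
        then obtain i' x' s' where s: "s = (i', x') # s'" by (cases s) auto
        then have "i' \<noteq> 0" using red(4) 0 by simp
        then have "\<not> isl (hd (expand s))"
          using expand_head(2)[of i' x' s'] red(1) s by simp
        then obtain q where "hd (expand s) = Inr q" by (cases "hd (expand s)") auto
        then show ?thesis using basis_word_neq_Nil[OF x] by (simp add: last_map)
      qed
      then have "map Inl (basis_word x) @ expand s \<in> nfs"
        by (intro append_normal_form w IH(1))
      then show ?thesis
        using normal_form_val_append[OF w IH(1)] basis_word(3)[OF x(1)] IH(2)
        by (simp add: p 0)
    next
      case (Suc n)
      then obtain k where n: "n < length ixs" "x \<noteq> \<one>" and
        k: "k \<in> K (ixs ! n)" "x = g (ixs ! n) \<otimes> k \<otimes> inv g (ixs ! n)"
        using red(3) by blast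
      have eq: "expand ((i, x) # s) = Inr (ixs ! n, k) # expand s"
        using conj_cancel(1)[OF n(1) k(1)] by (simp add: Suc k(2))
      have "joinable (Inr (ixs ! n, k)) (hd (expand s))" if "expand s \<noteq> []"
      proof -
        from that have "s \<noteq> []" by auto
        then obtain i' x' s' where s: "s = (i', x') # s'" by (cases s) auto
        then have i': "i' \<noteq> Suc n" using red(4) Suc by simp
        have red': "reduced_sequence G factors ((i', x') # s')" using red(1) s by simp
        show ?thesis
        proof (cases i')
          case 0
          then have "isl (hd (expand s))" using expand_head(2)[OF red'] s by simp
          then show ?thesis by (cases "hd (expand s)") auto
        next
          case (Suc n')
          then have "\<not> isl (hd (expand s))" "fst (projr (hd (expand s))) = ixs ! n'"
            using expand_head(2,3)[OF red'] s by simp_all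
          moreover have "n' < length ixs" using reduced_sequence_Cons(3)[OF red' Suc] by simp
          then have "ixs ! n' \<noteq> ixs ! n"
            using distinct n(1) i' Suc by (simp add: nth_eq_iff_index_eq)
          ultimately show ?thesis by (cases "hd (expand s)") auto
        qed
      qed
      then have "Inr (ixs ! n, k) # expand s \<in> nfs"
        using IH(1) n k conj_cancel(2)[OF n(1) k(1)] by (auto simp: normal_form_Cons)
      then show ?thesis
        using IH(2) eq k(2) by (simp add: p normal_form_val_def syllable_val_def)
    qed
  qed (simp add: normal_form_val_def)
  then show "expand s \<in> nfs" "normal_form_val b g (expand s) = foldr (\<lambda>p y. snd p \<otimes> y) s \<one>"
    by blast+
qed

lemma takeWhile_expand:
  assumes "reduced_sequence G factors ((0, x) # s)"
  shows "takeWhile isl (expand ((0, x) # s)) = map Inl (basis_word x)"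
proof (cases s)
  case (Cons p s')
  obtain i y where p: "p = (i, y)" by (cases p)
  note red = reduced_sequence_Cons[OF assms]
  have "reduced_sequence G factors ((i, y) # s')" "i \<noteq> 0" using red(1,4) Cons p by auto
  then have "expand s \<noteq> []" "\<not> isl (hd (expand s))" using expand_head(1,2) Cons p by auto
  then have "takeWhile isl (expand s) = []" by (cases "expand s") auto
  then show ?thesis by (simp add: takeWhile_append)
qed (simp add: takeWhile_eq_all_conv)

text \<open>
  After a syllable of index 0 comes a syllable of another index, so the leading letters of the
  expansion are exactly the word of the first syllable.
\<close>

lemma expand_inj:
  "reduced_sequence G factors s \<Longrightarrow> reduced_sequence G factors t \<Longrightarrow> expand s = expand t \<Longrightarrow> s = t"
proof (induction s arbitrary: t)
  case Nil
  show ?case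
  proof (cases t)
    case (Cons p t')
    obtain i x where "p = (i, x)" by (cases p)
    with Nil Cons show ?thesis using expand_head(1)[of i x t'] by simp
  qed simp
next
  case (Cons p s)
  obtain i x where p: "p = (i, x)" by (cases p)
  note reds = Cons.prems(1)[unfolded p]
  obtain j y t' where t: "t = (j, y) # t'"
    using Cons.prems expand_head(1)[OF reds] p by (cases t) auto
  note redt = Cons.prems(2)[unfolded t]
  have eq: "expand ((i, x) # s) = expand ((j, y) # t')" using Cons.prems(3) p t by simp
  show ?case
  proof (cases i)
    case 0
    then have j: "j = 0" using expand_head(2)[OF reds] expand_head(2)[OF redt] eq by simp
    have "map Inl (basis_word x) = (map Inl (basis_word y) :: ('j, 'i, 'a) syllable list)"
      using takeWhile_expand[OF reds[unfolded 0]] takeWhile_expand[OF redt[unfolded j]] eq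
      unfolding 0 j by simp
    then have w: "basis_word x = basis_word y" by (simp add: inj_map_eq_map)
    then have "x = y"
      using basis_word(3) reduced_sequence_Cons(2)[OF reds 0] reduced_sequence_Cons(2)[OF redt j]
      by metis
    moreover have "s = t'"
      using Cons.IH[OF reduced_sequence_Cons(1)[OF reds] reduced_sequence_Cons(1)[OF redt]]
        eq w 0 j by simp
    ultimately show ?thesis using p t 0 j by simp
  next
    case (Suc n)
    then obtain m where j: "j = Suc m"
      using expand_head(2)[OF reds] expand_head(2)[OF redt] eq by (metis nat.exhaust nat.distinct(1))
    obtain k where n: "n < length ixs" and
      k: "k \<in> K (ixs ! n)" "x = g (ixs ! n) \<otimes> k \<otimes> inv g (ixs ! n)"
      using reduced_sequence_Cons(3)[OF reds Suc] by blast
    obtain l where m: "m < length ixs" and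
      l: "l \<in> K (ixs ! m)" "y = g (ixs ! m) \<otimes> l \<otimes> inv g (ixs ! m)"
      using reduced_sequence_Cons(3)[OF redt j] by blast
    have "Inr (ixs ! n, k) # expand s = Inr (ixs ! m, l) # expand t'"
      using eq conj_cancel(1)[OF n k(1)] conj_cancel(1)[OF m l(1)] by (simp add: Suc j k(2) l(2))
    then have "n = m" "k = l" "expand s = expand t'"
      using distinct n m by (simp_all add: nth_eq_iff_index_eq)
    then show ?thesis
      using Cons.IH[OF reduced_sequence_Cons(1)[OF reds] reduced_sequence_Cons(1)[OF redt]] p t Suc j k l
      by simp
  qed
qed

lemma internal_free_product_factors:
  "internal_free_product G factors (generate G (\<Union> (set factors)))"
  unfolding internal_free_product_def
proof (intro conjI ballI ex_ex1I)
  fix x assume "x \<in> generate G (\<Union> (set factors))"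
  then show "\<exists>s. reduced_sequence G factors s \<and> foldr (\<lambda>p y. snd p \<otimes> y) s \<one> = x"
    by (rule reduced_sequence_exists[rotated]) (rule factors_subgroup)
next
  fix x s t
  assume s: "reduced_sequence G factors s \<and> foldr (\<lambda>p y. snd p \<otimes> y) s \<one> = x"
    and t: "reduced_sequence G factors t \<and> foldr (\<lambda>p y. snd p \<otimes> y) t \<one> = x"
  have st: "reduced_sequence G factors s" "reduced_sequence G factors t"
    "foldr (\<lambda>p y. snd p \<otimes> y) s \<one> = foldr (\<lambda>p y. snd p \<otimes> y) t \<one>"
    using s t by simp_all
  have "expand s = expand t"
    by (rule inj_onD[OF inj _ expand_normal_form(1)[OF st(1)] expand_normal_form(1)[OF st(2)]])
      (simp add: expand_normal_form(2)[OF st(1)] expand_normal_form(2)[OF st(2)] st(3))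
  then show "s = t" using expand_inj s t by blast
qed (auto intro: factors_subgroup)

end

end

section \<open>Words and their inverses\<close>

abbreviation inv_word :: "'a word \<Rightarrow> 'a word" where
  "inv_word w \<equiv> rev (map inv_letter w)"

lemma inv_word_involution [simp]: "inv_word (inv_word w) = w"
  by (simp add: rev_map comp_def)

lemma inv_word_words_over [simp]: "inv_word w \<in> words_over X \<longleftrightarrow> w \<in> words_over X"
  using words_over_inverse[of w X] words_over_inverse[of "inv_word w" X]
  unfolding inv_word_involution by blast

lemma Nil_words_over [simp]: "[] \<in> words_over X"
  and Cons_words_over [simp]: "l # w \<in> words_over X \<longleftrightarrow> fst l \<in> X \<and> w \<in> words_over X"
  by (auto simp: words_over_def mem_Times_iff)

lemma words_over_mono: "X \<subseteq> Y \<Longrightarrow> words_over X \<subseteq> words_over Y"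
  by (auto simp: words_over_def)

lemma pres_class_Nil: "pres_class X R [] = \<one>\<^bsub>presented_group X R\<^esub>"
  by (simp add: presented_group_def)

lemma pres_class_closed: "w \<in> words_over X \<Longrightarrow> pres_class X R w \<in> carrier (presented_group X R)"
  by (simp add: carrier_presented_group)

lemma pres_class_left_inverse:
  "w \<in> words_over X \<Longrightarrow> pres_class X R (inv_word w @ w) = \<one>\<^bsub>presented_group X R\<^esub>"
  using pres_eq_left_inverse[of w X R]
  by (simp add: pres_class_Nil[symmetric] pres_class_eq_iff words_over_append)

lemma pres_class_inverse:
  assumes "w \<in> words_over X"
  shows "pres_class X R (inv_word w) = inv\<^bsub>presented_group X R\<^esub> pres_class X R w"
proof -
  interpret group "presented_group X R" by (rule group_presented_group)
  have "pres_class X R (inv_word w) \<otimes>\<^bsub>presented_group X R\<^esub> pres_class X R w = \<one>\<^bsub>presented_group X R\<^esub>"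
    using assms pres_class_left_inverse[of w X R] by (simp add: pres_class_mult)
  then show ?thesis using assms by (intro inv_equality[symmetric]) (simp_all add: pres_class_closed)
qed

lemma pres_class_cancel_middle:
  assumes "u \<in> words_over X" "v \<in> words_over X" "w \<in> words_over X"
  shows "pres_class X R (u @ v @ inv_word v @ w) = pres_class X R (u @ w)"
    "pres_class X R (u @ inv_word v @ v @ w) = pres_class X R (u @ w)"
proof -
  have *: "pres_class X R (u @ inv_word v @ v @ w) = pres_class X R (u @ w)"
    if "v \<in> words_over X" for v
    using pres_eq_context[OF pres_eq_left_inverse[OF that] assms(1,3)] assms that
    by (simp add: pres_class_eq_iff words_over_append)
  show "pres_class X R (u @ v @ inv_word v @ w) = pres_class X R (u @ w)"
    "pres_class X R (u @ inv_word v @ v @ w) = pres_class X R (u @ w)"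
    using *[of "inv_word v"] *[of v] assms by simp_all
qed

section \<open>Coverings and their twisted action\<close>

text \<open>The two free factors are indexed by \<open>True\<close> and \<open>False\<close>, which allows uniform arguments.\<close>

locale free_product_presentation =
  fixes X :: "bool \<Rightarrow> 'a set" and R :: "bool \<Rightarrow> 'a word set"
  assumes disjoint: "X True \<inter> X False = {}"
    and R: "R i \<subseteq> words_over (X i)"
begin

abbreviation "XX \<equiv> X True \<union> X False"
abbreviation "G \<equiv> presented_group XX (R True \<union> R False)"
abbreviation "c \<equiv> pres_class XX (R True \<union> R False)"

sublocale group G by (rule group_presented_group)

lemma words_over_side: "w \<in> words_over (X i) \<Longrightarrow> w \<in> words_over XX"
  using words_over_mono[of "X i" XX] by (cases i) auto

lemma side_eq: "fst l \<in> X i \<Longrightarrow> (fst l \<in> X True) = i"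
  using disjoint by (cases i) auto

lemma relator_trivial: "r \<in> R i \<Longrightarrow> c r = \<one>\<^bsub>G\<^esub>"
proof -
  assume r: "r \<in> R i"
  then have "r \<in> words_over XX" "r \<in> R True \<union> R False" using R words_over_side by (blast, cases i) auto
  then show ?thesis
    using pres_eq.relator[of "[]" XX "[]" r "R True \<union> R False"]
    by (simp add: pres_class_Nil[symmetric] pres_class_eq_iff)
qed

end

text \<open>
  The set \<open>P\<close> carries an action of \<open>G\<close>.  Its points are the edges of a graph whose vertices on side
  \<open>i\<close> are the orbits of \<open>P\<close> under the factor \<open>i\<close>; an orbit is denoted by one of its points, its
  root, and \<open>rep i q\<close> leads from the root to \<open>q\<close>.  An edge \<open>q\<close> joins \<open>root True q\<close> to
  \<open>root False q\<close>.  The edges in \<open>T\<close> receive no letter of the free group; later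
  \<open>T\<close> is the set of edges of a spanning tree.
\<close>

locale covering = free_product_presentation X R
  for X :: "bool \<Rightarrow> 'a set" and R :: "bool \<Rightarrow> 'a word set" +
  fixes P :: "'p set" and act :: "'a \<times> bool \<Rightarrow> 'p \<Rightarrow> 'p"
    and root :: "bool \<Rightarrow> 'p \<Rightarrow> 'p" and rep :: "bool \<Rightarrow> 'p \<Rightarrow> 'a word"
    and T :: "'p set" and base :: 'p
  assumes act: "fst l \<in> X i \<Longrightarrow> q \<in> P \<Longrightarrow> act l q \<in> P"
    and act_inverse: "fst l \<in> X i \<Longrightarrow> q \<in> P \<Longrightarrow> act l (act (inv_letter l) q) = q"
    and act_relator: "r \<in> R i \<Longrightarrow> q \<in> P \<Longrightarrow> foldr act r q = q"
    and root: "q \<in> P \<Longrightarrow> root i q \<in> P"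
    and root_act: "fst l \<in> X i \<Longrightarrow> q \<in> P \<Longrightarrow> root i (act l q) = root i q"
    and rep: "q \<in> P \<Longrightarrow> rep i q \<in> words_over (X i)"
    and rep_root: "q \<in> P \<Longrightarrow> foldr act (rep i q) (root i q) = q"
    and rep_of_root: "q \<in> P \<Longrightarrow> rep i (root i q) = []"
    and base: "base \<in> P"
begin

lemma rep_XX [simp]: "q \<in> P \<Longrightarrow> rep i q \<in> words_over XX"
  by (rule words_over_side[OF rep])

lemma acts: "w \<in> words_over XX \<Longrightarrow> q \<in> P \<Longrightarrow> foldr act w q \<in> P"
  by (induction w) (auto intro: act)

lemma acts_inverse:
  "w \<in> words_over XX \<Longrightarrow> q \<in> P \<Longrightarrow> foldr act (inv_word w) (foldr act w q) = q"
proof (induction w)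
  case (Cons l w)
  then have "act (inv_letter l) (act l (foldr act w q)) = foldr act w q"
    using act_inverse[of "inv_letter l" _ "foldr act w q"] acts[of w q] by auto
  with Cons show ?case by simp
qed simp

lemma root_acts: "w \<in> words_over (X i) \<Longrightarrow> q \<in> P \<Longrightarrow> root i (foldr act w q) = root i q"
  by (induction w) (auto simp: root_act acts words_over_side)

text \<open>The group of the vertex \<open>v\<close> on side \<open>i\<close>.\<close>

definition stab :: "bool \<times> 'p \<Rightarrow> 'a word set set" where
  "stab iv = c ` {w \<in> words_over (X (fst iv)). foldr act w (snd iv) = snd iv}"

lemma subgroup_stab: "v \<in> P \<Longrightarrow> subgroup (stab (i, v)) G"
proof (rule subgroupI)
  assume v: "v \<in> P"
  show "stab (i, v) \<subseteq> carrier G"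
    by (auto simp: stab_def intro!: pres_class_closed words_over_side)
  show "stab (i, v) \<noteq> {}" by (auto simp: stab_def intro!: exI[of _ "[]"])
  fix x assume "x \<in> stab (i, v)"
  then obtain w where w: "w \<in> words_over (X i)" "foldr act w v = v" "x = c w"
    by (auto simp: stab_def)
  have "foldr act (inv_word w) v = v"
    using acts_inverse[of w v] w v by (simp add: words_over_side)
  moreover have "inv\<^bsub>G\<^esub> x = c (inv_word w)" using w by (simp add: pres_class_inverse words_over_side)
  ultimately show "inv\<^bsub>G\<^esub> x \<in> stab (i, v)" using w by (auto simp: stab_def)
  fix y assume "y \<in> stab (i, v)"
  then obtain u where u: "u \<in> words_over (X i)" "foldr act u v = v" "y = c u"
    by (auto simp: stab_def)
  have "x \<otimes>\<^bsub>G\<^esub> y = c (w @ u)" using u w by (simp add: pres_class_mult words_over_side)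
  then show "x \<otimes>\<^bsub>G\<^esub> y \<in> stab (i, v)"
    using u w by (auto simp: stab_def words_over_append intro!: imageI)
qed

definition NF :: "('p, bool \<times> 'p, 'a word set) syllable list set" where
  "NF = normal_forms G UNIV (UNIV \<times> P) stab"

text \<open>
  The coordinate change at the edge \<open>q\<close> between the two sides: an edge outside of \<open>T\<close> costs its
  letter when it is crossed, an edge in \<open>T\<close> is crossed for free.
\<close>

definition twist :: "bool \<Rightarrow> 'p \<Rightarrow> ('p, bool \<times> 'p, 'a word set) syllable list \<Rightarrow> _" where
  "twist i q s = (if i \<and> q \<notin> T then lmul_letter (q, True) s else s)"

definition untwist :: "bool \<Rightarrow> 'p \<Rightarrow> ('p, bool \<times> 'p, 'a word set) syllable list \<Rightarrow> _" where
  "untwist i q s = (if i \<and> q \<notin> T then lmul_letter (q, False) s else s)"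

lemma twist_NF [simp]: "s \<in> NF \<Longrightarrow> twist i q s \<in> NF" "s \<in> NF \<Longrightarrow> untwist i q s \<in> NF"
  by (auto simp: twist_def untwist_def NF_def intro: lmul_letter_normal_form)

lemma twist_untwist [simp]:
  "s \<in> NF \<Longrightarrow> twist i q (untwist i q s) = s" "s \<in> NF \<Longrightarrow> untwist i q (twist i q s) = s"
  using lmul_letter_cancel[of s _ _ _ _ "(q, False)"] lmul_letter_cancel[of s _ _ _ _ "(q, True)"]
  by (auto simp: twist_def untwist_def NF_def inv_letter_def)

abbreviation "mul i v k \<equiv> lmul_factor G (i, v) k"

text \<open>
  The loop at the root that goes to \<open>q\<close> along its representative, follows \<open>w\<close>, and returns along
  the representative of the end point.
\<close>

definition cocycle :: "bool \<Rightarrow> 'a word \<Rightarrow> 'p \<Rightarrow> 'a word set" where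
  "cocycle i w q = c (inv_word (rep i (foldr act w q)) @ w @ rep i q)"

lemma cocycle_stab:
  assumes "w \<in> words_over (X i)" "q \<in> P"
  shows "cocycle i w q \<in> stab (i, root i q)"
proof -
  let ?q = "foldr act w q"
  have q: "?q \<in> P" "root i ?q = root i q" using assms by (auto simp: acts words_over_side root_acts)
  have "foldr act (inv_word (rep i ?q)) ?q = root i q"
    using acts_inverse[of "rep i ?q" "root i ?q"] q rep_root[OF q(1), of i] root[OF q(1), of i]
    by simp
  then show ?thesis
    using assms rep_root[OF assms(2), of i] rep[of q i] rep[of ?q i] q
    unfolding stab_def cocycle_def
    by (intro imageI) (simp add: words_over_append)
qed

lemma cocycle_append:
  assumes "u \<in> words_over (X i)" "w \<in> words_over (X i)" "q \<in> P"
  shows "cocycle i (u @ w) q = cocycle i u (foldr act w q) \<otimes>\<^bsub>G\<^esub> cocycle i w q"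
proof -
  let ?q = "foldr act w q" and ?q' = "foldr act u (foldr act w q)"
  have q: "?q \<in> P" "?q' \<in> P" using assms by (auto simp: acts words_over_side)
  note ws = words_over_side[OF assms(1)] words_over_side[OF assms(2)]
    rep_XX[OF q(1), of i] rep_XX[OF q(2), of i] rep_XX[OF assms(3), of i]
  have "cocycle i u ?q \<otimes>\<^bsub>G\<^esub> cocycle i w q =
      c ((inv_word (rep i ?q') @ u) @ rep i ?q @ inv_word (rep i ?q) @ (w @ rep i q))"
    unfolding cocycle_def using ws by (subst pres_class_mult) (simp_all add: words_over_append)
  also have "\<dots> = cocycle i (u @ w) q"
    using ws by (subst pres_class_cancel_middle) (simp_all add: words_over_append cocycle_def)
  finally show ?thesis by simp
qed

text \<open>
  Passing to the coordinates of its own side before and after, a letter multiplies the normal form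
  by its cocycle.
\<close>

definition Act :: "'a \<times> bool \<Rightarrow> 'p \<times> ('p, bool \<times> 'p, 'a word set) syllable list \<Rightarrow> _" where
  "Act l y = (let i = (fst l \<in> X True); q = fst y in
     (act l q, untwist i (act l q) (mul i (root i q) (cocycle i [l] q) (twist i q (snd y)))))"

abbreviation "Acts w y \<equiv> foldr Act w y"

lemma mul_NF [simp]:
  "s \<in> NF \<Longrightarrow> v \<in> P \<Longrightarrow> k \<in> stab (i, v) \<Longrightarrow> mul i v k s \<in> NF"
  unfolding NF_def by (rule lmul_factor_normal_form) (auto intro: subgroup_stab)

lemma mul_mul:
  "s \<in> NF \<Longrightarrow> v \<in> P \<Longrightarrow> k \<in> stab (i, v) \<Longrightarrow> k' \<in> stab (i, v) \<Longrightarrow>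
    mul i v k (mul i v k' s) = mul i v (k \<otimes>\<^bsub>G\<^esub> k') s"
  unfolding NF_def by (rule lmul_factor_mult) (auto intro: subgroup_stab)

lemma mul_one: "s \<in> NF \<Longrightarrow> v \<in> P \<Longrightarrow> mul i v \<one>\<^bsub>G\<^esub> s = s"
  unfolding NF_def by (rule lmul_factor_one) (auto intro: subgroup_stab)

text \<open>
  Inside of a word over one alphabet the coordinate changes cancel and the cocycles multiply.
\<close>

lemma Acts_side:
  assumes "w \<in> words_over (X i)" "q \<in> P" "s \<in> NF"
  shows "Acts w (q, s) =
    (foldr act w q, untwist i (foldr act w q) (mul i (root i q) (cocycle i w q) (twist i q s)))"
  using assms(1)
proof (induction w)
  case Nil
  have "cocycle i [] q = \<one>\<^bsub>G\<^esub>"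
    using assms(2) by (simp add: cocycle_def pres_class_left_inverse)
  then show ?case using assms by (simp add: mul_one root)
next
  case (Cons l w)
  let ?q = "foldr act w q"
  have l: "[l] \<in> words_over (X i)" "w \<in> words_over (X i)" using Cons.prems by auto
  have i: "(fst l \<in> X True) = i" using l(1) by (intro side_eq) simp
  have q: "?q \<in> P" "root i ?q = root i q" using l assms by (auto simp: acts words_over_side root_acts)
  note k = cocycle_stab[OF l(2) assms(2)] cocycle_stab[OF l(1) q(1), unfolded q(2)]
  show ?case
    using Cons k cocycle_append[OF l assms(2)] assms(2,3)
    by (simp add: Act_def i Let_def q mul_mul root)
qed

lemma Acts_closed:
  assumes "w \<in> words_over XX" "q \<in> P" "s \<in> NF"
  shows "Acts w (q, s) \<in> P \<times> NF" "fst (Acts w (q, s)) = foldr act w q"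
proof -
  have "Acts w (q, s) \<in> P \<times> NF \<and> fst (Acts w (q, s)) = foldr act w q" using assms(1)
  proof (induction w)
    case (Cons l w)
    obtain q' s' where w: "Acts w (q, s) = (q', s')" by (cases "Acts w (q, s)")
    obtain i where i: "[l] \<in> words_over (X i)" using Cons.prems by auto
    have q': "q' \<in> P" "s' \<in> NF" "q' = foldr act w q" using Cons w by auto
    then have "act l q' \<in> P" using act[of l i] i by simp
    with Acts_side[OF i q'(1,2)] cocycle_stab[OF i q'(1)] w q'
    show ?case by (simp add: root)
  qed (use assms in auto)
  then show "Acts w (q, s) \<in> P \<times> NF" "fst (Acts w (q, s)) = foldr act w q" by auto
qed

lemma Acts_trivial:
  assumes "w \<in> words_over (X i)" "c w = \<one>\<^bsub>G\<^esub>" "foldr act w q = q" "q \<in> P" "s \<in> NF"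
  shows "Acts w (q, s) = (q, s)"
proof -
  have "cocycle i w q = c (inv_word (rep i q)) \<otimes>\<^bsub>G\<^esub> (c w \<otimes>\<^bsub>G\<^esub> c (rep i q))"
    using assms(1,3,4) by (simp add: cocycle_def pres_class_mult words_over_side words_over_append)
  also have "\<dots> = \<one>\<^bsub>G\<^esub>"
    using assms pres_class_left_inverse[of "rep i q" XX]
    by (simp add: pres_class_mult pres_class_closed)
  finally show ?thesis using assms by (simp add: Acts_side mul_one root)
qed

text \<open>
  Each relator lies in one of the two alphabets, is trivial in \<open>G\<close> and fixes the points of \<open>P\<close>, so
  it has a trivial cocycle.  The action on words thus descends to \<open>G\<close>.
\<close>

lemma Acts_pres_eq:
  "pres_eq XX (R True \<union> R False) v w \<Longrightarrow> q \<in> P \<Longrightarrow> s \<in> NF \<Longrightarrow> Acts v (q, s) = Acts w (q, s)"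
proof (induction rule: pres_eq.induct)
  case (cancel u v l)
  obtain i where i: "fst l \<in> X i" using cancel by blast
  obtain q' s' where v: "Acts v (q, s) = (q', s')" "q' \<in> P" "s' \<in> NF"
    using Acts_closed(1)[OF cancel(2,4,5)] by (cases "Acts v (q, s)") auto
  have "Acts [l, inv_letter l] (q', s') = (q', s')"
  proof (rule Acts_trivial)
    show "c [l, inv_letter l] = \<one>\<^bsub>G\<^esub>"
      using pres_class_left_inverse[of "[inv_letter l]" XX] cancel(3) by simp
    show "foldr act [l, inv_letter l] q' = q'" using act_inverse[OF i v(2)] by simp
  qed (use i v in auto)
  then show ?case using v by simp
next
  case (relator u v r)
  obtain i where i: "r \<in> R i" using relator by blast
  obtain q' s' where v: "Acts v (q, s) = (q', s')" "q' \<in> P" "s' \<in> NF"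
    using Acts_closed(1)[OF relator(2,5,6)] by (cases "Acts v (q, s)") auto
  have "Acts r (q', s') = (q', s')"
  proof (rule Acts_trivial)
    show "c r = \<one>\<^bsub>G\<^esub>" by (rule relator_trivial[OF i])
    show "foldr act r q' = q'" using act_relator[OF i v(2)] .
  qed (use i v R in auto)
  then show ?case using v by simp
qed auto

lemma Acts_cong:
  "c v = c w \<Longrightarrow> v \<in> words_over XX \<Longrightarrow> w \<in> words_over XX \<Longrightarrow> q \<in> P \<Longrightarrow> s \<in> NF \<Longrightarrow>
    Acts v (q, s) = Acts w (q, s)"
  by (rule Acts_pres_eq) (simp_all add: pres_class_eq_iff)

lemma Acts_inverse:
  assumes "Acts w (q, s) = (q', s')" "w \<in> words_over XX" "q \<in> P" "s \<in> NF"
  shows "Acts (inv_word w) (q', s') = (q, s)"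
proof -
  have "Acts (inv_word w @ w) (q, s) = Acts [] (q, s)"
    by (rule Acts_pres_eq[OF pres_eq_left_inverse]) (use assms in auto)
  then show ?thesis using assms(1) by simp
qed

section \<open>Words leading to the base point\<close>

text \<open>
  Such a word leads to the base point and leaves the normal form, read in the coordinates of side
  \<open>i\<close>, unchanged.  It plays the role of a path in the tree.
\<close>

definition straight :: "bool \<Rightarrow> 'p \<Rightarrow> 'a word \<Rightarrow> bool" where
  "straight i q w \<longleftrightarrow> w \<in> words_over XX \<and> (\<forall>s\<in>NF. Acts w (q, untwist i q s) = (base, s))"

lemma straight_base: "straight False base []"
  by (simp add: straight_def untwist_def)

lemma straight_cross: "q \<in> T \<Longrightarrow> straight i q w \<Longrightarrow> straight j q w"
  by (simp add: straight_def untwist_def)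

lemma Acts_rep:
  assumes "q \<in> P" "s \<in> NF"
  shows "Acts (rep i q) (root i q, untwist i (root i q) s) = (q, untwist i q s)"
proof -
  have r: "root i q \<in> P" "root i (root i q) = root i q"
    using assms root_acts[OF rep[OF assms(1), of i] root[OF assms(1), of i]] rep_root[of q i]
    by (simp_all add: root)
  have "cocycle i (rep i q) (root i q) = \<one>\<^bsub>G\<^esub>"
    using assms(1) by (simp add: cocycle_def rep_root rep_of_root pres_class_left_inverse)
  then show ?thesis
    using assms rep[OF assms(1), of i] r by (simp add: Acts_side rep_root mul_one)
qed

lemma straight_root: "q \<in> P \<Longrightarrow> straight i q w \<Longrightarrow> straight i (root i q) (w @ rep i q)"
  by (simp add: straight_def words_over_append Acts_rep)

lemma straight_point:
  assumes "q \<in> P" "straight i (root i q) w"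
  shows "straight i q (w @ inv_word (rep i q))"
proof -
  have "Acts (inv_word (rep i q)) (q, untwist i q s) = (root i q, untwist i (root i q) s)"
    if "s \<in> NF" for s
    by (rule Acts_inverse[OF Acts_rep]) (use that assms(1) in \<open>auto simp: root\<close>)
  with assms show ?thesis by (simp add: straight_def words_over_append)
qed

text \<open>
  Going from the base point to the edge on one side and returning on the other side leaves the
  coordinate change of the edge as the only effect.
\<close>

lemma Acts_loop:
  assumes "straight True q a" "straight False q a'" "q \<in> P - T" "s \<in> NF"
  shows "Acts (a @ inv_word a') (base, s) = (base, lmul_letter (q, True) s)"
proof -
  have "Acts a' (q, s) = (base, s)" "a' \<in> words_over XX"
    using assms(2,4) by (auto simp: straight_def untwist_def)
  then have 1: "Acts (inv_word a') (base, s) = (q, s)"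
    using assms by (intro Acts_inverse) auto
  have "\<forall>s\<in>NF. Acts a (q, untwist True q s) = (base, s)"
    using assms(1) by (simp add: straight_def)
  from bspec[OF this twist_NF(1)[OF assms(4), of True q]]
  have "Acts a (q, s) = (base, twist True q s)"
    using assms(4) by simp
  then have "Acts a (q, s) = (base, lmul_letter (q, True) s)"
    using assms(3) by (simp add: twist_def)
  with 1 show ?thesis by simp
qed

lemma Acts_conjugate:
  assumes "straight i v g" "v \<in> P" "root i v = v" "w \<in> words_over (X i)" "foldr act w v = v" "s \<in> NF"
  shows "Acts (g @ w @ inv_word g) (base, s) = (base, mul i v (c w) s)"
proof -
  have g: "Acts g (v, untwist i v s) = (base, s)" "g \<in> words_over XX" if "s \<in> NF" for s
    using assms(1) that by (auto simp: straight_def)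
  have 1: "Acts (inv_word g) (base, s) = (v, untwist i v s)"
    by (rule Acts_inverse[OF g]) (use assms in auto)
  have w: "c w \<in> stab (i, v)" using assms by (auto simp: stab_def)
  have "cocycle i w v = c w"
    using rep_of_root[OF assms(2), of i] assms by (simp add: cocycle_def)
  then have "Acts w (v, untwist i v s) = (v, untwist i v (mul i v (c w) s))"
    using assms by (simp add: Acts_side)
  with 1 g(1)[of "mul i v (c w) s"] w assms show ?thesis by simp
qed

text \<open>
  The value of a normal form \<open>s\<close> maps \<open>(base, [])\<close> to \<open>(base, s)\<close>, by induction on \<open>s\<close>: on a normal
  form \<open>u # s\<close>, the loop for \<open>u\<close> multiplies \<open>s\<close> by \<open>u\<close>, and this product is \<open>u # s\<close> because no
  cancellation takes place.  So the value determines \<open>s\<close>.  The lists \<open>ks\<close> may generate proper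
  subgroups of the vertex groups, because uniqueness is inherited by fewer normal forms.
\<close>

theorem free_product:
  assumes js: "J \<subseteq> P - T"
      "\<And>q. q \<in> J \<Longrightarrow> \<exists>a a'. b q = a @ inv_word a' \<and> straight True q a \<and> straight False q a'"
    and vs: "distinct vs" "\<And>i v. (i, v) \<in> set vs \<Longrightarrow> v \<in> P \<and> root i v = v \<and> straight i v (g (i, v))"
      "\<And>i v k. (i, v) \<in> set vs \<Longrightarrow> k \<in> set (ks (i, v)) \<Longrightarrow> k \<in> words_over (X i) \<and> foldr act k v = v"
  defines "F \<equiv> generate G ((\<lambda>q. c (b q)) ` J)" and "K \<equiv> \<lambda>v. generate G (c ` set (ks v))"
  shows "inj_on (\<lambda>q. c (b q)) J" "free_basis G ((\<lambda>q. c (b q)) ` J) F"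
    "internal_free_product G (F # map (\<lambda>v. conjugate G (c (g v)) (K v)) vs)
      (generate G (\<Union> (set (F # map (\<lambda>v. conjugate G (c (g v)) (K v)) vs))))"
proof -
  have b: "b q \<in> words_over XX" if "q \<in> J" for q
    using js(2)[OF that] by (auto simp: straight_def words_over_append)
  have g: "g v \<in> words_over XX" if "v \<in> set vs" for v
    using vs(2)[of "fst v" "snd v"] that by (simp add: straight_def)
  have K: "subgroup (K v) G" "K v \<subseteq> stab v" if "v \<in> set vs" for v
  proof -
    have *: "c ` set (ks v) \<subseteq> stab v"
      using vs(3)[of "fst v" "snd v"] that by (auto simp: stab_def)
    have sub: "subgroup (stab v) G"
      using subgroup_stab[of "snd v" "fst v"] vs(2)[of "fst v" "snd v"] that by simp
    show "subgroup (K v) G" unfolding K_def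
      by (rule generate_is_subgroup) (use * subgroup.subset[OF sub] in blast)
    show "K v \<subseteq> stab v" unfolding K_def
      using generate_subgroup_incl[OF * sub] .
  qed
  have NF: "normal_forms G J (set vs) K \<subseteq> NF"
    using K(2) vs(2) by (fastforce simp: NF_def normal_forms_def)
  let ?val = "normal_form_val (\<lambda>q. c (b q)) (\<lambda>v. c (g v))"
  have word: "\<exists>w\<in>words_over XX. c w = ?val s \<and> Acts w (base, []) = (base, s)"
    if "s \<in> normal_forms G J (set vs) K" for s
    using that
  proof (induction s)
    case Nil
    show ?case by (intro bexI[of _ "[]"]) (auto simp: normal_form_val_def pres_class_Nil)
  next
    case (Cons u s)
    then have s: "s \<in> normal_forms G J (set vs) K" "u # s \<in> NF"
      using NF normal_form_Cons[of u s G J "set vs" K] by blast+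
    then have s: "s \<in> normal_forms G J (set vs) K" "u # s \<in> NF" "s \<in> NF"
      using NF by blast+
    obtain w where w: "w \<in> words_over XX" "c w = ?val s" "Acts w (base, []) = (base, s)"
      using Cons.IH[OF s(1)] by blast
    have "\<exists>x\<in>words_over XX. c x = syllable_val (\<lambda>q. c (b q)) (\<lambda>v. c (g v)) u \<and>
        Acts x (base, s) = (base, u # s)"
    proof (cases u)
      case (Inl l)
      obtain q \<sigma> where l: "l = (q, \<sigma>)" by (cases l)
      have q: "q \<in> J" using Cons.prems Inl l by (auto simp: normal_form_Cons)
      have 1: "Acts (b q) (base, s) = (base, lmul_letter (q, True) s)" if "s \<in> NF" for s
        using js(2)[OF q] Acts_loop[OF _ _ _ that] q js(1) by auto
      have eq: "lmul_letter (q, \<sigma>) s = u # s"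
        using s(2) Inl l by (auto simp: NF_def intro: lmul_letter_Cons)
      show ?thesis
      proof (cases \<sigma>)
        case True
        then show ?thesis using 1[OF s(3)] eq b[OF q] Inl l
          by (intro bexI[of _ "b q"]) (auto simp: syllable_val_def)
      next
        case False
        have "Acts (b q) (base, u # s) = (base, s)"
          using 1[OF s(2)] lmul_letter_cancel[of s G UNIV "UNIV \<times> P" stab "(q, False)"] s(3) eq False
          by (simp add: NF_def inv_letter_def)
        from Acts_inverse[OF this b[OF q] base s(2)]
        show ?thesis using Inl l False b[OF q]
          by (intro bexI[of _ "inv_word (b q)"]) (auto simp: syllable_val_def pres_class_inverse)
      qed
    next
      case (Inr x)
      obtain i v k where x: "x = ((i, v), k)" by (metis surj_pair)
      have v: "(i, v) \<in> set vs" "k \<in> K (i, v)"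
        using Cons.prems Inr x by (auto simp: normal_form_Cons)
      obtain y where y: "y \<in> words_over (X i)" "foldr act y v = v" "k = c y"
        using K(2)[OF v(1)] v(2) by (auto simp: stab_def)
      have "mul i v k s = u # s"
        using s(2) Inr x by (auto simp: NF_def intro: lmul_factor_Cons)
      then have "Acts (g (i, v) @ y @ inv_word (g (i, v))) (base, s) = (base, u # s)"
        using Acts_conjugate[OF _ _ _ y(1,2) s(3), of "g (i, v)"] vs(2)[OF v(1)] y(3) by simp
      moreover have "c (g (i, v) @ y @ inv_word (g (i, v))) = c (g (i, v)) \<otimes>\<^bsub>G\<^esub> c y \<otimes>\<^bsub>G\<^esub> inv\<^bsub>G\<^esub> c (g (i, v))"
        using g[OF v(1)] words_over_side[OF y(1)]
        by (simp add: pres_class_mult pres_class_inverse[symmetric] words_over_append)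
      ultimately show ?thesis
        using g[OF v(1)] words_over_side[OF y(1)] Inr x y(3)
        by (intro bexI[of _ "g (i, v) @ y @ inv_word (g (i, v))"])
          (auto simp: syllable_val_def words_over_append)
    qed
    then obtain x where "x \<in> words_over XX" "c x = syllable_val (\<lambda>q. c (b q)) (\<lambda>v. c (g v)) u"
      "Acts x (base, s) = (base, u # s)" by blast
    then show ?case
      using w by (intro bexI[of _ "x @ w"])
        (auto simp: normal_form_val_def pres_class_mult[symmetric] words_over_append)
  qed
  have inj: "inj_on ?val (normal_forms G J (set vs) K)"
  proof (rule inj_onI)
    fix s s' assume s: "s \<in> normal_forms G J (set vs) K" "s' \<in> normal_forms G J (set vs) K"
      and eq: "?val s = ?val s'"
    obtain w where w: "w \<in> words_over XX" "c w = ?val s" "Acts w (base, []) = (base, s)"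
      using word[OF s(1)] by blast
    obtain w' where w': "w' \<in> words_over XX" "c w' = ?val s'" "Acts w' (base, []) = (base, s')"
      using word[OF s(2)] by blast
    have "Acts w (base, []) = Acts w' (base, [])"
      using w w' eq base by (intro Acts_cong) (auto simp: NF_def)
    with w w' show "s = s'" by simp
  qed
  have bc: "(\<lambda>q. c (b q)) ` J \<subseteq> carrier G" and gc: "(\<lambda>v. c (g v)) ` set vs \<subseteq> carrier G"
    using b g by (auto intro: pres_class_closed)
  show "inj_on (\<lambda>q. c (b q)) J"
    by (rule inj_on_basis[OF bc gc K(1) vs(1) inj])
  show "free_basis G ((\<lambda>q. c (b q)) ` J) F"
    unfolding F_def by (rule free_basis_letters[OF bc gc K(1) vs(1) inj])
  show "internal_free_product G (F # map (\<lambda>v. conjugate G (c (g v)) (K v)) vs)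
      (generate G (\<Union> (set (F # map (\<lambda>v. conjugate G (c (g v)) (K v)) vs))))"
    unfolding F_def by (rule internal_free_product_factors[OF bc gc K(1) vs(1) inj])
qed

end

section \<open>Spanning trees\<close>

text \<open>
  An entry describes a vertex of a tree: the vertex, a word leading from it to the base point, and
  the edge that joins the vertex to a vertex found earlier.
\<close>

type_synonym ('a, 'p) vertex_entry = "(bool \<times> 'p) \<times> 'a word \<times> 'p"

abbreviation side :: "('a, 'p) vertex_entry \<Rightarrow> bool" where "side e \<equiv> fst (fst e)"
abbreviation vertex :: "('a, 'p) vertex_entry \<Rightarrow> 'p" where "vertex e \<equiv> snd (fst e)"
abbreviation word_of :: "('a, 'p) vertex_entry \<Rightarrow> 'a word" where "word_of e \<equiv> fst (snd e)"
abbreviation edge_of :: "('a, 'p) vertex_entry \<Rightarrow> 'p" where "edge_of e \<equiv> snd (snd e)"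

text \<open>
  Words act from the left, so their last letter acts first and the points visited by a word are
  the images of the base point under its suffixes.
\<close>

abbreviation suffix_of :: "'a list list \<Rightarrow> 'a list \<Rightarrow> bool" where
  "suffix_of hs u \<equiv> u = [] \<or> (\<exists>h\<in>set hs. \<exists>v. h = v @ u)"

lemma finite_suffixes: "finite {u. suffix_of hs u}"
proof (rule finite_subset)
  have "u \<in> (\<lambda>n. drop n h) ` {..length h}" if "h = v @ u" for h u v :: "'a list"
    using that by (intro image_eqI[of _ _ "length v"]) auto
  then show "{u. suffix_of hs u} \<subseteq> insert [] (\<Union>h\<in>set hs. (\<lambda>n. drop n h) ` {..length h})"
    by blast
qed simp

text \<open>
  Entries are added at the front.  The word of a new vertex follows the representatives from the
  new vertex to the connecting edge and from there to the vertex \<open>d\<close> found before.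
\<close>

fun reached ::
    "(bool \<Rightarrow> 'p \<Rightarrow> 'p) \<Rightarrow> (bool \<Rightarrow> 'p \<Rightarrow> 'a word) \<Rightarrow> 'p \<Rightarrow> ('a, 'p) vertex_entry list \<Rightarrow> bool" where
  "reached root rep base [] \<longleftrightarrow> True"
| "reached root rep base (e # es) \<longleftrightarrow> reached root rep base es \<and>
     (fst e = (False, root False base) \<and> word_of e = rep False base \<or>
      (\<exists>d\<in>set es. vertex d = root (side d) (edge_of e) \<and>
         vertex e = root (side e) (edge_of e) \<and>
         word_of e = word_of d @ inv_word (rep (side d) (edge_of e)) @
           rep (side e) (edge_of e)))"

context covering
begin

lemma root_root: "q \<in> P \<Longrightarrow> root i (root i q) = root i q"
  using root_acts[OF rep[of q i] root[of q i]] rep_root[of q i] by simp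

text \<open>
  The connecting edges belong to \<open>T\<close> and are crossed for free, so every word in the list is straight.
\<close>

lemma straight_reached:
  assumes "reached root rep base es" "edge_of ` set es \<subseteq> P \<inter> T" "((i, v), g, q) \<in> set es"
  shows "straight i v g \<and> v \<in> P \<and> root i v = v"
  using assms
proof (induction es arbitrary: i v g q)
  case (Cons e es)
  note IH = Cons.IH[OF _ _ ]
  show ?case
  proof (cases "((i, v), g, q) \<in> set es")
    case False
    then have e: "e = ((i, v), g, q)" using Cons.prems by simp
    then consider "i = False" "v = root False base" "g = rep False base"
      | j w h q' where "((j, w), h, q') \<in> set es" "w = root j q" "v = root i q"
        "g = h @ inv_word (rep j q) @ rep i q"
      using Cons.prems(1) by fastforce
    then show ?thesis
    proof cases
      case 1
      then show ?thesis
        using straight_root[OF base straight_base] base by (simp add: root root_root)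
    next
      case 2
      have q: "q \<in> P" "q \<in> T" using Cons.prems(2) e by auto
      have "straight j (root j q) h" using Cons 2 by auto
      from straight_root[OF q(1) straight_cross[OF q(2) straight_point[OF q(1) this]], of i]
      show ?thesis using 2 q by (simp add: root root_root)
    qed
  qed (use Cons in auto)
qed simp

end

definition kurosh_generators ::
    "('a, 'p) vertex_entry list \<Rightarrow> (bool \<times> 'p \<Rightarrow> 'a word list) \<Rightarrow> ('p \<times> 'a word) list \<Rightarrow> 'a word list" where
  "kurosh_generators es ks bs = map snd bs @
     concat (map (\<lambda>e. map (\<lambda>k. word_of e @ k @ inv_word (word_of e)) (ks (fst e))) es)"

lemma set_kurosh_generators:
  "x \<in> set (kurosh_generators es ks bs) \<longleftrightarrow> x \<in> snd ` set bs \<or>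
     (\<exists>e\<in>set es. \<exists>k\<in>set (ks (fst e)). x = word_of e @ k @ inv_word (word_of e))"
  by (auto simp: kurosh_generators_def)

lemma (in group) l_coset_eq_self: "subgroup H G \<Longrightarrow> x \<in> carrier G \<Longrightarrow> x <# H = H \<Longrightarrow> x \<in> H"
  using subgroup.one_closed[of H G] by (force simp: l_coset_def)

text \<open>
  A covering that resembles the cosets of \<open>H\<close> around the points \<open>E\<close> visited by the generators of
  \<open>H\<close>: the coset \<open>\<nu> q\<close> belongs to the point \<open>q\<close>, and \<open>\<nu>\<close> respects representatives and
  vertex groups of the orbits that meet \<open>E\<close>.  The tree, and with it \<open>T\<close>, is still to be chosen.
\<close>

locale kurosh_model = covering X R P act root rep "{}" base
  for X :: "bool \<Rightarrow> 'a set" and R :: "bool \<Rightarrow> 'a word set" and P :: "'p set" and act root rep base +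
  fixes hs :: "'a word list" and \<nu> :: "'p \<Rightarrow> 'a word set set" and E :: "'p set"
  assumes hs: "set hs \<subseteq> words_over XX"
    and E: "E = {foldr act u base | u. suffix_of hs u}"
    and nu_base: "\<nu> base = generate G (c ` set hs)"
    and nu_closed: "q \<in> P \<Longrightarrow> \<nu> q \<subseteq> carrier G"
    and nu_rep: "q \<in> E \<Longrightarrow> \<nu> q = c (rep i q) <#\<^bsub>G\<^esub> \<nu> (root i q)"
    and nu_stab: "q \<in> E \<Longrightarrow> w \<in> words_over (X i) \<Longrightarrow> foldr act w (root i q) = root i q \<Longrightarrow>
        c w <#\<^bsub>G\<^esub> \<nu> (root i q) = \<nu> (root i q)"
    and base_loop: "h \<in> set hs \<Longrightarrow> foldr act h base = base"
    and finite_side: "finite (c ` words_over (X i))"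
begin

abbreviation "H \<equiv> generate G (c ` set hs)"

lemma c_hs: "c ` set hs \<subseteq> carrier G"
  using hs by (auto intro: pres_class_closed)

lemma suffix_words_over: "suffix_of hs u \<Longrightarrow> u \<in> words_over XX"
  using hs by (force simp: words_over_append)

lemma E_P: "E \<subseteq> P"
  using suffix_words_over acts base by (auto simp: E)

lemma base_E: "base \<in> E"
  unfolding E by (intro CollectI exI[of _ "[]"]) simp

lemma finite_E: "finite E"
  using finite_suffixes[of hs] by (simp only: E setcompr_eq_image finite_imageI)

text \<open>The two ways from the base point to \<open>q\<close>, through either end of \<open>q\<close>, agree in \<open>G\<close>.\<close>

definition tree_edge :: "('a, 'p) vertex_entry set \<Rightarrow> 'p \<Rightarrow> bool" where
  "tree_edge S q \<longleftrightarrow> (\<exists>g g' r r'. ((True, root True q), g, r) \<in> S \<and> ((False, root False q), g', r') \<in> S \<and>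
     c (g @ inv_word (rep True q)) = c (g' @ inv_word (rep False q)))"

text \<open>
  The entry with edge \<open>base\<close> is the start of the tree.  As its edge counts as a tree edge,
  the other end of \<open>base\<close> has to be present from the beginning.
\<close>

definition tree :: "('a, 'p) vertex_entry list \<Rightarrow> bool" where
  "tree es \<longleftrightarrow> reached root rep base es \<and> distinct (map fst es) \<and>
     (\<forall>((i, v), g, q)\<in>set es. q \<in> E \<and> v = root i q \<and> c g <#\<^bsub>G\<^esub> \<nu> v = H \<and> g \<in> words_over XX \<and>
        tree_edge (set es) q) \<and>
     ((False, root False base), rep False base, base) \<in> set es"

lemma treeD:
  assumes "tree es" "((i, v), g, q) \<in> set es"
  shows "q \<in> E" "v = root i q" "c g <#\<^bsub>G\<^esub> \<nu> v = H" "g \<in> words_over XX" "tree_edge (set es) q"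
  using assms unfolding tree_def by fast+

lemma tree_edge_mono: "tree_edge S q \<Longrightarrow> S \<subseteq> S' \<Longrightarrow> tree_edge S' q"
  unfolding tree_edge_def by blast

text \<open>
  Extending a word across the edge \<open>q\<close> keeps its coset, since both ends of \<open>q\<close> lead to the
  coset of \<open>q\<close>.
\<close>

lemma tree_step:
  assumes q: "q \<in> E" and g: "c g <#\<^bsub>G\<^esub> \<nu> (root j q) = H" "g \<in> words_over XX"
  shows "c (g @ inv_word (rep j q) @ rep i q) <#\<^bsub>G\<^esub> \<nu> (root i q) = H"
    "c ((g @ inv_word (rep j q) @ rep i q) @ inv_word (rep i q)) = c (g @ inv_word (rep j q))"
    "g @ inv_word (rep j q) @ rep i q \<in> words_over XX"
proof -
  have qP: "q \<in> P" using q E_P by blast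
  have closed: "\<nu> q \<subseteq> carrier G" "\<nu> (root i q) \<subseteq> carrier G" "\<nu> (root j q) \<subseteq> carrier G"
    using qP by (auto intro!: nu_closed root)
  have r: "rep i q \<in> words_over XX" "rep j q \<in> words_over XX" using qP by simp_all
  show "g @ inv_word (rep j q) @ rep i q \<in> words_over XX"
    using g(2) r by (simp add: words_over_append)
  show "c ((g @ inv_word (rep j q) @ rep i q) @ inv_word (rep i q)) = c (g @ inv_word (rep j q))"
    using pres_class_cancel_middle(1)[of "g @ inv_word (rep j q)" XX "rep i q" "[]"] g(2) r
    by (simp add: words_over_append)
  have "c (g @ inv_word (rep j q) @ rep i q) <#\<^bsub>G\<^esub> \<nu> (root i q)
      = c (g @ inv_word (rep j q)) <#\<^bsub>G\<^esub> (c (rep i q) <#\<^bsub>G\<^esub> \<nu> (root i q))"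
    using closed g(2) r by (simp add: lcos_m_assoc pres_class_mult pres_class_closed words_over_append)
  also have "c (rep i q) <#\<^bsub>G\<^esub> \<nu> (root i q) = c (rep j q) <#\<^bsub>G\<^esub> \<nu> (root j q)"
    using nu_rep[OF q, of i] nu_rep[OF q, of j] by simp
  also have "c (g @ inv_word (rep j q)) <#\<^bsub>G\<^esub> (c (rep j q) <#\<^bsub>G\<^esub> \<nu> (root j q))
      = c (g @ inv_word (rep j q) @ rep j q) <#\<^bsub>G\<^esub> \<nu> (root j q)"
    using closed g(2) r by (simp add: lcos_m_assoc pres_class_mult pres_class_closed words_over_append)
  also have "c (g @ inv_word (rep j q) @ rep j q) = c g"
    using pres_class_cancel_middle(2)[of g XX "rep j q" "[]"] g(2) r by simp
  finally show "c (g @ inv_word (rep j q) @ rep i q) <#\<^bsub>G\<^esub> \<nu> (root i q) = H"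
    using g(1) by simp
qed

lemma tree_start: "\<exists>es. tree es"
proof -
  let ?g = "rep False base" and ?h = "rep False base @ inv_word (rep False base) @ rep True base"
  let ?es = "[((True, root True base), ?h, base), ((False, root False base), ?g, base)]"
  have g: "c ?g <#\<^bsub>G\<^esub> \<nu> (root False base) = H"
    using nu_rep[OF base_E, of False] nu_base by simp
  have w: "?g \<in> words_over XX" using base by simp
  note step = tree_step[OF base_E g w, of True]
  have "tree ?es"
    unfolding tree_def tree_edge_def using step(1,3) base_E g w
    by (auto intro!: step(2)[simplified])
  then show ?thesis ..
qed

lemma tree_extend:
  assumes es: "tree es" and q: "q \<in> E" and d: "((j, root j q), g, q') \<in> set es"
    and new: "(i, root i q) \<notin> fst ` set es"
  shows "tree (((i, root i q), g @ inv_word (rep j q) @ rep i q, q) # es)"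
proof -
  let ?g = "g @ inv_word (rep j q) @ rep i q"
  have g: "c g <#\<^bsub>G\<^esub> \<nu> (root j q) = H" "g \<in> words_over XX"
    using treeD[OF es d] by simp_all
  note step = tree_step[OF q g, of i]
  have ij: "i = (\<not> j)" using new d by force
  have "reached root rep base (((i, root i q), ?g, q) # es)"
    using es d by (auto simp: tree_def intro!: bexI[OF _ d])
  moreover have "c ((if i then ?g else g) @ inv_word (rep True q)) =
      c ((if i then g else ?g) @ inv_word (rep False q))"
    using step(2) ij by (cases i) simp_all
  then have edge: "tree_edge (set (((i, root i q), ?g, q) # es)) q"
  proof (cases i)
    case True
    then show ?thesis
      unfolding tree_edge_def
      using ij d step(2) by (intro exI[of _ ?g] exI[of _ g] exI[of _ q] exI[of _ q']) simp
  next
    case False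
    then show ?thesis
      unfolding tree_edge_def
      using ij d step(2) by (intro exI[of _ g] exI[of _ ?g] exI[of _ q'] exI[of _ q]) simp
  qed
  moreover have "distinct (map fst (((i, root i q), ?g, q) # es))"
    using es new by (simp add: tree_def)
  moreover have "r \<in> E \<and> v = root m r \<and> c h <#\<^bsub>G\<^esub> \<nu> v = H \<and> h \<in> words_over XX \<and>
      tree_edge (set (((i, root i q), ?g, q) # es)) r"
    if e: "((m, v), h, r) \<in> set (((i, root i q), ?g, q) # es)" for m v h r
  proof (cases "((m, v), h, r) \<in> set es")
    case True
    then show ?thesis using treeD[OF es True] tree_edge_mono[OF _ set_subset_Cons] by blast
  next
    case False
    then show ?thesis using e q step(1,3) edge by simp
  qed
  moreover have "((False, root False base), rep False base, base) \<in> set (((i, root i q), ?g, q) # es)"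
    using es by (simp add: tree_def)
  ultimately show ?thesis unfolding tree_def by fast
qed

text \<open>
  A longest tree cannot be extended, so every edge in \<open>E\<close> with one end in the tree has both ends in
  it.  All points of \<open>E\<close> are connected to the base point by the words that visit them.
\<close>

lemma spanning_tree:
  obtains es where "tree es" "\<And>i q. q \<in> E \<Longrightarrow> (i, root i q) \<in> fst ` set es"
proof -
  define V where "V = (\<Union>i. (\<lambda>q. (i, root i q)) ` E)"
  have "finite V" using finite_E by (simp add: V_def)
  have bound: "length es \<le> card V" if "tree es" for es
  proof -
    have "fst ` set es \<subseteq> V" using treeD(1,2)[OF that] by (force simp: V_def)
    then have "card (fst ` set es) \<le> card V" using \<open>finite V\<close> by (rule card_mono[rotated])
    then show ?thesis using that distinct_card[of "map fst es"] by (simp add: tree_def)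
  qed
  obtain es0 where "tree es0" using tree_start by blast
  then obtain es where es: "tree es" and max: "\<And>es'. tree es' \<Longrightarrow> length es' \<le> length es"
    using ex_has_greatest_nat[of tree es0 length "Suc (card V)"] bound by (metis le_imp_less_Suc)
  have other: "(i, root i q) \<in> fst ` set es" if q: "q \<in> E" and jq: "(j, root j q) \<in> fst ` set es" for i j q
  proof (rule ccontr)
    assume "(i, root i q) \<notin> fst ` set es"
    moreover obtain g q' where "((j, root j q), g, q') \<in> set es" using jq by force
    ultimately show False using tree_extend[OF es q] max by fastforce
  qed
  have all: "(i, root i (foldr act u base)) \<in> fst ` set es"
    if "suffix_of hs u" for u i
    using that
  proof (induction u arbitrary: i)
    case Nil
    have "(False, root False base) \<in> fst ` set es" using es unfolding tree_def by force
    then show ?case using other[OF base_E] by simp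
  next
    case (Cons l u)
    then obtain h v where h: "h \<in> set hs" "h = (v @ [l]) @ u" by auto
    then have u: "suffix_of hs u" by blast
    obtain j where j: "fst l \<in> X j" using suffix_words_over[OF Cons.prems] by auto
    have "root j (act l (foldr act u base)) = root j (foldr act u base)"
      using j base suffix_words_over[OF u] by (simp add: root_act acts)
    then have "(j, root j (foldr act (l # u) base)) \<in> fst ` set es"
      using Cons.IH[OF u] by simp
    moreover have "foldr act (l # u) base \<in> E" unfolding E using Cons.prems by blast
    ultimately show ?case by (rule other[rotated])
  qed
  show thesis
  proof (rule that[OF es])
    fix i q assume "q \<in> E"
    then obtain u where "q = foldr act u base" "suffix_of hs u"
      unfolding E by blast
    then show "(i, root i q) \<in> fst ` set es" using all by simp
  qed
qed

lemma mem_H: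
  assumes "w \<in> words_over XX" "c w <#\<^bsub>G\<^esub> H = H"
  shows "c w \<in> H"
  using l_coset_eq_self[OF generate_is_subgroup[OF c_hs] pres_class_closed[OF assms(1)] assms(2)] .

lemma coset_back:
  assumes "c g <#\<^bsub>G\<^esub> \<nu> v = H" "g \<in> words_over XX" "v \<in> P"
  shows "c (inv_word g) <#\<^bsub>G\<^esub> H = \<nu> v"
proof -
  have "c (inv_word g) <#\<^bsub>G\<^esub> (c g <#\<^bsub>G\<^esub> \<nu> v) = c (inv_word g @ g) <#\<^bsub>G\<^esub> \<nu> v"
    using assms(2,3) nu_closed[of v] by (simp add: lcos_m_assoc pres_class_mult pres_class_closed)
  then show ?thesis
    using assms nu_closed[of v] by (simp add: pres_class_left_inverse lcos_mult_one)
qed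

lemma stab_conjugate_mem_H:
  assumes "q \<in> E" "c g <#\<^bsub>G\<^esub> \<nu> (root i q) = H" "g \<in> words_over XX"
    "k \<in> words_over (X i)" "foldr act k (root i q) = root i q"
  shows "c (g @ k @ inv_word g) \<in> H"
proof (rule mem_H)
  have k: "k \<in> words_over XX" using assms words_over_side by blast
  show "g @ k @ inv_word g \<in> words_over XX" using assms k by (simp add: words_over_append)
  have v: "root i q \<in> P" using assms E_P root by blast
  have Hc: "H \<subseteq> carrier G" using generate_incl[OF c_hs] .
  have "c (g @ k @ inv_word g) <#\<^bsub>G\<^esub> H = c g <#\<^bsub>G\<^esub> (c k <#\<^bsub>G\<^esub> (c (inv_word g) <#\<^bsub>G\<^esub> H))"
    using assms k Hc by (simp add: lcos_m_assoc pres_class_mult pres_class_closed words_over_append)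
  also have "\<dots> = H"
    using coset_back[OF assms(2,3) v] nu_stab[OF assms(1,4,5)] assms(2) by simp
  finally show "c (g @ k @ inv_word g) <#\<^bsub>G\<^esub> H = H" .
qed

lemma loop_mem_H:
  assumes "q \<in> E" "c g <#\<^bsub>G\<^esub> \<nu> (root i q) = H" "g \<in> words_over XX"
    "c g' <#\<^bsub>G\<^esub> \<nu> (root j q) = H" "g' \<in> words_over XX"
  shows "c ((g @ inv_word (rep i q)) @ inv_word (g' @ inv_word (rep j q))) \<in> H"
proof (rule mem_H)
  have q: "q \<in> P" using assms E_P by blast
  show "(g @ inv_word (rep i q)) @ inv_word (g' @ inv_word (rep j q)) \<in> words_over XX"
    using assms q by (simp add: words_over_append)
  have Hc: "H \<subseteq> carrier G" using generate_incl[OF c_hs] .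
  note step = tree_step[OF assms(1,2,3), of j]
  have "c ((g @ inv_word (rep i q)) @ inv_word (g' @ inv_word (rep j q))) <#\<^bsub>G\<^esub> H =
      c (g @ inv_word (rep i q) @ rep j q) <#\<^bsub>G\<^esub> (c (inv_word g') <#\<^bsub>G\<^esub> H)"
    using assms q Hc by (simp add: lcos_m_assoc pres_class_mult pres_class_closed words_over_append)
  also have "\<dots> = H"
    using coset_back[OF assms(4,5)] step(1) q root by simp
  finally show "c ((g @ inv_word (rep i q)) @ inv_word (g' @ inv_word (rep j q))) <#\<^bsub>G\<^esub> H = H" .
qed

text \<open>
  The lists \<open>ks\<close> enumerate the vertex groups, and \<open>bs\<close> has one element for each edge in \<open>E\<close> outside
  of the tree.  With \<open>\<gamma> i q\<close> denoting the word from \<open>q\<close> to the base point through the end of \<open>q\<close> on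
  side \<open>i\<close>, a change of sides at \<open>q\<close> is trivial or a generator from \<open>bs\<close>, and a letter of side \<open>i\<close>
  leading from \<open>q\<close> to \<open>q'\<close> contributes \<open>\<gamma> i q' l (\<gamma> i q)\<^sup>-\<^sup>1\<close>, an element of a conjugated vertex
  group.  The product of these contributions along a generator of \<open>H\<close> telescopes to this generator.
\<close>

theorem kurosh_data_exists:
  obtains es ks bs where
    "reached root rep base es" "distinct (map fst es)" "edge_of ` set es \<subseteq> P"
    "\<And>e k. e \<in> set es \<Longrightarrow> k \<in> set (ks (fst e)) \<Longrightarrow>
       k \<in> words_over (X (side e)) \<and> foldr act k (vertex e) = vertex e"
    "distinct (map fst bs)"
    "\<And>q b. (q, b) \<in> set bs \<Longrightarrow> q \<in> P \<and> q \<notin> edge_of ` set es \<and>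
       (\<exists>d\<in>set es. \<exists>d'\<in>set es. fst d = (True, root True q) \<and> fst d' = (False, root False q) \<and>
          b = (word_of d @ inv_word (rep True q)) @ inv_word (word_of d' @ inv_word (rep False q)))"
    "set (kurosh_generators es ks bs) \<subseteq> words_over XX"
    "generate G (c ` set (kurosh_generators es ks bs)) = H"
proof -
  obtain es where es: "tree es" and span: "\<And>i q. q \<in> E \<Longrightarrow> (i, root i q) \<in> fst ` set es"
    using spanning_tree by blast
  let ?T = "edge_of ` set es"
  have dist: "distinct (map fst es)" using es by (simp add: tree_def)
  define word where "word v = fst (the (map_of es v))" for v
  have word: "word (fst e) = word_of e" if "e \<in> set es" for e
    using that map_of_is_SomeI[OF dist, of "fst e" "snd e"] by (simp add: word_def)
  define \<gamma> where "\<gamma> i q = word (i, root i q) @ inv_word (rep i q)" for i q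
  have entry: "\<exists>e\<in>set es. fst e = (i, root i q) \<and> word_of e = word (i, root i q)" if "q \<in> E" for i q
    using span[OF that, of i] word by force
  have word_H: "c (word (i, root i q)) <#\<^bsub>G\<^esub> \<nu> (root i q) = H" "word (i, root i q) \<in> words_over XX"
    if "q \<in> E" for i q
    using entry[OF that, of i] treeD(3,4)[OF es] by (metis prod.collapse)+
  have \<gamma>: "\<gamma> i q \<in> words_over XX" if "q \<in> E" for i q
    using word_H(2)[OF that] that E_P by (auto simp: \<gamma>_def words_over_append)
  define ks where "ks v = (SOME ws. set ws \<subseteq> {w \<in> words_over (X (fst v)). foldr act w (snd v) = snd v} \<and>
      c ` set ws = stab v)" for v
  have ks: "set (ks v) \<subseteq> {w \<in> words_over (X (fst v)). foldr act w (snd v) = snd v}"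
    "c ` set (ks v) = stab v" for v
  proof -
    have "finite (stab v)"
      by (rule finite_subset[OF _ finite_side[of "fst v"]]) (auto simp: stab_def)
    then obtain W where W: "finite W" "W \<subseteq> {w \<in> words_over (X (fst v)). foldr act w (snd v) = snd v}"
      "stab v = c ` W"
      using finite_subset_image[of "stab v" c "{w \<in> words_over (X (fst v)). foldr act w (snd v) = snd v}"]
      by (auto simp: stab_def)
    then obtain ws where "set ws = W" using finite_list by blast
    then have "\<exists>ws. set ws \<subseteq> {w \<in> words_over (X (fst v)). foldr act w (snd v) = snd v} \<and>
        c ` set ws = stab v" using W by blast
    from someI_ex[OF this]
    show "set (ks v) \<subseteq> {w \<in> words_over (X (fst v)). foldr act w (snd v) = snd v}"
      "c ` set (ks v) = stab v" unfolding ks_def by blast+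
  qed
  obtain qs where qs: "set qs = E - ?T" "distinct qs"
    using finite_distinct_list[of "E - ?T"] finite_E by auto
  define bs where "bs = map (\<lambda>q. (q, \<gamma> True q @ inv_word (\<gamma> False q))) qs"
  let ?gens = "kurosh_generators es ks bs"
  have gens_H: "x \<in> words_over XX \<and> c x \<in> H" if x: "x \<in> set ?gens" for x
  proof -
    consider q where "q \<in> E" "x = \<gamma> True q @ inv_word (\<gamma> False q)"
      | e k where "e \<in> set es" "k \<in> set (ks (fst e))" "x = word_of e @ k @ inv_word (word_of e)"
      using x qs(1) by (auto simp: kurosh_generators_def bs_def)
    then show ?thesis
    proof cases
      case 1
      then show ?thesis
        using loop_mem_H[OF 1(1) word_H[OF 1(1), of True] word_H[OF 1(1), of False]]
          \<gamma>[OF 1(1), of True] \<gamma>[OF 1(1), of False]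
        by (simp add: \<gamma>_def words_over_append)
    next
      case 2
      obtain i v g q where e: "e = ((i, v), g, q)" by (metis surj_pair)
      then have q: "q \<in> E" "v = root i q" "c g <#\<^bsub>G\<^esub> \<nu> (root i q) = H" "g \<in> words_over XX"
        using treeD[OF es, of i v g q] 2(1) by auto
      have k: "k \<in> words_over (X i)" "foldr act k (root i q) = root i q"
        using ks(1)[of "fst e"] 2(2) e q(2) by auto
      show ?thesis
        using stab_conjugate_mem_H[OF q(1,3,4) k] 2(3) e q(4) words_over_side[OF k(1)]
        by (simp add: words_over_append)
    qed
  qed
  define M where "M = generate G (c ` set ?gens)"
  have gens_closed: "c ` set ?gens \<subseteq> carrier G" using gens_H by (auto intro: pres_class_closed)
  have M: "subgroup M G" unfolding M_def by (rule generate_is_subgroup[OF gens_closed])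
  have "M \<subseteq> H"
    unfolding M_def using gens_H by (intro generate_subgroup_incl generate_is_subgroup c_hs) auto
  have gen_M: "c x \<in> M" if "x \<in> set ?gens" for x
    unfolding M_def using that by (auto intro: generate.incl)
  have cross: "c (\<gamma> i q @ inv_word (\<gamma> j q)) \<in> M" if q: "q \<in> E" for i j q
  proof -
    have one: "\<one>\<^bsub>G\<^esub> \<in> M" using M subgroup.one_closed by blast
    have tf: "c (\<gamma> True q @ inv_word (\<gamma> False q)) \<in> M"
    proof (cases "q \<in> ?T")
      case True
      then have "tree_edge (set es) q" using treeD(5)[OF es] by force
      then obtain g g' r r' where "((True, root True q), g, r) \<in> set es" "((False, root False q), g', r') \<in> set es"
        and eq: "c (g @ inv_word (rep True q)) = c (g' @ inv_word (rep False q))"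
        unfolding tree_edge_def by blast
      from word[OF this(1)] word[OF this(2)] have "c (\<gamma> True q) = c (\<gamma> False q)"
        using eq by (simp add: \<gamma>_def)
      then show ?thesis
        using \<gamma>[OF q] one by (simp add: pres_class_mult[symmetric] pres_class_inverse pres_class_closed)
    next
      case False
      then have "\<gamma> True q @ inv_word (\<gamma> False q) \<in> set ?gens"
        using q qs(1) by (auto simp: kurosh_generators_def bs_def)
      then show ?thesis by (rule gen_M)
    qed
    then have "inv\<^bsub>G\<^esub> c (\<gamma> True q @ inv_word (\<gamma> False q)) \<in> M" using M subgroup.m_inv_closed by metis
    then have ft: "c (\<gamma> False q @ inv_word (\<gamma> True q)) \<in> M"
      using \<gamma>[OF q] by (simp add: pres_class_inverse[symmetric] words_over_append)
    have "c (\<gamma> i q @ inv_word (\<gamma> i q)) \<in> M"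
      using \<gamma>[OF q] one by (simp add: pres_class_mult[symmetric] pres_class_inverse pres_class_closed)
    with tf ft show ?thesis by (cases i; cases j) auto
  qed
  have side: "c (\<gamma> i (act l q) @ [l] @ inv_word (\<gamma> i q)) \<in> M"
    if q: "q \<in> E" "act l q \<in> E" and l: "fst l \<in> X i" for i l q
  proof -
    have qP: "q \<in> P" "act l q \<in> P" using q E_P by auto
    have r: "root i (act l q) = root i q" using l qP by (simp add: root_act)
    have lw: "[l] \<in> words_over (X i)" using l by simp
    let ?g = "word (i, root i q)" and ?w = "inv_word (rep i (act l q)) @ [l] @ rep i q"
    have "cocycle i [l] q \<in> c ` set (ks (i, root i q))"
      using cocycle_stab[OF lw qP(1)] ks(2) by blast
    then obtain k where k: "k \<in> set (ks (i, root i q))" "c k = c ?w" by (auto simp: cocycle_def)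
    obtain e where e: "e \<in> set es" "fst e = (i, root i q)" "word_of e = ?g" using entry[OF q(1)] by blast
    then have "?g @ k @ inv_word ?g \<in> set ?gens"
      unfolding set_kurosh_generators using k(1)
      by (intro disjI2 bexI[OF _ e(1)] bexI[of _ k]) simp_all
    then have "c (?g @ k @ inv_word ?g) \<in> M" by (rule gen_M)
    moreover have "c (?g @ k @ inv_word ?g) = c (?g @ ?w @ inv_word ?g)"
    proof -
      have "k \<in> words_over XX" using ks(1) k(1) words_over_side by fastforce
      moreover have "?w \<in> words_over XX" using qP words_over_side[OF lw] by (simp add: words_over_append)
      ultimately show ?thesis
        using k(2) word_H(2)[OF q(1)] pres_class_mult[of ?g XX "k @ inv_word ?g"]
          pres_class_mult[of k XX "inv_word ?g"] pres_class_mult[of ?g XX "?w @ inv_word ?g"]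
          pres_class_mult[of ?w XX "inv_word ?g"]
        by (simp only: words_over_append inv_word_words_over) metis
    qed
    ultimately show ?thesis by (simp add: \<gamma>_def r)
  qed
  have path: "c (\<gamma> False (foldr act u base) @ u @ inv_word (\<gamma> False base)) \<in> M"
    if "suffix_of hs u" for u
    using that
  proof (induction u)
    case Nil
    then show ?case using cross[OF base_E, of False False] by simp
  next
    case (Cons l u)
    then obtain h v where h: "h \<in> set hs" "h = (v @ [l]) @ u" by auto
    then have u: "suffix_of hs u" by blast
    let ?q = "foldr act u base" and ?q' = "foldr act (l # u) base"
    have q: "?q \<in> E" "?q' \<in> E" unfolding E using u Cons.prems by blast+
    obtain i where i: "fst l \<in> X i" using suffix_words_over[OF Cons.prems] by auto
    note ws = \<gamma>[OF q(1)] \<gamma>[OF q(2)] \<gamma>[OF base_E] suffix_words_over[OF Cons.prems] suffix_words_over[OF u]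
    have l: "[l] \<in> words_over XX" using ws(4) by simp
    have "c (\<gamma> False ?q' @ inv_word (\<gamma> i ?q')) \<otimes>\<^bsub>G\<^esub> (c (\<gamma> i ?q' @ [l] @ inv_word (\<gamma> i ?q)) \<otimes>\<^bsub>G\<^esub>
        (c (\<gamma> i ?q @ inv_word (\<gamma> False ?q)) \<otimes>\<^bsub>G\<^esub> c (\<gamma> False ?q @ u @ inv_word (\<gamma> False base)))) \<in> M"
      using cross q side i Cons.IH[OF u] M by (intro subgroup.m_closed) simp_all
    also have "c (\<gamma> i ?q @ inv_word (\<gamma> False ?q)) \<otimes>\<^bsub>G\<^esub> c (\<gamma> False ?q @ u @ inv_word (\<gamma> False base)) =
        c (\<gamma> i ?q @ u @ inv_word (\<gamma> False base))"
      using pres_class_cancel_middle(2)[of "\<gamma> i ?q" XX "\<gamma> False ?q" "u @ inv_word (\<gamma> False base)"] ws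
      by (simp add: pres_class_mult words_over_append)
    also have "c (\<gamma> i ?q' @ [l] @ inv_word (\<gamma> i ?q)) \<otimes>\<^bsub>G\<^esub> c (\<gamma> i ?q @ u @ inv_word (\<gamma> False base)) =
        c (\<gamma> i ?q' @ [l] @ u @ inv_word (\<gamma> False base))"
      using pres_class_cancel_middle(2)[of "\<gamma> i ?q' @ [l]" XX "\<gamma> i ?q" "u @ inv_word (\<gamma> False base)"] ws l
      by (simp add: pres_class_mult words_over_append)
    also have "c (\<gamma> False ?q' @ inv_word (\<gamma> i ?q')) \<otimes>\<^bsub>G\<^esub> c (\<gamma> i ?q' @ [l] @ u @ inv_word (\<gamma> False base)) =
        c (\<gamma> False ?q' @ [l] @ u @ inv_word (\<gamma> False base))"
      using pres_class_cancel_middle(2)[of "\<gamma> False ?q'" XX "\<gamma> i ?q'" "[l] @ u @ inv_word (\<gamma> False base)"] ws l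
      by (simp add: pres_class_mult words_over_append)
    finally show ?case by simp
  qed
  have "word (False, root False base) = rep False base"
    using word[of "((False, root False base), rep False base, base)"] es by (simp add: tree_def)
  then have \<gamma>1: "c (\<gamma> False base) = \<one>\<^bsub>G\<^esub>"
    using pres_class_left_inverse[of "inv_word (rep False base)" XX] base by (simp add: \<gamma>_def)
  have "c h \<in> M" if h: "h \<in> set hs" for h
  proof -
    have "\<exists>h'\<in>set hs. \<exists>v. h' = v @ h" using h by (intro bexI[of _ h] exI[of _ "[]"]) auto
    then have "c (\<gamma> False base @ h @ inv_word (\<gamma> False base)) \<in> M"
      using path[of h] base_loop[OF h] by simp
    moreover have "h \<in> words_over XX" using h hs by blast
    then have "c (\<gamma> False base @ h @ inv_word (\<gamma> False base)) = c h"
      using \<gamma>[OF base_E, of False] \<gamma>1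
      by (simp add: pres_class_mult[symmetric] pres_class_inverse words_over_append pres_class_closed)
    ultimately show ?thesis by simp
  qed
  then have "H \<subseteq> M" using M by (intro generate_subgroup_incl) auto
  show thesis
  proof (rule that[of es ks bs])
    show "set ?gens \<subseteq> words_over XX" using gens_H by blast
    show "generate G (c ` set ?gens) = H" using \<open>H \<subseteq> M\<close> \<open>M \<subseteq> H\<close> by (simp add: M_def)
    show "\<And>q b. (q, b) \<in> set bs \<Longrightarrow> q \<in> P \<and> q \<notin> ?T \<and>
       (\<exists>d\<in>set es. \<exists>d'\<in>set es. fst d = (True, root True q) \<and> fst d' = (False, root False q) \<and>
          b = (word_of d @ inv_word (rep True q)) @ inv_word (word_of d' @ inv_word (rep False q)))"
    proof -
      fix q b assume "(q, b) \<in> set bs"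
      then have q: "q \<in> E" "q \<notin> ?T" "b = \<gamma> True q @ inv_word (\<gamma> False q)"
        using qs(1) by (auto simp: bs_def)
      obtain d where "d \<in> set es" "fst d = (True, root True q)" "word_of d = word (True, root True q)"
        using entry[OF q(1)] by blast
      moreover obtain d' where "d' \<in> set es" "fst d' = (False, root False q)"
        "word_of d' = word (False, root False q)"
        using entry[OF q(1)] by blast
      ultimately show "q \<in> P \<and> q \<notin> ?T \<and>
       (\<exists>d\<in>set es. \<exists>d'\<in>set es. fst d = (True, root True q) \<and> fst d' = (False, root False q) \<and>
          b = (word_of d @ inv_word (rep True q)) @ inv_word (word_of d' @ inv_word (rep False q)))"
        using q E_P unfolding \<gamma>_def by (intro conjI bexI[of _ d] bexI[of _ d']) auto
    qed
    show "reached root rep base es" "distinct (map fst es)" using es by (simp_all add: tree_def)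
    show "?T \<subseteq> P" using treeD(1)[OF es] E_P by force
    show "\<And>e k. e \<in> set es \<Longrightarrow> k \<in> set (ks (fst e)) \<Longrightarrow>
       k \<in> words_over (X (side e)) \<and> foldr act k (vertex e) = vertex e"
      using ks(1) by blast
    show "distinct (map fst bs)" using qs(2) by (simp add: bs_def comp_def)
  qed
qed

end

section \<open>The finite action on cosets\<close>

text \<open>
  This serves twice: to number the points of a finite model, and to replace its functions by
  finite tables, which agree with them on relevant arguments only.
\<close>

lemma kurosh_model_transport:
  fixes g :: "'p \<Rightarrow> 'q" and P :: "'p set"
  defines "f \<equiv> inv_into P g"
  assumes "kurosh_model X R P act root rep base hs \<nu> E" and g: "bij_betw g P P'"
    and act': "\<And>l q. fst l \<in> X True \<union> X False \<Longrightarrow> q \<in> P' \<Longrightarrow> act' l q = g (act l (f q))"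
    and root': "\<And>i q. q \<in> P' \<Longrightarrow> root' i q = g (root i (f q))"
    and rep': "\<And>i q. q \<in> P' \<Longrightarrow> rep' i q = rep i (f q)"
  shows "kurosh_model X R P' act' root' rep' (g base) hs (\<lambda>q. \<nu> (f q)) (g ` E)"
proof -
  interpret kurosh_model X R P act root rep base hs \<nu> E by fact
  have f: "f q \<in> P" "g (f q) = q" if "q \<in> P'" for q
    using that g by (auto simp: f_def bij_betw_def inv_into_into f_inv_into_f)
  have gP: "g q \<in> P'" "f (g q) = q" if "q \<in> P" for q
    using that g by (auto simp: f_def bij_betw_def)
  have acts': "foldr act' w q = g (foldr act w (f q))"
    if "w \<in> words_over XX" "q \<in> P'" for w q
    using that by (induction w) (auto simp: f gP acts act')
  have act'_side: "act' l q = g (act l (f q))" if "fst l \<in> X i" "q \<in> P'" for l i q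
    using that act'[of l q] by (cases i) auto
  note XX = words_over_side
  have R': "r \<in> words_over (X i)" if "r \<in> R i" for r i using R that by blast
  \<comment> \<open>The cases are numbered like the assumptions of \<open>covering\<close>, followed by those of \<open>kurosh_model\<close>.\<close>
  show ?thesis
  proof (unfold_locales, goal_cases)
    case (3 r i q)
    then show ?case using R'[of r i] by (simp add: acts' XX f act_relator)
  next
    case (7 q i)
    then show ?case by (simp add: acts' f gP root rep_root root' rep')
  next
    case (1 l i q)
    then show ?case by (simp add: act'_side[OF 1(1)] gP f act[OF 1(1)])
  next
    case (2 l i q)
    then have "fst (inv_letter l) \<in> X i" by simp
    with 2 show ?case by (simp add: act'_side[of _ i] gP f act[of _ i] act_inverse[of _ i])
  next
    case (5 l i q)
    then show ?case by (simp add: act'_side[OF 5(1)] root' gP f act[OF 5(1)] root_act)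
  next
    case 11
    have "foldr act' u (g base) = g (foldr act u base)"
      if "suffix_of hs u" for u
      using acts'[OF suffix_words_over[OF that] gP(1)[OF base]] by (simp add: gP base)
    then have "(\<lambda>u. g (foldr act u base)) ` {u. suffix_of hs u} =
        (\<lambda>u. foldr act' u (g base)) ` {u. suffix_of hs u}"
      by (intro image_cong) simp_all
    moreover have "g ` E = (\<lambda>u. g (foldr act u base)) ` {u. suffix_of hs u}"
      unfolding E by blast
    ultimately show ?case by (simp only: setcompr_eq_image)
  next
    case (14 q i)
    then show ?case using E_P nu_rep by (auto simp: gP root root' rep' subset_iff)
  next
    case (15 q w i)
    then obtain r where r: "r \<in> E" "q = g r" by blast
    then have rP: "r \<in> P" "root i r \<in> P" using E_P root by auto
    then have "g (foldr act w (root i r)) = g (root i r)"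
      using 15 r by (simp add: gP acts' XX root')
    then have "foldr act w (root i r) = root i r"
      using gP(2) rP acts[OF XX[OF 15(2)]] by metis
    then show ?case using nu_stab[OF r(1) 15(2)] r rP by (simp add: gP root')
  next
    case (16 h)
    then show ?case using hs base_loop[of h] by (auto simp: acts' gP base)
  qed (use disjoint R hs in \<open>auto simp: f gP root rep rep_of_root root' rep' base nu_base nu_closed finite_side\<close>)
qed

locale finite_free_factors = free_product_presentation X R
  for X :: "bool \<Rightarrow> 'a set" and R :: "bool \<Rightarrow> 'a word set" +
  fixes hs :: "'a word list"
  assumes hs: "set hs \<subseteq> words_over XX"
    and finite_side: "finite (c ` words_over (X i))"
begin

abbreviation "H \<equiv> generate G (c ` set hs)"

definition visited :: "'a word set set set" where
  "visited = {c u <#\<^bsub>G\<^esub> H | u. suffix_of hs u}"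

definition orbit :: "bool \<Rightarrow> 'a word set set \<Rightarrow> 'a word set set set" where
  "orbit i C = (\<lambda>w. c w <#\<^bsub>G\<^esub> C) ` words_over (X i)"

text \<open>The union of those orbits under factor \<open>i\<close> that contain a visited coset.\<close>

definition domain :: "bool \<Rightarrow> 'a word set set set" where
  "domain i = (\<Union>C\<in>visited. orbit i C)"

text \<open>
  The domain of one factor need not be invariant under the other one.  Each factor acts trivially
  outside of its domain, which turns the union of both domains into a finite set with an action
  of \<open>G\<close>.
\<close>

definition cact :: "'a \<times> bool \<Rightarrow> 'a word set set \<Rightarrow> 'a word set set" where
  "cact l C = (if C \<in> domain (fst l \<in> X True) then c [l] <#\<^bsub>G\<^esub> C else C)"

definition croot :: "bool \<Rightarrow> 'a word set set \<Rightarrow> 'a word set set" where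
  "croot i C = (if C \<in> domain i then SOME D. D \<in> orbit i C else C)"

definition crep :: "bool \<Rightarrow> 'a word set set \<Rightarrow> 'a word" where
  "crep i C = (if croot i C = C then [] else SOME w. w \<in> words_over (X i) \<and> c w <#\<^bsub>G\<^esub> croot i C = C)"

lemma suffix_words_over: "suffix_of hs u \<Longrightarrow> u \<in> words_over XX"
  using hs by (force simp: words_over_append)

lemma H_subgroup: "subgroup H G"
  using hs by (intro generate_is_subgroup) (auto intro: pres_class_closed)

lemma coset_append:
  "C \<subseteq> carrier G \<Longrightarrow> u \<in> words_over XX \<Longrightarrow> w \<in> words_over XX \<Longrightarrow>
    c u <#\<^bsub>G\<^esub> (c w <#\<^bsub>G\<^esub> C) = c (u @ w) <#\<^bsub>G\<^esub> C"
  by (simp add: lcos_m_assoc pres_class_mult pres_class_closed)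

lemma coset_Nil: "C \<subseteq> carrier G \<Longrightarrow> c [] <#\<^bsub>G\<^esub> C = C"
  by (simp add: pres_class_Nil lcos_mult_one)

lemma coset_inverse:
  "C \<subseteq> carrier G \<Longrightarrow> w \<in> words_over XX \<Longrightarrow> c (inv_word w) <#\<^bsub>G\<^esub> (c w <#\<^bsub>G\<^esub> C) = C"
  by (simp add: coset_append pres_class_left_inverse lcos_mult_one)

lemma coset_closed: "C \<subseteq> carrier G \<Longrightarrow> w \<in> words_over XX \<Longrightarrow> c w <#\<^bsub>G\<^esub> C \<subseteq> carrier G"
  by (rule l_coset_subset_G) (simp_all add: pres_class_closed)

lemma visited_closed: "C \<in> visited \<Longrightarrow> C \<subseteq> carrier G"
  using coset_closed[OF subgroup.subset[OF H_subgroup]] suffix_words_over by (auto simp: visited_def)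

lemma domain_closed: "C \<in> domain i \<Longrightarrow> C \<subseteq> carrier G"
  using coset_closed[OF visited_closed words_over_side] by (auto simp: domain_def orbit_def)

lemma H_visited: "H \<in> visited"
  using coset_Nil[OF subgroup.subset[OF H_subgroup]] unfolding visited_def by force

lemma orbit_self: "C \<subseteq> carrier G \<Longrightarrow> C \<in> orbit i C"
  unfolding orbit_def by (rule image_eqI[of _ _ "[]"]) (simp_all add: coset_Nil)

lemma orbit_step:
  assumes "C \<subseteq> carrier G" "w \<in> words_over (X i)"
  shows "orbit i (c w <#\<^bsub>G\<^esub> C) = orbit i C"
proof -
  have sub: "orbit i (c w <#\<^bsub>G\<^esub> C) \<subseteq> orbit i C" if "C \<subseteq> carrier G" "w \<in> words_over (X i)" for C w
  proof
    fix D assume "D \<in> orbit i (c w <#\<^bsub>G\<^esub> C)"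
    then obtain u where u: "u \<in> words_over (X i)" "D = c u <#\<^bsub>G\<^esub> (c w <#\<^bsub>G\<^esub> C)" by (auto simp: orbit_def)
    then have "D = c (u @ w) <#\<^bsub>G\<^esub> C" using that by (simp add: coset_append words_over_side)
    then show "D \<in> orbit i C" using u that by (auto simp: orbit_def words_over_append)
  qed
  have "orbit i C = orbit i (c (inv_word w) <#\<^bsub>G\<^esub> (c w <#\<^bsub>G\<^esub> C))"
    using assms by (simp add: coset_inverse words_over_side)
  also have "\<dots> \<subseteq> orbit i (c w <#\<^bsub>G\<^esub> C)"
    using assms by (intro sub coset_closed) (auto simp: words_over_side)
  finally show ?thesis using sub[OF assms] by blast
qed

lemma visited_domain: "C \<in> visited \<Longrightarrow> C \<in> domain i"
  using orbit_self[OF visited_closed, of C i] by (auto simp: domain_def)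

lemma domain_step:
  assumes "C \<in> domain i" "w \<in> words_over (X i)"
  shows "c w <#\<^bsub>G\<^esub> C \<in> domain i"
proof -
  obtain D where D: "D \<in> visited" "C \<in> orbit i D" using assms by (auto simp: domain_def)
  then obtain u where u: "u \<in> words_over (X i)" "C = c u <#\<^bsub>G\<^esub> D" by (auto simp: orbit_def)
  have "c w <#\<^bsub>G\<^esub> C \<in> orbit i C" using assms(2) by (auto simp: orbit_def)
  also have "orbit i C = orbit i D" using orbit_step[OF visited_closed[OF D(1)] u(1)] u(2) by simp
  finally show ?thesis using D(1) by (auto simp: domain_def)
qed

lemma cact_domain:
  "C \<in> domain i \<Longrightarrow> w \<in> words_over (X i) \<Longrightarrow> foldr cact w C = c w <#\<^bsub>G\<^esub> C"
proof (induction w)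
  case Nil
  then show ?case by (simp add: coset_Nil domain_closed)
next
  case (Cons l w)
  then have w: "w \<in> words_over (X i)" "[l] \<in> words_over (X i)" "(fst l \<in> X True) = i"
    using side_eq[of l i] by auto
  then show ?case
    using Cons domain_step[OF Cons.prems(1) w(1)]
      coset_append[OF domain_closed[OF Cons.prems(1)] words_over_side[OF w(2)] words_over_side[OF w(1)]]
    by (simp add: cact_def)
qed

lemma cact_outside: "C \<notin> domain i \<Longrightarrow> w \<in> words_over (X i) \<Longrightarrow> foldr cact w C = C"
proof (induction w)
  case (Cons l w)
  then have "(fst l \<in> X True) = i" by (intro side_eq) simp
  with Cons show ?case by (simp add: cact_def)
qed simp

lemma croot_orbit: "C \<in> domain i \<Longrightarrow> croot i C \<in> orbit i C"
  using someI[of "\<lambda>D. D \<in> orbit i C", OF orbit_self[OF domain_closed]] by (simp add: croot_def)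

lemma croot_domain: "C \<in> domain i \<Longrightarrow> croot i C \<in> domain i"
  using croot_orbit[of C i] domain_step[of C i] by (auto simp: orbit_def)

lemma croot_step: "C \<in> domain i \<Longrightarrow> w \<in> words_over (X i) \<Longrightarrow> croot i (c w <#\<^bsub>G\<^esub> C) = croot i C"
  using orbit_step[OF domain_closed] domain_step by (simp add: croot_def)

lemma croot_croot: "croot i (croot i C) = croot i C"
proof (cases "C \<in> domain i")
  case True
  then show ?thesis using croot_orbit[OF True] croot_step[OF True] by (auto simp: orbit_def)
qed (simp add: croot_def)

lemma crep: "crep i C \<in> words_over (X i)" "C \<in> domain i \<Longrightarrow> c (crep i C) <#\<^bsub>G\<^esub> croot i C = C"
proof -
  have ex: "\<exists>w. w \<in> words_over (X i) \<and> c w <#\<^bsub>G\<^esub> croot i C = C" if C: "C \<in> domain i"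
  proof -
    obtain w where w: "w \<in> words_over (X i)" "croot i C = c w <#\<^bsub>G\<^esub> C"
      using croot_orbit[OF C] by (auto simp: orbit_def)
    then show ?thesis
      using coset_inverse[OF domain_closed[OF C] words_over_side[OF w(1)]] by (intro exI[of _ "inv_word w"]) simp
  qed
  show "crep i C \<in> words_over (X i)"
  proof (cases "C \<in> domain i")
    case True
    from someI_ex[OF ex[OF this]] show ?thesis by (simp add: crep_def)
  qed (simp add: crep_def croot_def)
  show "C \<in> domain i \<Longrightarrow> c (crep i C) <#\<^bsub>G\<^esub> croot i C = C"
  proof -
    assume C: "C \<in> domain i"
    from someI_ex[OF ex[OF C]] show ?thesis
      by (auto simp: crep_def coset_Nil domain_closed[OF C])
  qed
qed

lemma crep_croot: "foldr cact (crep i C) (croot i C) = C"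
proof (cases "C \<in> domain i")
  case True
  then show ?thesis using cact_domain[OF croot_domain[OF True] crep(1)] crep(2)[OF True] by simp
qed (simp add: croot_def crep_def)

text \<open>
  A generator of \<open>H\<close> only passes through visited cosets, where the modified action agrees with the
  multiplication of cosets.
\<close>

lemma cact_visited:
  "suffix_of hs u \<Longrightarrow> foldr cact u H = c u <#\<^bsub>G\<^esub> H"
proof (induction u)
  case Nil
  then show ?case by (simp add: coset_Nil subgroup.subset[OF H_subgroup])
next
  case (Cons l u)
  then obtain h v where h: "h \<in> set hs" "h = (v @ [l]) @ u" by auto
  then have u: "suffix_of hs u" by blast
  obtain i where i: "[l] \<in> words_over (X i)" using suffix_words_over[OF Cons.prems] by auto
  have vis: "c u <#\<^bsub>G\<^esub> H \<in> visited" using u unfolding visited_def by blast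
  have "foldr cact (l # u) H = foldr cact [l] (c u <#\<^bsub>G\<^esub> H)" using Cons.IH[OF u] by simp
  also have "\<dots> = c [l] <#\<^bsub>G\<^esub> (c u <#\<^bsub>G\<^esub> H)" by (rule cact_domain[OF visited_domain[OF vis] i])
  also have "\<dots> = c (l # u) <#\<^bsub>G\<^esub> H"
    using coset_append[OF subgroup.subset[OF H_subgroup] words_over_side[OF i] suffix_words_over[OF u]]
    by simp
  finally show ?case .
qed

lemma finite_domain: "finite (domain i)"
proof -
  have "visited = (\<lambda>u. c u <#\<^bsub>G\<^esub> H) ` {u. suffix_of hs u}"
    unfolding visited_def by blast
  then have "finite visited" using finite_suffixes[of hs] by simp
  moreover have "orbit i C = (\<lambda>x. x <#\<^bsub>G\<^esub> C) ` (c ` words_over (X i))" for C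
    by (auto simp: orbit_def)
  then have "finite (orbit i C)" for C using finite_side by simp
  ultimately show ?thesis by (simp add: domain_def)
qed

lemma coset_model:
  "kurosh_model X R (domain True \<union> domain False) cact croot crep H hs (\<lambda>C. C) visited"
proof -
  have dom: "C \<in> domain i \<Longrightarrow> C \<in> domain True \<union> domain False" for C i by (cases i) auto
  have cact1: "(C \<in> domain i \<and> cact l C = c [l] <#\<^bsub>G\<^esub> C \<and> cact l C \<in> domain i) \<or> (C \<notin> domain i \<and> cact l C = C)"
    if "fst l \<in> X i" for l C i
    using side_eq[OF that] domain_step[of C i "[l]"] that by (simp add: cact_def)
  \<comment> \<open>The cases are numbered like the assumptions of \<open>covering\<close>, followed by those of \<open>kurosh_model\<close>.\<close>
  show ?thesis
  proof (unfold_locales, goal_cases)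
    case (1 l i q)
    then show ?case using cact1[OF 1(1), of q] dom by auto
  next
    case (2 l i q)
    have l: "[l, inv_letter l] \<in> words_over (X i)" "[l] \<in> words_over (X i)" using 2 by auto
    have "foldr cact [l, inv_letter l] q = q"
    proof (cases "q \<in> domain i")
      case True
      have "c [l, inv_letter l] = \<one>\<^bsub>G\<^esub>"
        using pres_class_left_inverse[of "[inv_letter l]" XX] words_over_side[OF l(2)] by simp
      then show ?thesis
        using cact_domain[OF True l(1)] domain_closed[OF True] by (simp only: lcos_mult_one)
    qed (rule cact_outside[OF _ l(1)])
    then show ?case by simp
  next
    case (3 r i q)
    then have r: "r \<in> words_over (X i)" using R by blast
    show ?case
    proof (cases "q \<in> domain i")
      case True
      then show ?thesis
        using cact_domain[OF True r] relator_trivial[OF 3(1)] domain_closed[OF True] by (simp add: lcos_mult_one)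
    qed (rule cact_outside[OF _ r])
  next
    case (4 q i)
    then show ?case using croot_domain[of q i] dom by (cases "q \<in> domain i") (auto simp: croot_def)
  next
    case (5 l i q)
    then show ?case using cact1[OF 5(1), of q] croot_step[of q i "[l]"] by auto
  next
    case (8 q i)
    then show ?case by (simp add: crep_def croot_croot)
  next
    case 11
    show ?case unfolding visited_def using cact_visited by (metis (no_types, lifting))
  next
    case (13 q)
    then show ?case using domain_closed by blast
  next
    case (14 q i)
    then show ?case using crep(2)[OF visited_domain] by simp
  next
    case (15 q w i)
    then show ?case using cact_domain[OF croot_domain[OF visited_domain]] by simp
  next
    case (16 h)
    have "\<exists>h'\<in>set hs. \<exists>v. h' = v @ h" using 16 by (intro bexI[of _ h] exI[of _ "[]"]) simp_all
    then have "foldr cact h H = c h <#\<^bsub>G\<^esub> H" by (intro cact_visited) blast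
    moreover have "c h \<in> H" using 16 by (auto intro: generate.incl)
    then have "c h <#\<^bsub>G\<^esub> H = H" using subgroup.mem_carrier[OF H_subgroup]
      by (intro coset_join3) (auto simp: H_subgroup)
    ultimately show ?case by simp
  qed (use disjoint R hs H_visited finite_side crep(1) crep_croot visited_domain[of H True] in auto)
qed

theorem nat_model_exists:
  obtains n act root rep base \<nu> E where
    "kurosh_model X R {..<n :: nat} act root rep base hs \<nu> E"
proof -
  obtain n and g :: "_ \<Rightarrow> nat" where "bij_betw g (domain True \<union> domain False) {..<n}"
    using ex_bij_betw_finite_nat[of "domain True \<union> domain False"] finite_domain
    by (auto simp: atLeast0LessThan)
  from that[OF kurosh_model_transport[OF coset_model this HOL.refl HOL.refl HOL.refl]] show thesis .
qed

end

section \<open>Derivations and membership witnesses\<close>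

text \<open>
  A step \<open>(a, m, b)\<close> inserts or deletes \<open>m\<close> between \<open>a\<close> and \<open>b\<close>, whichever is possible.  A step that
  does not fit has no effect, and every step is its own inverse; hence a derivation
  is just a list of steps, and reversing it inverts it.
\<close>

definition apply_step :: "'a word \<times> 'a word \<times> 'a word \<Rightarrow> 'a word \<Rightarrow> 'a word" where
  "apply_step s w = (case s of (a, m, b) \<Rightarrow>
     if w = a @ b then a @ m @ b else if w = a @ m @ b then a @ b else w)"

definition elementary :: "'a set \<Rightarrow> 'a word set \<Rightarrow> 'a word \<Rightarrow> bool" where
  "elementary X R m \<longleftrightarrow> m \<in> R \<or> (\<exists>x\<in>X. m = [(x, True), (x, False)] \<or> m = [(x, False), (x, True)])"

lemma apply_step_involution: "apply_step s (apply_step s w) = w"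
  by (auto simp: apply_step_def split: prod.splits)

lemma foldr_apply_step_rev: "foldr apply_step (rev D) (foldr apply_step D w) = w"
  by (induction D arbitrary: w) (auto simp: apply_step_involution)

lemma elementary_pres_eq:
  assumes "R \<subseteq> words_over X" "elementary X R m" "a @ b \<in> words_over X"
  shows "pres_eq X R (a @ m @ b) (a @ b)" "m \<in> words_over X"
proof -
  have ab: "a \<in> words_over X" "b \<in> words_over X" using assms(3) by (simp_all add: words_over_append)
  show "pres_eq X R (a @ m @ b) (a @ b)" "m \<in> words_over X"
    using assms(1,2) pres_eq.relator[OF ab, of m R]
      pres_eq.cancel[OF ab, of "(_, True)" R] pres_eq.cancel[OF ab, of "(_, False)" R]
    by (auto simp: elementary_def inv_letter_def)
qed

lemma apply_step_pres_eq:
  assumes "R \<subseteq> words_over X" "elementary X R (fst (snd s))" "w \<in> words_over X"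
  shows "pres_eq X R w (apply_step s w)"
proof -
  obtain a m b where s: "s = (a, m, b)" by (cases s)
  consider "w = a @ b" "apply_step s w = a @ m @ b" | "w = a @ m @ b" "apply_step s w = a @ b"
    | "apply_step s w = w"
    unfolding apply_step_def s prod.case by argo
  then show ?thesis
  proof cases
    case 1
    then show ?thesis using elementary_pres_eq(1)[of R X m a b] assms s by (auto intro: pres_eq.sym)
  next
    case 2
    then show ?thesis using elementary_pres_eq(1)[of R X m a b] assms s by (auto simp: words_over_append)
  qed (use assms(3) in \<open>auto intro: pres_eq.refl\<close>)
qed

lemma derivation_sound:
  assumes "R \<subseteq> words_over X" "\<And>s. s \<in> set D \<Longrightarrow> elementary X R (fst (snd s))" "w \<in> words_over X"
  shows "pres_eq X R w (foldr apply_step D w)"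
  using assms(2)
proof (induction D)
  case (Cons s D)
  then have "pres_eq X R w (foldr apply_step D w)" by simp
  moreover from pres_eq_words[OF this]
  have "pres_eq X R (foldr apply_step D w) (apply_step s (foldr apply_step D w))"
    using Cons.prems assms(1) by (intro apply_step_pres_eq) auto
  ultimately show ?case by (auto intro: pres_eq.trans)
qed (use assms(3) in \<open>auto intro: pres_eq.refl\<close>)

lemma derivation_complete:
  assumes "pres_eq X R v w"
  shows "\<exists>D. (\<forall>s\<in>set D. elementary X R (fst (snd s))) \<and> foldr apply_step D v = w"
  using assms
proof (induction rule: pres_eq.induct)
  case (refl w)
  show ?case by (intro exI[of _ "[]"]) simp
next
  case (sym v w)
  then obtain D where D: "\<forall>s\<in>set D. elementary X R (fst (snd s))" "foldr apply_step D v = w" by blast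
  then have "foldr apply_step (rev D) w = v" using foldr_apply_step_rev by metis
  with D show ?case by (intro exI[of _ "rev D"]) simp
next
  case (trans u v w)
  then obtain D D' where "\<forall>s\<in>set D. elementary X R (fst (snd s))" "foldr apply_step D u = v"
    "\<forall>s\<in>set D'. elementary X R (fst (snd s))" "foldr apply_step D' v = w" by blast
  then show ?case by (intro exI[of _ "D' @ D"]) auto
next
  case (cancel u v p)
  then show ?case
    by (intro exI[of _ "[(u, [p, inv_letter p], v)]"])
      (cases p; auto simp: apply_step_def elementary_def inv_letter_def)
next
  case (relator u v r)
  then show ?case
    by (intro exI[of _ "[(u, r, v)]"]) (auto simp: apply_step_def elementary_def)
qed

text \<open>
  Equality in \<open>G\<close> has finite proofs, and so has membership in a subgroup: a product of
  generators and their inverses together with a derivation of the given word from it.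
\<close>

definition witnesses ::
    "'a set \<Rightarrow> 'a word set \<Rightarrow> 'a word set \<Rightarrow> 'a word list \<times> ('a word \<times> 'a word \<times> 'a word) list \<Rightarrow> 'a word \<Rightarrow> bool" where
  "witnesses X R Y z x \<longleftrightarrow> (\<forall>u\<in>set (fst z). u \<in> Y \<or> inv_word u \<in> Y) \<and>
     (\<forall>s\<in>set (snd z). elementary X R (fst (snd s))) \<and> foldr apply_step (snd z) (concat (fst z)) = x"

lemma concat_mem_generate:
  assumes "Y \<subseteq> words_over X" "\<forall>u\<in>set us. u \<in> Y \<or> inv_word u \<in> Y"
  shows "concat us \<in> words_over X \<and>
    pres_class X R (concat us) \<in> generate (presented_group X R) (pres_class X R ` Y)"
  using assms(2)
proof (induction us)
  case Nil
  then show ?case by (simp add: pres_class_Nil generate.one)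
next
  case (Cons u us)
  let ?G = "presented_group X R" and ?c = "pres_class X R"
  have u: "u \<in> words_over X" using Cons.prems assms(1) inv_word_words_over[of u X] by auto
  have "?c u \<in> generate ?G (?c ` Y)"
  proof (cases "u \<in> Y")
    case False
    then have "inv_word u \<in> Y" using Cons.prems by simp
    then have "inv\<^bsub>?G\<^esub> ?c (inv_word u) \<in> generate ?G (?c ` Y)" by (auto intro: generate.inv)
    then show ?thesis using u by (simp add: pres_class_inverse[symmetric])
  qed (auto intro: generate.incl)
  then show ?case
    using Cons u by (auto simp: words_over_append pres_class_mult[symmetric] intro: generate.eng)
qed

lemma witness_sound:
  assumes "R \<subseteq> words_over X" "Y \<subseteq> words_over X" "witnesses X R Y z x"
  shows "x \<in> words_over X" "pres_class X R x \<in> generate (presented_group X R) (pres_class X R ` Y)"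
proof -
  have 1: "concat (fst z) \<in> words_over X"
    "pres_class X R (concat (fst z)) \<in> generate (presented_group X R) (pres_class X R ` Y)"
    using concat_mem_generate[OF assms(2)] assms(3) by (auto simp: witnesses_def)
  have "pres_eq X R (concat (fst z)) x"
    using derivation_sound[OF assms(1) _ 1(1)] assms(3) by (auto simp: witnesses_def)
  then show "x \<in> words_over X" "pres_class X R x \<in> generate (presented_group X R) (pres_class X R ` Y)"
    using 1 pres_eq_words[of X R _ x] pres_class_eq_iff[of "concat (fst z)" X x R] by auto
qed

lemma generate_concat:
  assumes "Y \<subseteq> words_over X" "y \<in> generate (presented_group X R) (pres_class X R ` Y)"
  shows "\<exists>us. (\<forall>u\<in>set us. u \<in> Y \<or> inv_word u \<in> Y) \<and> pres_class X R (concat us) = y"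
  using assms(2)
proof (induction rule: generate.induct)
  case one
  show ?case by (intro exI[of _ "[]"]) (simp add: pres_class_Nil)
next
  case (incl y)
  then obtain u where "u \<in> Y" "y = pres_class X R u" by blast
  then show ?case by (intro exI[of _ "[u]"]) simp
next
  case (inv y)
  then obtain u where "u \<in> Y" "y = pres_class X R u" by blast
  then show ?case using assms(1)
    by (intro exI[of _ "[inv_word u]"]) (auto simp: pres_class_inverse)
next
  case (eng y z)
  then obtain us vs where us: "\<forall>u\<in>set us. u \<in> Y \<or> inv_word u \<in> Y" "pres_class X R (concat us) = y"
    and vs: "\<forall>u\<in>set vs. u \<in> Y \<or> inv_word u \<in> Y" "pres_class X R (concat vs) = z" by blast
  have "concat us \<in> words_over X" "concat vs \<in> words_over X"
    using concat_mem_generate[OF assms(1) us(1)] concat_mem_generate[OF assms(1) vs(1)] by blast+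
  then show ?case using us vs by (intro exI[of _ "us @ vs"]) (auto simp: pres_class_mult[symmetric])
qed

lemma witness_complete:
  assumes "Y \<subseteq> words_over X" "x \<in> words_over X"
    "pres_class X R x \<in> generate (presented_group X R) (pres_class X R ` Y)"
  shows "\<exists>z. witnesses X R Y z x"
proof -
  obtain us where us: "\<forall>u\<in>set us. u \<in> Y \<or> inv_word u \<in> Y" "pres_class X R (concat us) = pres_class X R x"
    using generate_concat[OF assms(1,3)] by blast
  have "concat us \<in> words_over X" using concat_mem_generate[OF assms(1) us(1)] by blast
  then have "pres_eq X R (concat us) x" using us(2) assms(2) by (simp add: pres_class_eq_iff)
  then obtain D where "\<forall>s\<in>set D. elementary X R (fst (snd s))" "foldr apply_step D (concat us) = x"
    using derivation_complete by blast
  then show ?thesis using us(1) by (intro exI[of _ "(us, D)"]) (simp add: witnesses_def)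
qed

section \<open>Certificates\<close>

text \<open>Finite functions occur in certificates as association lists, with a default elsewhere.\<close>

fun lookup :: "'b \<Rightarrow> ('k \<times> 'b) list \<Rightarrow> 'k \<Rightarrow> 'b" where
  "lookup d [] k = d"
| "lookup d (e # es) k = (if fst e = k then snd e else lookup d es k)"

lemma lookup_map: "k \<in> set ks \<Longrightarrow> lookup d (map (\<lambda>k. (k, f k)) ks) k = f k"
  by (induction ks) auto

definition act_tab :: "((('a \<times> bool) \<times> 'p) \<times> 'p) list \<Rightarrow> 'a \<times> bool \<Rightarrow> 'p \<Rightarrow> 'p" where
  "act_tab t l q = lookup q t (l, q)"

definition root_tab :: "((bool \<times> 'p) \<times> 'p \<times> 'a word) list \<Rightarrow> bool \<Rightarrow> 'p \<Rightarrow> 'p" where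
  "root_tab t i q = fst (lookup (q, []) t (i, q))"

definition rep_tab :: "((bool \<times> 'p) \<times> 'p \<times> 'a word) list \<Rightarrow> bool \<Rightarrow> 'p \<Rightarrow> 'a word" where
  "rep_tab t i q = snd (lookup (q, []) t (i, q))"

type_synonym presentation_pair = "(nat list \<times> nat word list) \<times> (nat list \<times> nat word list)"

definition gens_of :: "presentation_pair \<Rightarrow> bool \<Rightarrow> nat list" where
  "gens_of p i = (if i then fst (fst p) else fst (snd p))"

definition rels_of :: "presentation_pair \<Rightarrow> bool \<Rightarrow> nat word list" where
  "rels_of p i = (if i then snd (fst p) else snd (snd p))"

definition valid_covering :: "presentation_pair \<Rightarrow> nat \<Rightarrow> nat \<Rightarrow> (((nat \<times> bool) \<times> nat) \<times> nat) list \<Rightarrow>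
    ((bool \<times> nat) \<times> nat \<times> nat word) list \<Rightarrow> bool" where
  "valid_covering p n base ta tr \<longleftrightarrow> base < n \<and>
     (\<forall>i\<in>set [True, False]. \<forall>q\<in>set [0..<n].
        (\<forall>x\<in>set (gens_of p i). \<forall>s\<in>set [True, False]. act_tab ta (x, s) q < n \<and>
            act_tab ta (x, s) (act_tab ta (inv_letter (x, s)) q) = q \<and>
            root_tab tr i (act_tab ta (x, s) q) = root_tab tr i q) \<and>
        (\<forall>r\<in>set (rels_of p i). foldr (act_tab ta) r q = q) \<and>
        root_tab tr i q < n \<and>
        (\<forall>l\<in>set (rep_tab tr i q). fst l \<in> set (gens_of p i)) \<and>
        foldr (act_tab ta) (rep_tab tr i q) (root_tab tr i q) = q \<and>
        rep_tab tr i (root_tab tr i q) = [])"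

definition valid_tree :: "presentation_pair \<Rightarrow> nat \<Rightarrow> nat \<Rightarrow> (((nat \<times> bool) \<times> nat) \<times> nat) list \<Rightarrow>
    ((bool \<times> nat) \<times> nat \<times> nat word) list \<Rightarrow> (nat, nat) vertex_entry list \<Rightarrow>
    ((bool \<times> nat) \<times> nat word list) list \<Rightarrow> (nat \<times> nat word) list \<Rightarrow> bool" where
  "valid_tree p n base ta tr es tk bs \<longleftrightarrow>
     reached (root_tab tr) (rep_tab tr) base es \<and> distinct (map fst es) \<and>
     (\<forall>e\<in>set es. edge_of e < n) \<and>
     (\<forall>e\<in>set es. \<forall>k\<in>set (lookup [] tk (fst e)).
        (\<forall>l\<in>set k. fst l \<in> set (gens_of p (side e))) \<and>
        foldr (act_tab ta) k (vertex e) = vertex e) \<and>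
     distinct (map fst bs) \<and>
     (\<forall>b\<in>set bs. fst b < n \<and> fst b \<notin> set (map edge_of es) \<and>
        (\<exists>d\<in>set es. \<exists>d'\<in>set es. fst d = (True, root_tab tr True (fst b)) \<and>
           fst d' = (False, root_tab tr False (fst b)) \<and>
           snd b = (word_of d @ inv_word (rep_tab tr True (fst b))) @
             inv_word (word_of d' @ inv_word (rep_tab tr False (fst b)))))"

definition valid_generators :: "presentation_pair \<Rightarrow> nat word list \<Rightarrow> nat word list \<Rightarrow>
    (nat word list \<times> (nat word \<times> nat word \<times> nat word) list) list \<Rightarrow> bool" where
  "valid_generators p hs gs zs \<longleftrightarrow>
     (\<forall>h\<in>set hs. \<exists>z\<in>set zs. witnesses (set (gens_of p True @ gens_of p False))
        (set (rels_of p True @ rels_of p False)) (set gs) z h) \<and>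
     (\<forall>g\<in>set gs. \<exists>z\<in>set zs. witnesses (set (gens_of p True @ gens_of p False))
        (set (rels_of p True @ rels_of p False)) (set hs) z g)"

text \<open>
  The components are: the number of points with the base point, the tables of the action and of
  roots with representatives, the tree, the table of the lists that generate subgroups of the
  vertex groups, the basis elements with their edges, and the membership witnesses.
\<close>

type_synonym kurosh_certificate =
  "((nat \<times> nat) \<times> (((nat \<times> bool) \<times> nat) \<times> nat) list \<times> ((bool \<times> nat) \<times> nat \<times> nat word) list) \<times>
   ((nat, nat) vertex_entry list \<times> ((bool \<times> nat) \<times> nat word list) list \<times> (nat \<times> nat word) list) \<times>
   (nat word list \<times> (nat word \<times> nat word \<times> nat word) list) list"

definition valid_certificate ::
    "presentation_pair \<times> nat word list \<Rightarrow> kurosh_certificate \<Rightarrow> bool" where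
  "valid_certificate i c \<longleftrightarrow> (case (i, c) of ((p, hs), ((n, base), ta, tr), (es, tk, bs), zs) \<Rightarrow>
     valid_covering p n base ta tr \<and> valid_tree p n base ta tr es tk bs \<and>
     valid_generators p hs (kurosh_generators es (lookup [] tk) bs) zs)"

definition certificate_output ::
    "kurosh_certificate \<Rightarrow> nat word list \<times> (nat word \<times> nat word list) list" where
  "certificate_output c = (case c of (_, (es, tk, bs), _) \<Rightarrow>
     (map snd bs, map (\<lambda>e. (word_of e, lookup [] tk (fst e))) es))"

section \<open>Certificates can be checked by a program\<close>

lemma computable_lookup [comp_intros]:
  assumes "computable d" "computable t" "computable k"
  shows "computable (\<lambda>x. lookup (d x) (t x) (k x))"
  by (rule computable_list_rec[where f = "\<lambda>x t. lookup (d x) t (k x)" and a = d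
        and h = "\<lambda>e _ r x. if fst e = k x then snd e else r"])
    (auto intro!: comp_intros assms computable_comp[OF assms(3)])

lemma computable_foldr [comp_intros]:
  assumes "computable a" "computable (\<lambda>p. f (fst p) (fst (snd p)) (snd (snd p)))" "computable l"
  shows "computable (\<lambda>x. foldr (\<lambda>y r. f y r x) (l x) (a x))"
proof -
  have f: "computable (\<lambda>x. f (f1 x) (f2 x) (f3 x))"
    if "computable f1" "computable f2" "computable f3" for f1 f2 f3
    using computable_comp[OF assms(2) computable_Pair[OF that(1) computable_Pair[OF that(2,3)]]] by simp
  show ?thesis
    by (rule computable_list_rec[where f = "\<lambda>x l. foldr (\<lambda>y r. f y r x) l (a x)" and a = a
        and h = "\<lambda>y _ r x. f y r x"]) (auto intro!: comp_intros assms f)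
qed

lemma computable_act_tab [comp_intros]:
  "computable t \<Longrightarrow> computable l \<Longrightarrow> computable q \<Longrightarrow> computable (\<lambda>x. act_tab (t x) (l x) (q x))"
  unfolding act_tab_def by (intro comp_intros)

lemma computable_root_tab [comp_intros]:
  "computable t \<Longrightarrow> computable i \<Longrightarrow> computable q \<Longrightarrow> computable (\<lambda>x. root_tab (t x) (i x) (q x))"
  unfolding root_tab_def by (intro comp_intros)

lemma computable_rep_tab [comp_intros]:
  "computable t \<Longrightarrow> computable i \<Longrightarrow> computable q \<Longrightarrow> computable (\<lambda>x. rep_tab (t x) (i x) (q x))"
  unfolding rep_tab_def by (intro comp_intros)

lemma computable_gens_of [comp_intros]:
  "computable p \<Longrightarrow> computable i \<Longrightarrow> computable (\<lambda>x. gens_of (p x) (i x))"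
  unfolding gens_of_def by (intro comp_intros)

lemma computable_rels_of [comp_intros]:
  "computable p \<Longrightarrow> computable i \<Longrightarrow> computable (\<lambda>x. rels_of (p x) (i x))"
  unfolding rels_of_def by (intro comp_intros)

lemma computable_inv_letter [comp_intros]: "computable l \<Longrightarrow> computable (\<lambda>x. inv_letter (l x))"
  unfolding inv_letter_def by (intro comp_intros)

lemma computable_apply_step [comp_intros]:
  "computable s \<Longrightarrow> computable w \<Longrightarrow> computable (\<lambda>x. apply_step (s x) (w x))"
  unfolding apply_step_def case_prod_unfold by (intro comp_intros)

lemma computable_reached [comp_intros]:
  assumes "computable t" "computable b" "computable es"
  shows "computable (\<lambda>x. reached (root_tab (t x)) (rep_tab (t x)) (b x) (es x))"
proof (rule computable_list_rec[where f = "\<lambda>x es. reached (root_tab (t x)) (rep_tab (t x)) (b x) es"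
      and a = "\<lambda>_. True" and h = "\<lambda>e es r x. r \<and>
       (fst e = (False, root_tab (t x) False (b x)) \<and> word_of e = rep_tab (t x) False (b x) \<or>
        (\<exists>d\<in>set es. vertex d = root_tab (t x) (side d) (edge_of e) \<and>
           vertex e = root_tab (t x) (side e) (edge_of e) \<and>
           word_of e = word_of d @ inv_word (rep_tab (t x) (side d) (edge_of e)) @
             rep_tab (t x) (side e) (edge_of e)))"])
qed (simp_all only: reached.simps, (intro comp_intros assms computable_comp[OF assms(1)] computable_comp[OF assms(2)])+)

lemma computable_witnesses [comp_intros]:
  assumes "computable X" "computable R" "computable Y" "computable z" "computable w"
  shows "computable (\<lambda>x. witnesses (set (X x)) (set (R x)) (set (Y x)) (z x) (w x))"
  unfolding witnesses_def elementary_def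
  by (intro comp_intros assms computable_comp[OF assms(1)] computable_comp[OF assms(2)]
      computable_comp[OF assms(3)])

lemma computable_kurosh_generators [comp_intros]:
  assumes "computable es" "computable t" "computable bs"
  shows "computable (\<lambda>x. kurosh_generators (es x) (lookup [] (t x)) (bs x))"
  unfolding kurosh_generators_def
  by (intro comp_intros assms computable_comp[OF assms(2)])

lemma computable_valid_certificate:
  "computable (\<lambda>p. valid_certificate (fst p) (snd p))"
  unfolding valid_certificate_def case_prod_unfold fst_conv snd_conv valid_covering_def valid_tree_def valid_generators_def
  by (intro comp_intros)

lemma computable_certificate_output: "computable certificate_output"
proof -
  have "computable (\<lambda>c. certificate_output c)" unfolding certificate_output_def case_prod_unfold
    by (intro comp_intros)
  then show ?thesis by simp
qed

lemma enumerable_kurosh_certificate: "enumerable TYPE(kurosh_certificate)"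
  by (intro enumerable_prod enumerable_list enumerable_nat enumerable_bool)

section \<open>Valid certificates describe Kurosh decompositions\<close>

lemma words_over_iff: "w \<in> words_over X \<longleftrightarrow> (\<forall>l\<in>set w. fst l \<in> X)"
  by (auto simp: words_over_def mem_Times_iff lists_eq_set)

lemma generate_words_over:
  assumes "Y \<subseteq> X" "W \<subseteq> words_over Y"
  shows "generate (presented_group X R) (pres_class X R ` W) \<subseteq> pres_class X R ` words_over Y"
proof
  fix y assume y: "y \<in> generate (presented_group X R) (pres_class X R ` W)"
  have "W \<subseteq> words_over X" using assms words_over_mono by blast
  then obtain us where us: "\<forall>u\<in>set us. u \<in> W \<or> inv_word u \<in> W" "pres_class X R (concat us) = y"
    using generate_concat y by blast
  have "\<forall>u\<in>set us. u \<in> words_over Y" using us(1) assms(2) inv_word_words_over by blast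
  then have "concat us \<in> words_over Y" by (auto simp: words_over_iff)
  with us(2) show "y \<in> pres_class X R ` words_over Y" by blast
qed

text \<open>
  Membership witnesses speak of single words, whereas a free product decomposition speaks of the
  subgroups generated by parts of them.
\<close>

lemma generate_kurosh_generators:
  fixes X :: "'a set" and R :: "'a word set"
  defines "G \<equiv> presented_group X R" and "c \<equiv> pres_class X R"
  assumes es: "\<And>e. e \<in> set es \<Longrightarrow> word_of e \<in> words_over X \<and> set (ks (fst e)) \<subseteq> words_over X"
    and bs: "snd ` set bs \<subseteq> words_over X"
  shows "generate G (c ` set (kurosh_generators es ks bs)) =
    generate G (\<Union> (set (generate G (c ` snd ` set bs) #
      map (\<lambda>e. conjugate G (c (word_of e)) (generate G (c ` set (ks (fst e))))) es)))"
    (is "?M = generate G ?U")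
proof -
  interpret group G unfolding G_def by (rule group_presented_group)
  have closed: "c w \<in> carrier G" if "w \<in> words_over X" for w
    using that by (simp add: c_def G_def pres_class_closed)
  have conj: "c (g @ k @ inv_word g) = c g \<otimes>\<^bsub>G\<^esub> c k \<otimes>\<^bsub>G\<^esub> inv\<^bsub>G\<^esub> c g"
    if "g \<in> words_over X" "k \<in> words_over X" for g k
    using that unfolding c_def G_def
    by (simp add: pres_class_mult pres_class_inverse[symmetric] words_over_append)
  have gens: "set (kurosh_generators es ks bs) \<subseteq> words_over X"
    using es bs by (auto simp: set_kurosh_generators words_over_append subset_iff)
  then have M: "subgroup ?M G" by (intro generate_is_subgroup) (auto intro: closed)
  have F: "generate G (c ` snd ` set bs) \<subseteq> ?M"
    by (intro mono_generate image_mono subsetI) (simp add: set_kurosh_generators)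
  have K: "conjugate G (c (word_of e)) (generate G (c ` set (ks (fst e)))) \<subseteq> ?M" if e: "e \<in> set es" for e
  proof
    fix x assume "x \<in> conjugate G (c (word_of e)) (generate G (c ` set (ks (fst e))))"
    then obtain y where y: "y \<in> generate G (c ` set (ks (fst e)))"
      "x = c (word_of e) \<otimes>\<^bsub>G\<^esub> y \<otimes>\<^bsub>G\<^esub> inv\<^bsub>G\<^esub> c (word_of e)" by (auto simp: conjugate_def)
    let ?g = "c (word_of e)"
    have g: "?g \<in> carrier G" using es[OF e] by (simp add: closed)
    have unconj: "inv\<^bsub>G\<^esub> ?g \<otimes>\<^bsub>G\<^esub> (?g \<otimes>\<^bsub>G\<^esub> z \<otimes>\<^bsub>G\<^esub> inv\<^bsub>G\<^esub> ?g) \<otimes>\<^bsub>G\<^esub> inv\<^bsub>G\<^esub> (inv\<^bsub>G\<^esub> ?g) = z"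
      "?g \<otimes>\<^bsub>G\<^esub> (inv\<^bsub>G\<^esub> ?g \<otimes>\<^bsub>G\<^esub> z \<otimes>\<^bsub>G\<^esub> inv\<^bsub>G\<^esub> (inv\<^bsub>G\<^esub> ?g)) \<otimes>\<^bsub>G\<^esub> inv\<^bsub>G\<^esub> ?g = z"
      if "z \<in> carrier G" for z
    proof -
      have "?g \<otimes>\<^bsub>G\<^esub> (inv\<^bsub>G\<^esub> ?g \<otimes>\<^bsub>G\<^esub> y) = y" "inv\<^bsub>G\<^esub> ?g \<otimes>\<^bsub>G\<^esub> (?g \<otimes>\<^bsub>G\<^esub> y) = y" if "y \<in> carrier G" for y
        using g that by (simp_all add: m_assoc[symmetric])
      then show "inv\<^bsub>G\<^esub> ?g \<otimes>\<^bsub>G\<^esub> (?g \<otimes>\<^bsub>G\<^esub> z \<otimes>\<^bsub>G\<^esub> inv\<^bsub>G\<^esub> ?g) \<otimes>\<^bsub>G\<^esub> inv\<^bsub>G\<^esub> (inv\<^bsub>G\<^esub> ?g) = z"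
        "?g \<otimes>\<^bsub>G\<^esub> (inv\<^bsub>G\<^esub> ?g \<otimes>\<^bsub>G\<^esub> z \<otimes>\<^bsub>G\<^esub> inv\<^bsub>G\<^esub> (inv\<^bsub>G\<^esub> ?g)) \<otimes>\<^bsub>G\<^esub> inv\<^bsub>G\<^esub> ?g = z"
        using g that by (simp_all add: m_assoc)
    qed
    have "c ` set (ks (fst e)) \<subseteq> conjugate G (inv\<^bsub>G\<^esub> ?g) ?M"
    proof
      fix z assume "z \<in> c ` set (ks (fst e))"
      then obtain k where k: "k \<in> set (ks (fst e))" "z = c k" by blast
      then have kw: "k \<in> words_over X" using es[OF e] by blast
      have "word_of e @ k @ inv_word (word_of e) \<in> set (kurosh_generators es ks bs)"
        unfolding set_kurosh_generators using k(1) by (intro disjI2 bexI[OF _ e] bexI[of _ k]) simp_all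
      then have "c (word_of e @ k @ inv_word (word_of e)) \<in> ?M" by (intro generate.incl imageI)
      then have "?g \<otimes>\<^bsub>G\<^esub> c k \<otimes>\<^bsub>G\<^esub> inv\<^bsub>G\<^esub> ?g \<in> ?M"
        using conj[of "word_of e" k] es[OF e] kw by simp
      then show "z \<in> conjugate G (inv\<^bsub>G\<^esub> ?g) ?M"
        unfolding conjugate_def
        by (rule rev_image_eqI) (simp only: unconj(1)[OF closed[OF kw]] k(2))
    qed
    then have "generate G (c ` set (ks (fst e))) \<subseteq> conjugate G (inv\<^bsub>G\<^esub> ?g) ?M"
      using M g by (intro generate_subgroup_incl subgroup_conjugate) auto
    then obtain m where m: "m \<in> ?M" "y = inv\<^bsub>G\<^esub> ?g \<otimes>\<^bsub>G\<^esub> m \<otimes>\<^bsub>G\<^esub> inv\<^bsub>G\<^esub> (inv\<^bsub>G\<^esub> ?g)"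
      using y(1) by (auto simp: conjugate_def)
    then show "x \<in> ?M" using y(2) unconj(2) subgroup.mem_carrier[OF M] by simp
  qed
  have U: "?U \<subseteq> ?M"
  proof (rule Union_least)
    fix Q assume "Q \<in> set (generate G (c ` snd ` set bs) #
      map (\<lambda>e. conjugate G (c (word_of e)) (generate G (c ` set (ks (fst e))))) es)"
    then consider "Q = generate G (c ` snd ` set bs)"
      | e where "e \<in> set es" "Q = conjugate G (c (word_of e)) (generate G (c ` set (ks (fst e))))"
      by auto
    then show "Q \<subseteq> ?M" by cases (simp_all only: F K)
  qed
  show ?thesis
  proof
    show "generate G ?U \<subseteq> ?M" by (rule generate_subgroup_incl[OF U M])
    have "c x \<in> ?U" if "x \<in> set (kurosh_generators es ks bs)" for x
      using that unfolding set_kurosh_generators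
    proof (elim disjE bexE)
      fix e k assume e: "e \<in> set es" "k \<in> set (ks (fst e))" "x = word_of e @ k @ inv_word (word_of e)"
      then have "c x \<in> conjugate G (c (word_of e)) (generate G (c ` set (ks (fst e))))"
        using conj[of "word_of e" k] es[OF e(1)] by (auto simp: conjugate_def intro: generate.incl)
      then show ?thesis using e(1) by auto
    qed (auto intro: generate.incl)
    then show "?M \<subseteq> generate G ?U" by (intro mono_generate) auto
  qed
qed

lemma valid_covering_locale:
  assumes valid: "valid_covering p n base ta tr"
    and disj: "set (gens_of p True) \<inter> set (gens_of p False) = {}"
    and R: "\<And>i. set (rels_of p i) \<subseteq> words_over (set (gens_of p i))"
  shows "covering (\<lambda>i. set (gens_of p i)) (\<lambda>i. set (rels_of p i)) {..<n} (act_tab ta)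
    (root_tab tr) (rep_tab tr) base"
proof -
  have act: "act_tab ta l q < n" "act_tab ta l (act_tab ta (inv_letter l) q) = q"
    "root_tab tr i (act_tab ta l q) = root_tab tr i q" if "fst l \<in> set (gens_of p i)" "q < n" for i l q
    using that valid unfolding valid_covering_def by (cases i; cases l; cases "snd l"; simp)+
  have rest: "r \<in> set (rels_of p i) \<Longrightarrow> foldr (act_tab ta) r q = q" "root_tab tr i q < n"
    "rep_tab tr i q \<in> words_over (set (gens_of p i))"
    "foldr (act_tab ta) (rep_tab tr i q) (root_tab tr i q) = q"
    "rep_tab tr i (root_tab tr i q) = []" if "q < n" for i q r
    using that valid unfolding valid_covering_def words_over_iff by (cases i; simp)+
  show ?thesis
    by unfold_locales (use disj R act rest valid in \<open>auto simp: valid_covering_def\<close>)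
qed

text \<open>
  The tests are the hypotheses of \<open>free_product\<close>, where \<open>T\<close> consists of the connecting edges
  of the tree, and the witnesses show that the product is \<open>H\<close>.
\<close>

theorem valid_certificate_sound:
  assumes R1: "set R1 \<subseteq> words_over (set X1)" and R2: "set R2 \<subseteq> words_over (set X2)"
    and disj: "set X1 \<inter> set X2 = {}" and hs: "set hs \<subseteq> words_over (set X1 \<union> set X2)"
    and valid: "valid_certificate (((X1, R1), (X2, R2)), hs) cert"
  shows "represents_kurosh_decomposition (set X1) (set R1) (set X2) (set R2) hs
    (fst (certificate_output cert)) (snd (certificate_output cert))"
proof -
  let ?p = "((X1, R1), (X2, R2))"
  obtain n base ta tr es tk bq zs where cert: "cert = (((n, base), ta, tr), (es, tk, bq), zs)"
    by (metis surj_pair)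
  have vc: "valid_covering ?p n base ta tr" and vt: "valid_tree ?p n base ta tr es tk bq"
    and vg: "valid_generators ?p hs (kurosh_generators es (lookup [] tk) bq) zs"
    using valid by (simp_all add: valid_certificate_def cert)
  define X where "X i = set (gens_of ?p i)" for i
  define R where "R i = set (rels_of ?p i)" for i
  have XR: "X True = set X1" "X False = set X2" "R True = set R1" "R False = set R2"
    by (simp_all add: X_def R_def gens_of_def rels_of_def)
  let ?act = "act_tab ta" and ?root = "root_tab tr" and ?rep = "rep_tab tr"
  let ?T = "edge_of ` set es"
  have "covering X R {..<n} ?act ?root ?rep base"
    unfolding X_def[abs_def] R_def[abs_def]
    by (rule valid_covering_locale[OF vc]) (use R1 R2 disj in \<open>auto simp: gens_of_def rels_of_def\<close>)
  then interpret covering X R "{..<n}" ?act ?root ?rep ?T base .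
  have T: "?T \<subseteq> {..<n} \<inter> ?T" and reached: "reached ?root ?rep base es" and dist: "distinct (map fst es)"
    using vt by (auto simp: valid_tree_def)
  have ks: "k \<in> words_over (X (side e)) \<and> foldr ?act k (vertex e) = vertex e"
    if "e \<in> set es" "k \<in> set (lookup [] tk (fst e))" for e k
    using vt that by (simp add: valid_tree_def words_over_iff X_def)
  have distb: "distinct (map fst bq)" using vt by (simp add: valid_tree_def)
  have str: "straight (side e) (vertex e) (word_of e) \<and> vertex e \<in> {..<n} \<and>
      ?root (side e) (vertex e) = vertex e" if "e \<in> set es" for e
    using straight_reached[OF reached T, of "side e" "vertex e" "word_of e" "edge_of e"] that
    by simp
  have bq: "q < n \<and> q \<notin> ?T \<and> (\<exists>a a'. w = a @ inv_word a' \<and> straight True q a \<and> straight False q a')"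
    if qw: "(q, w) \<in> set bq" for q w
  proof -
    obtain d d' where d: "d \<in> set es" "d' \<in> set es" "fst d = (True, ?root True q)"
      "fst d' = (False, ?root False q)" and q: "q < n" "q \<notin> ?T"
      and w: "w = (word_of d @ inv_word (?rep True q)) @ inv_word (word_of d' @ inv_word (?rep False q))"
      using vt qw unfolding valid_tree_def by fastforce
    have "straight True q (word_of d @ inv_word (?rep True q))"
      "straight False q (word_of d' @ inv_word (?rep False q))"
      using straight_point[of q True "word_of d"] straight_point[of q False "word_of d'"]
        str[OF d(1)] str[OF d(2)] d(3,4) q(1) by simp_all
    then show ?thesis using w q by blast
  qed
  define J where "J = fst ` set bq"
  define b where "b q = the (map_of bq q)" for q
  define g where "g v = fst (the (map_of es v))" for v
  define ksf where "ksf = lookup [] tk"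
  define K where "K v = generate G (c ` set (ksf v))" for v
  have b: "b q = w" if "(q, w) \<in> set bq" for q w using that distb by (simp add: b_def)
  have g: "g (fst e) = word_of e" if "e \<in> set es" for e
    using map_of_is_SomeI[OF dist, of "fst e" "snd e"] that by (simp add: g_def)
  have Jq: "q < n \<and> q \<notin> ?T \<and> (\<exists>a a'. b q = a @ inv_word a' \<and> straight True q a \<and> straight False q a')"
    if qJ: "q \<in> J" for q
  proof -
    obtain w where "(q, w) \<in> set bq" using qJ by (auto simp: J_def)
    then show ?thesis using bq[of q w] b[of q w] by simp
  qed
  have J: "J \<subseteq> {..<n} - ?T" "\<And>q. q \<in> J \<Longrightarrow> \<exists>a a'. b q = a @ inv_word a' \<and> straight True q a \<and> straight False q a'"
    using Jq by blast+
  have vs: "\<And>i v. (i, v) \<in> set (map fst es) \<Longrightarrow> v \<in> {..<n} \<and> ?root i v = v \<and> straight i v (g (i, v))"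
    "\<And>i v k. (i, v) \<in> set (map fst es) \<Longrightarrow> k \<in> set (ksf (i, v)) \<Longrightarrow>
      k \<in> words_over (X i) \<and> foldr ?act k v = v"
  proof -
    fix i v assume "(i, v) \<in> set (map fst es)"
    then obtain h r where e: "((i, v), h, r) \<in> set es" by auto
    show "v \<in> {..<n} \<and> ?root i v = v \<and> straight i v (g (i, v))"
      using str[OF e] g[OF e] by simp
    fix k assume "k \<in> set (ksf (i, v))"
    then show "k \<in> words_over (X i) \<and> foldr ?act k v = v"
      using ks[OF e] by (simp add: ksf_def)
  qed
  note fp = free_product[where ks = ksf and g = g and b = b, OF J dist vs]
  have img: "(\<lambda>q. c (b q)) ` J = c ` snd ` set bq"
  proof -
    have "(\<lambda>q. c (b q)) (fst z) = c (snd z)" if "z \<in> set bq" for z using b[of "fst z" "snd z"] that by simp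
    then show ?thesis unfolding J_def image_image by (rule image_cong[OF HOL.refl])
  qed
  define F where "F = generate G (c ` snd ` set bq)"
  have words: "word_of e \<in> words_over XX \<and> set (ksf (fst e)) \<subseteq> words_over XX" if "e \<in> set es" for e
    using str[OF that] ks[OF that] words_over_side by (auto simp: straight_def ksf_def)
  have bwords: "snd ` set bq \<subseteq> words_over XX"
    using bq by (force simp: straight_def words_over_append)
  let ?gens = "kurosh_generators es ksf bq"
  have gens: "set ?gens \<subseteq> words_over XX"
    using words bwords by (auto simp: set_kurosh_generators words_over_append subset_iff)
  have RR: "R True \<union> R False \<subseteq> words_over XX"
    using R words_over_side by blast
  have "generate G (c ` set hs) = generate G (c ` set ?gens)"
  proof
    have hs': "set hs \<subseteq> words_over XX" using hs by (simp add: XR)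
    have *: "set (gens_of ?p True @ gens_of ?p False) = XX"
      "set (rels_of ?p True @ rels_of ?p False) = R True \<union> R False" by (simp_all add: X_def R_def)
    have 1: "\<exists>z. witnesses XX (R True \<union> R False) (set ?gens) z h" if "h \<in> set hs" for h
      using vg that unfolding valid_generators_def * ksf_def by blast
    have 2: "\<exists>z. witnesses XX (R True \<union> R False) (set hs) z x" if "x \<in> set ?gens" for x
      using vg that unfolding valid_generators_def * ksf_def by blast
    show "generate G (c ` set hs) \<subseteq> generate G (c ` set ?gens)"
      using 1 witness_sound(2)[OF RR gens] gens
      by (intro generate_subgroup_incl generate_is_subgroup) (auto intro: pres_class_closed)
    show "generate G (c ` set ?gens) \<subseteq> generate G (c ` set hs)"
      using 2 witness_sound(2)[OF RR hs'] hs'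
      by (intro generate_subgroup_incl generate_is_subgroup) (auto intro: pres_class_closed)
  qed
  also have "\<dots> = generate G (\<Union> (set (F # map (\<lambda>e. conjugate G (c (word_of e)) (K (fst e))) es)))"
    unfolding F_def K_def by (rule generate_kurosh_generators[OF words bwords])
  finally have H: "generate G (c ` set hs) =
      generate G (\<Union> (set (F # map (\<lambda>e. conjugate G (c (word_of e)) (K (fst e))) es)))" .
  have maps: "map (\<lambda>v. conjugate G (c (g v)) (K v)) (map fst es) =
      map (\<lambda>e. conjugate G (c (word_of e)) (K (fst e))) es"
    using g by simp
  have out: "certificate_output cert = (map snd bq, map (\<lambda>e. (word_of e, ksf (fst e))) es)"
    by (simp add: certificate_output_def cert ksf_def)
  have basis: "free_basis G (c ` snd ` set bq) F"
    using fp(2) unfolding img F_def .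
  have "distinct (map (\<lambda>q. c (b q)) (map fst bq))"
    using fp(1) distb unfolding J_def by (simp only: distinct_map set_map)
  moreover have "map (\<lambda>q. c (b q)) (map fst bq) = map c (map snd bq)"
    using b by auto
  ultimately have dist_c: "distinct (map c (map snd bq))" by metis
  have product: "internal_free_product G (F # map (\<lambda>e. conjugate G (c (word_of e)) (K (fst e))) es)
      (generate G (c ` set hs))"
    using fp(3) unfolding H img F_def[symmetric] K_def[symmetric] maps by simp
  have sub: "c (word_of e) \<in> carrier G \<and> subgroup (K (fst e)) G \<and>
      (K (fst e) \<subseteq> c ` words_over (X True) \<or> K (fst e) \<subseteq> c ` words_over (X False))" if e: "e \<in> set es" for e
  proof -
    have "set (ksf (fst e)) \<subseteq> words_over (X (side e))" using ks[OF e] by (auto simp: ksf_def)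
    then have "K (fst e) \<subseteq> c ` words_over (X (side e))"
      unfolding K_def by (intro generate_words_over) (cases "side e"; auto)
    moreover have "subgroup (K (fst e)) G"
      unfolding K_def using words[OF e] by (intro generate_is_subgroup) (auto intro: pres_class_closed)
    ultimately show ?thesis
      using words[OF e] by (cases "side e") (auto intro: pres_class_closed)
  qed
  have ks_side: "set (ksf (fst e)) \<subseteq> words_over (X True) \<or> set (ksf (fst e)) \<subseteq> words_over (X False)"
    if "e \<in> set es" for e
    using ks[OF that] by (cases "side e") (auto simp: ksf_def)
  show ?thesis
    unfolding represents_kurosh_decomposition_def kurosh_decomposition_def Let_def out fst_conv snd_conv
    using basis dist_c product sub ks_side words bwords
    unfolding XR F_def K_def by (auto simp: comp_def image_image)
qed

section \<open>Every input has a valid certificate\<close>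

lemma pres_eq_mono:
  assumes "pres_eq X R v w" "X \<subseteq> X'" "R \<subseteq> R'"
  shows "pres_eq X' R' v w"
  using assms(1)
proof (induction rule: pres_eq.induct)
  case (cancel u v p)
  then show ?case
    using pres_eq.cancel[of u X' v p R'] assms(2) words_over_mono[OF assms(2)] by blast
qed (use assms(2,3) words_over_mono[OF assms(2)] in
    \<open>auto intro: pres_eq.refl pres_eq.sym pres_eq.trans pres_eq.relator\<close>)

text \<open>The class of a word in the factor determines its class in the larger group.\<close>

lemma finite_factor_image:
  assumes "finite (carrier (presented_group X R))" "X \<subseteq> X'" "R \<subseteq> R'"
  shows "finite (pres_class X' R' ` words_over X)"
proof -
  let ?r = "\<lambda>K. SOME w. w \<in> words_over X \<and> pres_class X R w = K"
  have "pres_class X' R' w \<in> (\<lambda>K. pres_class X' R' (?r K)) ` carrier (presented_group X R)"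
    if w: "w \<in> words_over X" for w
  proof (rule image_eqI)
    have r: "?r (pres_class X R w) \<in> words_over X \<and> pres_class X R (?r (pres_class X R w)) = pres_class X R w"
      using w by (rule_tac someI[where x = w]) simp
    then have "pres_eq X R w (?r (pres_class X R w))"
      using w pres_class_eq_iff[of w X "?r (pres_class X R w)" R] by simp
    from pres_eq_mono[OF this assms(2,3)] show "pres_class X' R' w = pres_class X' R' (?r (pres_class X R w))"
      using w r words_over_mono[OF assms(2)] by (subst pres_class_eq_iff) auto
    show "pres_class X R w \<in> carrier (presented_group X R)" using w by (rule pres_class_closed)
  qed
  then show ?thesis by (intro finite_surj[OF assms(1)] image_subsetI)
qed

text \<open>
  The functions of the finite coset model are replaced by tables before the spanning tree is chosen,
  so that the tree refers to the functions that the test uses.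
\<close>

theorem valid_certificate_exists:
  assumes R1: "set R1 \<subseteq> words_over (set X1)" and R2: "set R2 \<subseteq> words_over (set X2)"
    and disj: "set X1 \<inter> set X2 = {}"
    and fin1: "finite (carrier (presented_group (set X1) (set R1)))"
    and fin2: "finite (carrier (presented_group (set X2) (set R2)))"
    and hs: "set hs \<subseteq> words_over (set X1 \<union> set X2)"
  shows "\<exists>cert. valid_certificate (((X1, R1), (X2, R2)), hs) cert"
proof -
  let ?p = "((X1, R1), (X2, R2))"
  define X where "X i = set (gens_of ?p i)" for i
  define R where "R i = set (rels_of ?p i)" for i
  have XR: "X True = set X1" "X False = set X2" "R True = set R1" "R False = set R2"
    by (simp_all add: X_def R_def gens_of_def rels_of_def)
  have "finite (pres_class (X True \<union> X False) (R True \<union> R False) ` words_over (X i))" for i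
    using finite_factor_image[OF fin1, of "X True \<union> X False" "R True \<union> R False"]
      finite_factor_image[OF fin2, of "X True \<union> X False" "R True \<union> R False"]
    by (cases i) (auto simp: XR)
  moreover have "R i \<subseteq> words_over (X i)" for i using R1 R2 by (cases i) (simp_all add: XR)
  ultimately have "finite_free_factors X R hs"
    by unfold_locales (use disj hs in \<open>auto simp: XR\<close>)
  then obtain n act root rep base \<nu> E where
    model: "kurosh_model X R {..<n :: nat} act root rep base hs \<nu> E"
    by (rule finite_free_factors.nat_model_exists)
  define ta where "ta = map (\<lambda>k. (k, act (fst k) (snd k)))
    (List.product (List.product (X1 @ X2) [True, False]) [0..<n])"
  define tr where "tr = map (\<lambda>k. (k, root (fst k) (snd k), rep (fst k) (snd k)))
    (List.product [True, False] [0..<n])"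
  have id: "inv_into {..<n} (\<lambda>q. q) q = q" if "q < n" for q
    using that inv_into_f_f[of "\<lambda>q. q" "{..<n}" q] by (simp add: inj_on_def)
  have "kurosh_model X R {..<n} (act_tab ta) (root_tab tr) (rep_tab tr) base hs
      (\<lambda>q. \<nu> (inv_into {..<n} (\<lambda>q. q) q)) ((\<lambda>q. q) ` E)"
  proof (rule kurosh_model_transport[OF model])
    show "bij_betw (\<lambda>q. q) {..<n} {..<n}" by (simp add: bij_betw_def inj_on_def)
    fix q assume q: "q \<in> {..<n}"
    { fix l :: "nat \<times> bool" assume "fst l \<in> X True \<union> X False"
      then have "(l, q) \<in> set (List.product (List.product (X1 @ X2) [True, False]) [0..<n])"
        using q by (cases l) (auto simp: XR)
      then show "act_tab ta l q = act l (inv_into {..<n} (\<lambda>q. q) q)"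
        using lookup_map[of "(l, q)" _ q "\<lambda>k. act (fst k) (snd k)"] q id
        by (simp add: act_tab_def ta_def) }
    fix i :: bool
    have "(i, q) \<in> set (List.product [True, False] [0..<n])" using q by auto
    from lookup_map[OF this, of "(q, [])" "\<lambda>k. (root (fst k) (snd k), rep (fst k) (snd k))"]
    show "root_tab tr i q = root i (inv_into {..<n} (\<lambda>q. q) q)"
      "rep_tab tr i q = rep i (inv_into {..<n} (\<lambda>q. q) q)"
      using q id by (simp_all add: root_tab_def rep_tab_def tr_def)
  qed
  then interpret kurosh_model X R "{..<n}" "act_tab ta" "root_tab tr" "rep_tab tr" base hs
    "\<lambda>q. \<nu> (inv_into {..<n} (\<lambda>q. q) q)" "(\<lambda>q. q) ` E" .
  obtain es ks bs where
    data: "reached (root_tab tr) (rep_tab tr) base es" "distinct (map fst es)" "edge_of ` set es \<subseteq> {..<n}"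
    and ks: "\<And>e k. e \<in> set es \<Longrightarrow> k \<in> set (ks (fst e)) \<Longrightarrow>
       k \<in> words_over (X (side e)) \<and> foldr (act_tab ta) k (vertex e) = vertex e"
    and distb: "distinct (map fst bs)"
    and bs: "\<And>q b. (q, b) \<in> set bs \<Longrightarrow> q \<in> {..<n} \<and> q \<notin> edge_of ` set es \<and>
       (\<exists>d\<in>set es. \<exists>d'\<in>set es. fst d = (True, root_tab tr True q) \<and> fst d' = (False, root_tab tr False q) \<and>
          b = (word_of d @ inv_word (rep_tab tr True q)) @
            inv_word (word_of d' @ inv_word (rep_tab tr False q)))"
    and gens: "set (kurosh_generators es ks bs) \<subseteq> words_over XX"
    and H: "generate G (c ` set (kurosh_generators es ks bs)) = generate G (c ` set hs)"
    by (rule kurosh_data_exists) blast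
  define tk where "tk = map (\<lambda>v. (v, ks v)) (map fst es)"
  have tk: "lookup [] tk (fst e) = ks (fst e)" if "e \<in> set es" for e
    unfolding tk_def using that by (intro lookup_map) simp
  have gens_eq: "kurosh_generators es (lookup [] tk) bs = kurosh_generators es ks bs"
    unfolding kurosh_generators_def using tk by (intro arg_cong2[where f = "(@)"] arg_cong[where f = concat] map_cong) simp_all
  have "valid_covering ?p n base ta tr"
    unfolding valid_covering_def
    using base act act_inverse act_relator root root_act rep rep_root rep_of_root
    by (auto simp: X_def R_def words_over_iff)
  moreover have "valid_tree ?p n base ta tr es tk bs"
    unfolding valid_tree_def
  proof (intro conjI ballI)
    fix b assume "b \<in> set bs"
    with bs[of "fst b" "snd b"]
    show "fst b < n" "fst b \<notin> set (map edge_of es)"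
      "\<exists>d\<in>set es. \<exists>d'\<in>set es. fst d = (True, root_tab tr True (fst b)) \<and>
           fst d' = (False, root_tab tr False (fst b)) \<and>
           snd b = (word_of d @ inv_word (rep_tab tr True (fst b))) @
             inv_word (word_of d' @ inv_word (rep_tab tr False (fst b)))" by simp_all
  qed (use data ks tk distb in \<open>auto simp: X_def words_over_iff\<close>)
  moreover
  have hs': "set hs \<subseteq> words_over XX" using hs by (simp add: XR)
  let ?gens = "kurosh_generators es ks bs"
  have 1: "\<exists>z. witnesses XX (R True \<union> R False) (set ?gens) z h" if "h \<in> set hs" for h
    using that hs' by (intro witness_complete[OF gens]) (auto simp: H intro: generate.incl)
  have 2: "\<exists>z. witnesses XX (R True \<union> R False) (set hs) z x" if "x \<in> set ?gens" for x
    using that gens by (intro witness_complete[OF hs']) (auto simp: H[symmetric] intro: generate.incl)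
  define zs where "zs = map (\<lambda>h. SOME z. witnesses XX (R True \<union> R False) (set ?gens) z h) hs @
    map (\<lambda>x. SOME z. witnesses XX (R True \<union> R False) (set hs) z x) ?gens"
  have "valid_generators ?p hs ?gens zs"
  proof -
    have *: "set (gens_of ?p True @ gens_of ?p False) = XX"
      "set (rels_of ?p True @ rels_of ?p False) = R True \<union> R False" by (simp_all add: X_def R_def)
    show ?thesis
      unfolding valid_generators_def * zs_def using someI_ex[OF 1] someI_ex[OF 2] by fastforce
  qed
  ultimately have "valid_certificate (?p, hs) (((n, base), ta, tr), (es, tk, bs), zs)"
    by (simp add: valid_certificate_def gens_eq)
  then show ?thesis by blast
qed

section \<open>The algorithm\<close>

lemma enc_nat_list: "enc (xs :: nat list) = list_encode xs"
  by (simp add: enc_list_def map_idI)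

lemma enc_word: "enc (w :: nat word) = word_encode w"
  by (simp add: enc_list_def word_encode_def case_prod_unfold list_encode_eq)

lemma enc_words: "enc (ws :: nat word list) = words_encode ws"
  by (simp add: enc_list_def[of ws] words_encode_def enc_word list_encode_eq)

lemma enc_kurosh: "enc (bs :: nat word list, L :: (nat word \<times> nat word list) list) = kurosh_encode bs L"
  by (simp add: kurosh_encode_def enc_words enc_list_def[of L] enc_word case_prod_unfold list_encode_eq)

text \<open>
  The program packs its five arguments into one code, searches for a certificate, and extracts
  the decomposition from the certificate that it finds.
\<close>

theorem theorem6p4:
  "\<exists>algorithm :: recf. \<forall>(X1 :: nat list) (R1 :: nat word list) (X2 :: nat list) (R2 :: nat word list)
       (hs :: nat word list).
     set R1 \<subseteq> words_over (set X1) \<longrightarrow>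
     set R2 \<subseteq> words_over (set X2) \<longrightarrow>
     set X1 \<inter> set X2 = {} \<longrightarrow>
     finite (carrier (presented_group (set X1) (set R1))) \<longrightarrow>
     finite (carrier (presented_group (set X2) (set R2))) \<longrightarrow>
     set hs \<subseteq> words_over (set X1 \<union> set X2) \<longrightarrow>
     (\<exists>bs L.
        computes algorithm
          [list_encode X1, words_encode R1, list_encode X2, words_encode R2, words_encode hs]
          (kurosh_encode bs L) \<and>
        represents_kurosh_decomposition (set X1) (set R1) (set X2) (set R2) hs bs L)"
proof -
  obtain p where p: "\<And>i. \<exists>c. valid_certificate i c \<Longrightarrow>
      \<exists>c. valid_certificate i c \<and> computes p [enc i] (enc (certificate_output c))"
    using search_program[OF enumerable_kurosh_certificate computable_valid_certificate computable_certificate_output]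
    by blast
  obtain r where r: "\<And>x y. computes r [x, y] (prod_encode (x, y))"
    using recursive_pair_program by blast
  let ?algorithm = "Comp p [Comp r [Comp r [Comp r [Proj 0, Proj 1], Comp r [Proj 2, Proj 3]], Proj 4]]"
  show ?thesis
  proof (intro exI[of _ ?algorithm] allI impI)
    fix X1 X2 :: "nat list" and R1 R2 hs :: "nat word list"
    assume asms: "set R1 \<subseteq> words_over (set X1)" "set R2 \<subseteq> words_over (set X2)" "set X1 \<inter> set X2 = {}"
      "finite (carrier (presented_group (set X1) (set R1)))"
      "finite (carrier (presented_group (set X2) (set R2)))"
      "set hs \<subseteq> words_over (set X1 \<union> set X2)"
    let ?i = "(((X1, R1), (X2, R2)), hs)"
    let ?xs = "[list_encode X1, words_encode R1, list_encode X2, words_encode R2, words_encode hs]"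
    obtain cert where cert: "valid_certificate ?i cert"
      and comp: "computes p [enc ?i] (enc (certificate_output cert))"
      using p[OF valid_certificate_exists[OF asms]] by blast
    have proj: "computes (Proj j) ?xs (?xs ! j)" if "j < 5" for j
      using that by (intro computes.Proj) simp
    have "computes (Comp r [Comp r [Comp r [Proj 0, Proj 1], Comp r [Proj 2, Proj 3]], Proj 4]) ?xs (enc ?i)"
      using computes_Comp2[OF computes_Comp2[OF computes_Comp2[OF proj[of 0] proj[of 1] r]
          computes_Comp2[OF proj[of 2] proj[of 3] r] r] proj[of 4] r]
      by (simp add: enc_nat_list enc_words)
    then have "computes ?algorithm ?xs (enc (certificate_output cert))"
      using comp by (rule computes_Comp1)
    then show "\<exists>bs L. computes ?algorithm ?xs (kurosh_encode bs L) \<and>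
        represents_kurosh_decomposition (set X1) (set R1) (set X2) (set R2) hs bs L"
      using valid_certificate_sound[OF asms(1-3,6) cert]
      by (intro exI[of _ "fst (certificate_output cert)"] exI[of _ "snd (certificate_output cert)"])
        (simp add: enc_kurosh[symmetric])
  qed
qed

end
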